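(* Let $K$ be a field, $S=K[x,y]$, and let $I\subset S$ be a nonzero proper monomial ideal such that $R=S/I$ is Cohen-Macaulay. Let $X$ be a Hilbert-Burch matrix of $I$, and let $\mu(I)$ be the minimal number of generators of $I$. Then $$\operatorname{tr}(\omega_R)=I_{\mu(I)-2}(X)/I .$$
   Context: $\omega_R$ is the canonical module of the Cohen-Macaulay positively graded $K$-algebra $R$, and the canonical trace is the ideal $\operatorname{tr}(\omega_R)=\sum_{\varphi\in\operatorname{Hom}_R(\omega_R,R)}\varphi(\omega_R)$ of $R$. With $m=\mu(I)$, the ideal $I$ has a minimal free resolution $0\to S^{m-1}\xrightarrow{\varphi}S^m\to I\to0$; a Hilbert-Burch matrix of $I$ is an $m\times(m-1)$ matrix $X$ representing $\varphi$ with respect to some bases. $I_j(X)$ denotes the ideal generated by the $j\times j$ minors of $X$, with the convention $I_j(X)=S$ for $j\le 0$ (so for $m=1$ or $m=2$ the right-hand side is $R$). *)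

theory Defs
  imports
    "HOL-Algebra.QuotRing"
    "HOL-Library.Extended_Nat"
    "Jordan_Normal_Form.VS_Connect"
    "Jordan_Normal_Form.Matrix_Kernel"
    "Jordan_Normal_Form.DL_Submatrix"
begin

text \<open>
  The polynomial ring \<open>S = K[x,y]\<close> is the type \<open>'k poly poly\<close>, i.e. \<open>K[x][y]\<close>; as an object of
  \<open>HOL-Algebra\<close> it is \<open>class_ring\<close>, and \<open>R = S/I\<close> is the ring \<open>class_ring Quot I\<close>.
  Modules are \<open>HOL-Algebra\<close> modules; free modules are the vectors of the matrix library.
\<close>

section \<open>Ideals of the polynomial ring\<close>

abbreviation varx :: "'k::field poly poly" where
  "varx \<equiv> [:[:0, 1:]:]"

abbreviation vary :: "'k::field poly poly" where
  "vary \<equiv> [:0, 1:]"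

definition monomial_ideal :: "'k::field poly poly set \<Rightarrow> bool" where
  "monomial_ideal I \<longleftrightarrow>
     (\<exists>E :: (nat \<times> nat) set. I = Idl\<^bsub>class_ring\<^esub> ((\<lambda>(a, b). varx ^ a * vary ^ b) ` E))"

definition irrelevant_ideal :: "'k::field poly poly set" where
  "irrelevant_ideal = Idl\<^bsub>class_ring\<^esub> {varx, vary}"

text \<open>\<open>\<mu>(I)\<close>; meaningful for finitely generated \<open>I\<close>, hence for every ideal of \<open>S\<close>.\<close>

definition min_gens :: "'a::comm_ring_1 set \<Rightarrow> nat" where
  "min_gens I = (LEAST n. \<exists>G. finite G \<and> card G = n \<and> I = Idl\<^bsub>class_ring\<^esub> G)"

text \<open>\<open>I\<^sub>j(X)\<close>, with an integer index so that the convention for \<open>j \<le> 0\<close> is explicit.\<close>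

definition minors_ideal :: "'a::comm_ring_1 mat \<Rightarrow> int \<Rightarrow> 'a set" where
  "minors_ideal X j =
     (if j \<le> 0 then UNIV
      else Idl\<^bsub>class_ring\<^esub> {det (submatrix X A B) | A B.
             A \<subseteq> {..<dim_row X} \<and> B \<subseteq> {..<dim_col X} \<and> int (card A) = j \<and> int (card B) = j})"

section \<open>Krull dimension, depth and Cohen-Macaulayness\<close>

definition krull_dim :: "('a, 'c) ring_scheme \<Rightarrow> enat" where
  "krull_dim R =
     Sup {enat n | n. \<exists>P :: nat \<Rightarrow> 'a set.
       (\<forall>i\<le>n. primeideal (P i) R) \<and> (\<forall>i<n. P i \<subset> P (Suc i))}"

definition regular_sequence :: "('a, 'c) ring_scheme \<Rightarrow> 'a list \<Rightarrow> bool" where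
  "regular_sequence R xs \<longleftrightarrow>
     set xs \<subseteq> carrier R \<and>
     Idl\<^bsub>R\<^esub> (set xs) \<noteq> carrier R \<and>
     (\<forall>i<length xs. \<forall>b\<in>carrier R.
        xs ! i \<otimes>\<^bsub>R\<^esub> b \<in> Idl\<^bsub>R\<^esub> (set (take i xs)) \<longrightarrow> b \<in> Idl\<^bsub>R\<^esub> (set (take i xs)))"

definition depth_in :: "'a set \<Rightarrow> ('a, 'c) ring_scheme \<Rightarrow> enat" where
  "depth_in \<mm> R = Sup {enat (length xs) | xs. regular_sequence R xs \<and> set xs \<subseteq> \<mm>}"

text \<open>
  \<open>R = S/I\<close> is a positively graded \<open>K\<close>-algebra with graded maximal ideal \<open>(x,y)R\<close>.
  As usual for such algebras, the depth of \<open>R\<close> is the maximal length of an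
  \<open>R\<close>-regular sequence in the graded maximal ideal, and \<open>R\<close> is Cohen-Macaulay iff
  depth and Krull dimension agree.
\<close>

definition cohen_macaulay_quot :: "'k::field poly poly set \<Rightarrow> bool" where
  "cohen_macaulay_quot I \<longleftrightarrow>
     depth_in ((\<lambda>f. I +>\<^bsub>class_ring\<^esub> f) ` irrelevant_ideal) (class_ring Quot I)
       = krull_dim (class_ring Quot I)"

section \<open>Hilbert-Burch matrices\<close>

definition mat_image :: "'a::comm_ring_1 mat \<Rightarrow> 'a vec set" where
  "mat_image A = (\<lambda>v. A *\<^sub>v v) ` carrier_vec (dim_col A)"

text \<open>
  \<open>X\<close> is the matrix of \<open>\<phi>\<close> in a minimal free resolution
  \<open>0 \<rightarrow> S\<^sup>m\<^sup>-\<^sup>1 \<rightarrow> S\<^sup>m \<rightarrow> I \<rightarrow> 0\<close>, \<open>m = \<mu>(I)\<close>. The augmentation \<open>S\<^sup>m \<rightarrow> I\<close> is \<open>v \<mapsto> f \<bullet> v\<close>, the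
  coordinates of \<open>f\<close> being the images of the basis vectors. Minimality means that the image
  of \<open>\<phi>\<close> lies in \<open>(x,y)S\<^sup>m\<close>. Changing bases of the two free modules changes \<open>X\<close> and \<open>f\<close>
  into data of the same kind, so matrices with respect to all bases are covered.
\<close>

definition hilbert_burch_matrix :: "'k::field poly poly set \<Rightarrow> 'k poly poly mat \<Rightarrow> bool" where
  "hilbert_burch_matrix I X \<longleftrightarrow>
     (let m = min_gens I in
        X \<in> carrier_mat m (m - 1) \<and>
        (\<exists>f \<in> carrier_vec m.
           (\<lambda>v. f \<bullet> v) ` carrier_vec m = I \<and>
           {v \<in> carrier_vec m. f \<bullet> v = 0} = mat_image X) \<and>
        mat_kernel X = {0\<^sub>v (m - 1)} \<and>
        (\<forall>i<m. \<forall>j<m - 1. X $$ (i, j) \<in> irrelevant_ideal))"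

section \<open>The canonical module and its trace\<close>

definition regular_module :: "('a, 'c) ring_scheme \<Rightarrow> ('a, 'a) module" where
  "regular_module R =
     \<lparr>carrier = carrier R, monoid.mult = (\<otimes>\<^bsub>R\<^esub>), one = \<one>\<^bsub>R\<^esub>, zero = \<zero>\<^bsub>R\<^esub>, add = (\<oplus>\<^bsub>R\<^esub>),
      smult = (\<otimes>\<^bsub>R\<^esub>)\<rparr>"

definition restrict_scalars ::
    "('a \<Rightarrow> 'b) \<Rightarrow> ('b, 'm, 'c) module_scheme \<Rightarrow> ('a, 'm) module" where
  "restrict_scalars h M =
     \<lparr>carrier = carrier M, monoid.mult = (\<otimes>\<^bsub>M\<^esub>), one = \<one>\<^bsub>M\<^esub>, zero = \<zero>\<^bsub>M\<^esub>, add = (\<oplus>\<^bsub>M\<^esub>),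
      smult = (\<lambda>r x. h r \<odot>\<^bsub>M\<^esub> x)\<rparr>"

text \<open>As in \<^const>\<open>module_vec\<close>, the multiplicative fields of the record play no role.\<close>

definition quotient_module :: "('a, 'm, 'c) module_scheme \<Rightarrow> 'm set \<Rightarrow> ('a, 'm set) module" where
  "quotient_module M N =
     \<lparr>carrier = a_rcosets\<^bsub>M\<^esub> N, monoid.mult = undefined, one = undefined, zero = N, add = set_add M,
      smult = (\<lambda>r X. \<Union>x\<in>X. N +>\<^bsub>M\<^esub> (r \<odot>\<^bsub>M\<^esub> x))\<rparr>"

text \<open>
  \<open>\<dots> \<rightarrow> S\<^sup>r\<^sup>2 \<rightarrow> S\<^sup>r\<^sup>1 \<rightarrow> S\<^sup>r\<^sup>0 \<rightarrow> M \<rightarrow> 0\<close>, a resolution of \<open>M\<close> by finite free modules, of ranks \<open>r i\<close>,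
  where \<open>A i\<close> is the matrix of the differential from degree \<open>i + 1\<close> to degree \<open>i\<close>.
\<close>

definition free_resolution ::
    "('a::comm_ring_1, 'm, 'c) module_scheme \<Rightarrow> (nat \<Rightarrow> nat) \<Rightarrow> (nat \<Rightarrow> 'a mat) \<Rightarrow> bool" where
  "free_resolution M r A \<longleftrightarrow>
     (\<forall>i. A i \<in> carrier_mat (r i) (r (Suc i))) \<and>
     (\<exists>\<epsilon> \<in> module_hom class_ring (module_vec TYPE('a) (r 0)) M.
        \<epsilon> ` carrier_vec (r 0) = carrier M \<and>
        {v \<in> carrier_vec (r 0). \<epsilon> v = \<zero>\<^bsub>M\<^esub>} = mat_image (A 0)) \<and>
     (\<forall>i. mat_kernel (A i) = mat_image (A (Suc i)))"

text \<open>
  \<open>Ext\<^sup>i(M, S)\<close>, the cohomology in degree \<open>i\<close> of the dual of the resolution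
  \<open>(r, A)\<close> of \<open>M\<close>; the dual of a map between free modules is given by the transposed matrix.
\<close>

definition ext_of_resolution ::
    "(nat \<Rightarrow> nat) \<Rightarrow> (nat \<Rightarrow> 'a::comm_ring_1 mat) \<Rightarrow> nat \<Rightarrow> ('a, 'a vec set) module" where
  "ext_of_resolution r A i =
     quotient_module
       ((module_vec TYPE('a) (r i))\<lparr>carrier := mat_kernel (transpose_mat (A i))\<rparr>)
       (case i of 0 \<Rightarrow> {0\<^sub>v (r 0)} | Suc j \<Rightarrow> mat_image (transpose_mat (A j)))"

text \<open>
  An \<open>R\<close>-module \<open>W\<close> is a canonical module of \<open>R = S/I\<close> iff \<open>W\<close> is isomorphic to
  \<open>Ext\<^sup>2\<^sup>-\<^sup>d(R, S)\<close>, where \<open>2 = dim S\<close> and \<open>d = dim R\<close>. Only the ungraded module matters for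
  the trace, so the degree shift of \<open>\<omega>\<^sub>S = S(-deg x - deg y)\<close> is not recorded.
\<close>

definition canonical_module ::
    "'k::field poly poly set \<Rightarrow> ('k poly poly set, 'w) module \<Rightarrow> bool" where
  "canonical_module I W \<longleftrightarrow>
     Module.module (class_ring Quot I) W \<and>
     (\<exists>d r A h.
        krull_dim (class_ring Quot I) = enat d \<and>
        free_resolution
          (restrict_scalars (\<lambda>s. I +>\<^bsub>class_ring\<^esub> s) (regular_module (class_ring Quot I))) r A \<and>
        h \<in> module_hom class_ring (ext_of_resolution r A (2 - d))
              (restrict_scalars (\<lambda>s. I +>\<^bsub>class_ring\<^esub> s) W) \<and>
        bij_betw h (carrier (ext_of_resolution r A (2 - d))) (carrier W))"

text \<open>The sum of the ideals \<open>\<phi>(M)\<close>, \<open>\<phi> \<in> Hom\<^sub>R(M, R)\<close>, is the ideal generated by their union.\<close>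

definition trace_ideal :: "('a, 'c) ring_scheme \<Rightarrow> ('a, 'm, 'd) module_scheme \<Rightarrow> 'a set" where
  "trace_ideal R M = Idl\<^bsub>R\<^esub> (\<Union>\<phi>\<in>module_hom R M (regular_module R). \<phi> ` carrier M)"

end

theory Submission
  imports Defs "HOL-Computational_Algebra.Polynomial_Factorial"
begin

text \<open>
  Write \<open>S = K[x,y]\<close>, \<open>R = S/I\<close>, \<open>m = \<mu>(I)\<close>.  There are two cases.

  If \<open>I\<close> is principal, then \<open>d = dim R = 1\<close> and \<open>\<omega> = Ext\<^sup>1(R, S)\<close> is isomorphic to \<open>R\<close>. Its trace is
  \<open>R\<close>, in accordance with \<open>I\<^sub>j(X) = S\<close> for \<open>j \<le> 0\<close> (\<open>trace_of_principal_quotient\<close>).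

  If \<open>I\<close> is not principal, then \<open>R\<close> has a monomial in its socle, at an inner corner of the staircase
  of \<open>I\<close> (\<open>monomial_ideal_principal_or_socle\<close>). So \<open>depth R = 0\<close>, and \<open>d = 0\<close> because \<open>R\<close> is
  Cohen-Macaulay; in particular \<open>I\<close> contains powers of \<open>x\<close> and of \<open>y\<close>. Now \<open>\<omega> = Ext\<^sup>2(R, S)\<close>, and by
  the comparison theorem for resolutions every free resolution \<open>0 \<rightarrow> S\<^sup>q \<rightarrow> S\<^sup>p \<rightarrow> S\<close> of \<open>R\<close> with matrix
  \<open>Y\<close> of the first map exhibits \<open>\<omega>\<close> as the cokernel of the transpose of \<open>Y\<close>
  (\<open>canonical_module_linear_cover\<close>). Functionals on this cokernel with values in \<open>R\<close> are the vectors
  \<open>w\<close> with \<open>Y w \<in> I S\<^sup>p\<close>, taken modulo \<open>I\<close>. Thus the trace is generated by the entries of all such \<open>w\<close>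
  (\<open>coset_mem_trace_ideal\<close>, \<open>trace_ideal_subset\<close>). The two inclusions use two different
  resolutions.

  \<^item> The trace contains \<open>I\<^sub>m\<^sub>-\<^sub>2(X)\<close>: take \<open>Y = X\<close>. Fix \<open>m - 2\<close> rows of \<open>X\<close> and let \<open>w\<close> be the vector of
    their signed \<open>(m - 2)\<close>-minors. The entries of \<open>X w\<close> are maximal minors of \<open>X\<close>, and these lie in
    \<open>I\<close> by the argument of Hilbert and Burch (\<open>minor_is_entry\<close>, \<open>maximal_minor_mem\<close>).

  \<^item> The trace is contained in \<open>I\<^sub>m\<^sub>-\<^sub>2(X)\<close>: take the resolution of the monomials \<open>x\<^sup>l y\<^sup>\<beta>\<^sup>l\<close>, \<open>l = 0, \<dots>, N\<close>,
    where \<open>\<beta>\<^sub>l\<close> is the least exponent with \<open>x\<^sup>l y\<^sup>\<beta>\<^sup>l \<in> I\<close> and \<open>\<beta>\<^sub>N = 0\<close>. Its matrix \<open>X\<^sub>0\<close> is bidiagonal.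
    Following a monomial of an entry of \<open>w\<close> through the rows of \<open>X\<^sub>0 w\<close> shows that it is a multiple of
    the determinant of a matrix all but two of whose columns are relations of the monomials
    (\<open>exponents_of_kernel_entry\<close>, \<open>staircase_monomial_mem_minors\<close>). Such determinants generate a
    Fitting ideal of \<open>I\<close>. It depends on \<open>I\<close> only, and so it is contained in \<open>I\<^sub>m\<^sub>-\<^sub>2(X)\<close>
    (\<open>fitting_ideal_transfer\<close>).

  The passage through Fitting ideals avoids any comparison of \<open>X\<close> with \<open>X\<^sub>0\<close> by base change: the two
  matrices may differ in size, and \<open>X\<close> need not be homogeneous.
\<close>

section \<open>Ideals of a commutative ring and their quotients\<close>

lemma class_cring_inv: "a_inv (class_ring :: 'a::comm_ring_1 ring) = uminus"
  by (rule class_ring_simps)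

lemma class_idealI:
  fixes J :: "'a::comm_ring_1 set"
  assumes "0 \<in> J" "\<And>a b. a \<in> J \<Longrightarrow> b \<in> J \<Longrightarrow> a + b \<in> J" "\<And>r a. a \<in> J \<Longrightarrow> r * a \<in> J"
  shows "ideal J class_ring"
proof (rule idealI)
  show "ring (class_ring :: 'a ring)" by (rule class_ring.ring_axioms)
  have m: "- a \<in> J" if "a \<in> J" for a using assms(3)[OF that, of "-1"] by simp
  show "subgroup J (add_monoid class_ring)"
  proof (rule group.subgroupI)
    show "group (add_monoid (class_ring :: 'a ring))"
      using abelian_group.a_group[OF class_ring.abelian_group_axioms] .
    fix a assume "a \<in> J"
    then show "inv\<^bsub>add_monoid class_ring\<^esub> a \<in> J"
      using m[of a] unfolding a_inv_def[symmetric] class_cring_inv by simp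
  qed (use assms in auto)
qed (use assms in \<open>auto simp: mult.commute\<close>)

lemma
  fixes J :: "'a::comm_ring_1 set"
  assumes J: "ideal J class_ring"
  shows class_ideal_zero: "0 \<in> J"
    and class_ideal_add: "a \<in> J \<Longrightarrow> b \<in> J \<Longrightarrow> a + b \<in> J"
    and class_ideal_mult: "a \<in> J \<Longrightarrow> r * a \<in> J"
    and class_ideal_uminus: "a \<in> J \<Longrightarrow> - a \<in> J"
    and class_ideal_diff: "a \<in> J \<Longrightarrow> b \<in> J \<Longrightarrow> a - b \<in> J"
proof -
  interpret ideal J class_ring by (rule J)
  show "0 \<in> J" using zero_closed by simp
  show A: "a \<in> J \<Longrightarrow> b \<in> J \<Longrightarrow> a + b \<in> J" for a b using a_closed by simp
  show M: "a \<in> J \<Longrightarrow> r * a \<in> J" for a r using I_l_closed by simp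
  show U: "a \<in> J \<Longrightarrow> - a \<in> J" for a using M[of a "-1"] by simp
  show "a \<in> J \<Longrightarrow> b \<in> J \<Longrightarrow> a - b \<in> J" using A[of a "-b"] U by simp
qed

lemma class_ideal_sum:
  fixes J :: "'a::comm_ring_1 set"
  assumes "ideal J class_ring" "\<And>i. i \<in> A \<Longrightarrow> f i \<in> J"
  shows "sum f A \<in> J"
  using assms(2)
  by (induction A rule: infinite_finite_induct)
     (auto simp: class_ideal_zero[OF assms(1)] class_ideal_add[OF assms(1)])

lemma class_ideal_mult_right:
  fixes J :: "'a::comm_ring_1 set"
  assumes "ideal J class_ring" "a \<in> J"
  shows "a * r \<in> J"
  using class_ideal_mult[OF assms, of r] by (simp add: mult.commute)

lemma class_ideal_dvd:
  fixes J :: "'a::comm_ring_1 set"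
  assumes "ideal J class_ring" "a \<in> J" "a dvd b"
  shows "b \<in> J"
  using assms by (auto simp: class_ideal_mult_right elim!: dvdE)

lemma class_ideal_one_imp_UNIV:
  fixes J :: "'a::comm_ring_1 set"
  assumes "ideal J class_ring" "1 \<in> J"
  shows "J = UNIV"
  using class_ideal_mult[OF assms] by auto

lemma class_ideal_UNIV: "ideal (UNIV :: 'a::comm_ring_1 set) class_ring"
  by (rule class_idealI) auto

lemma ideal_Idl: "ideal (Idl\<^bsub>class_ring\<^esub> (G :: 'a::comm_ring_1 set)) class_ring"
  by (rule ring.genideal_ideal[OF class_ring.ring_axioms]) simp

lemma Idl_superset: "(G :: 'a::comm_ring_1 set) \<subseteq> Idl\<^bsub>class_ring\<^esub> G"
  by (rule ring.genideal_self[OF class_ring.ring_axioms]) simp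

lemma Idl_least:
  fixes J :: "'a::comm_ring_1 set"
  assumes "ideal J class_ring" "G \<subseteq> J"
  shows "Idl\<^bsub>class_ring\<^esub> G \<subseteq> J"
  by (rule ring.genideal_minimal[OF class_ring.ring_axioms assms])

lemma Idl_singleton: "Idl\<^bsub>class_ring\<^esub> {g :: 'a::comm_ring_1} = {f. g dvd f}"
proof
  show "Idl\<^bsub>class_ring\<^esub> {g} \<subseteq> {f. g dvd f}"
    by (rule Idl_least) (auto intro!: class_idealI)
  show "{f. g dvd f} \<subseteq> Idl\<^bsub>class_ring\<^esub> {g}"
    using class_ideal_dvd[OF ideal_Idl] Idl_superset[of "{g}"] by auto
qed

abbreviation coset :: "'a::comm_ring_1 set \<Rightarrow> 'a \<Rightarrow> 'a set" where
  "coset I a \<equiv> I +>\<^bsub>class_ring\<^esub> a"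

lemma coset_eq_iff:
  assumes I: "ideal I class_ring"
  shows "coset I a = coset I b \<longleftrightarrow> a - b \<in> I"
proof -
  have *: "coset I a = {h + a | h. h \<in> I}" for a
    by (auto simp: a_r_coset_def r_coset_def)
  show ?thesis
  proof
    assume "coset I a = coset I b"
    moreover have "0 + a \<in> coset I a" using class_ideal_zero[OF I] unfolding * by blast
    ultimately obtain h where "a = h + b" "h \<in> I" unfolding * by auto
    then show "a - b \<in> I" by simp
  next
    have sub: "coset I a \<subseteq> coset I b" if "a - b \<in> I" for a b
    proof
      fix x assume "x \<in> coset I a"
      then obtain h where "x = h + a" "h \<in> I" unfolding * by auto
      then have "x = (h + (a - b)) + b" "h + (a - b) \<in> I"
        using that by (auto intro: class_ideal_add[OF I])
      then show "x \<in> coset I b" unfolding * by blast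
    qed
    assume "a - b \<in> I"
    then show "coset I a = coset I b"
      using sub[of a b] sub[of b a] class_ideal_uminus[OF I, of "a - b"] by auto
  qed
qed

lemma
  assumes I: "ideal I class_ring"
  shows carrier_Quot: "carrier (class_ring Quot I) = range (coset I)"
    and add_Quot: "coset I a \<oplus>\<^bsub>class_ring Quot I\<^esub> coset I b = coset I (a + b)"
    and mult_Quot: "coset I a \<otimes>\<^bsub>class_ring Quot I\<^esub> coset I b = coset I (a * b)"
    and zero_Quot: "\<zero>\<^bsub>class_ring Quot I\<^esub> = coset I 0"
    and one_Quot: "\<one>\<^bsub>class_ring Quot I\<^esub> = coset I 1"
proof -
  interpret ideal I class_ring by (rule I)
  show "carrier (class_ring Quot I) = range (coset I)"
    by (auto simp: FactRing_def A_RCOSETS_def')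
  show "coset I a \<oplus>\<^bsub>class_ring Quot I\<^esub> coset I b = coset I (a + b)"
    using a_rcos_sum[of a b] by (simp add: FactRing_def)
  show "coset I a \<otimes>\<^bsub>class_ring Quot I\<^esub> coset I b = coset I (a * b)"
    using rcoset_mult_add[of a b] by (simp add: FactRing_def)
  show "\<zero>\<^bsub>class_ring Quot I\<^esub> = coset I 0"
    by (auto simp: FactRing_def a_r_coset_def r_coset_def)
  show "\<one>\<^bsub>class_ring Quot I\<^esub> = coset I 1" by (simp add: FactRing_def)
qed

lemma cring_Quot:
  fixes I :: "'a::comm_ring_1 set"
  assumes I: "ideal I class_ring"
  shows "cring (class_ring Quot I)"
  by (rule ideal.quotient_is_cring[OF I class_cring.is_cring])

lemma ideal_coset_image:
  assumes "ideal I class_ring" "ideal J class_ring"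
  shows "ideal (coset I ` J) (class_ring Quot I)"
  by (rule ring.ring_ideal_imp_quot_ideal[OF class_ring.ring_axioms assms])

lemma coset_in_image_iff:
  assumes "ideal I class_ring" "ideal J class_ring" "I \<subseteq> J"
  shows "coset I a \<in> coset I ` J \<longleftrightarrow> a \<in> J"
proof
  assume "coset I a \<in> coset I ` J"
  then obtain b where "b \<in> J" "a - b \<in> I" using coset_eq_iff[OF assms(1)] by auto
  then show "a \<in> J" using class_ideal_add[OF assms(2), of "a - b" b] assms(3) by auto
qed auto

lemma ideal_coset_preimage:
  assumes I: "ideal I class_ring" and P: "ideal P (class_ring Quot I)"
  shows "ideal {s. coset I s \<in> P} class_ring" "I \<subseteq> {s. coset I s \<in> P}"
    "P = coset I ` {s. coset I s \<in> P}"
proof -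
  interpret ideal P "class_ring Quot I" by (rule P)
  show "ideal {s. coset I s \<in> P} class_ring"
    using ring_hom_ring.ideal_vimage[OF ideal.rcos_ring_hom_ring[OF I] P] by simp
  show "I \<subseteq> {s. coset I s \<in> P}"
  proof
    fix s assume "s \<in> I"
    then have "coset I s = \<zero>\<^bsub>class_ring Quot I\<^esub>"
      using coset_eq_iff[OF I, of s 0] by (simp add: zero_Quot[OF I])
    then show "s \<in> {s. coset I s \<in> P}"
      using additive_subgroup.zero_closed[OF is_additive_subgroup] by simp
  qed
  have "P \<subseteq> range (coset I)" using a_subset carrier_Quot[OF I] by simp
  then show "P = coset I ` {s. coset I s \<in> P}" by auto
qed

section \<open>Monomials and monomial ideals in two variables\<close>

definition xymon :: "nat \<Rightarrow> nat \<Rightarrow> 'k::field poly poly" where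
  "xymon a b = varx ^ a * vary ^ b"

definition cf :: "'k::field poly poly \<Rightarrow> nat \<Rightarrow> nat \<Rightarrow> 'k" where
  "cf f a b = coeff (coeff f b) a"

lemma varx_power: "(varx :: 'k::field poly poly) ^ a = [:monom 1 a:]"
proof -
  have "(varx :: 'k poly poly) = [:monom 1 1:]" by (simp add: monom_altdef)
  then show ?thesis by (simp add: poly_const_pow monom_power)
qed

lemma xymon_monom: "(xymon a b :: 'k::field poly poly) = monom (monom 1 a) b"
proof -
  have "(vary :: 'k poly poly) ^ b = monom 1 b" by (simp add: monom_altdef)
  then show ?thesis by (simp add: xymon_def varx_power smult_monom)
qed

lemma xymon_mult: "xymon a b * xymon c d = xymon (a + c) (b + d)"
  by (simp add: xymon_def power_add algebra_simps)

lemma xymon_0 [simp]: "xymon 0 0 = 1"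
  by (simp add: xymon_def)

lemma xymon_nz [simp]: "(xymon a b :: 'k::field poly poly) \<noteq> 0"
  by (simp add: xymon_monom monom_eq_0_iff)

lemma xymon_dvd_xymon: "a \<le> c \<Longrightarrow> b \<le> d \<Longrightarrow> xymon a b dvd xymon c d"
  using xymon_mult[of a b "c - a" "d - b"] by (metis dvd_triv_left le_add_diff_inverse)

lemma cf_0 [simp]: "cf 0 a b = 0"
  and cf_add: "cf (f + g) a b = cf f a b + cf g a b"
  and cf_diff: "cf (f - g) a b = cf f a b - cf g a b"
  by (simp_all add: cf_def)

lemma cf_xymon: "cf (xymon p q) a b = (if a = p \<and> b = q then 1 else 0)"
  by (auto simp: cf_def xymon_monom)

lemma cf_xymon_mult:
  "cf (xymon p q * f) a b = (if p \<le> a \<and> q \<le> b then cf f (a - p) (b - q) else 0)"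
  by (simp add: cf_def xymon_monom coeff_monom_mult)

lemma cf_mult: "cf (r * f) a b = (\<Sum>j\<le>b. \<Sum>i\<le>a. cf r i j * cf f (a - i) (b - j))"
  by (simp add: cf_def coeff_mult coeff_sum)

lemma cf_eqI: "(\<And>a b. cf f a b = cf g a b) \<Longrightarrow> f = g"
  by (auto simp: cf_def intro!: poly_eqI)

lemma mem_ideal_if_monomials_mem:
  fixes f :: "'k::field poly poly"
  assumes J: "ideal J class_ring" and mon: "\<And>a b. cf f a b \<noteq> 0 \<Longrightarrow> xymon a b \<in> J"
  shows "f \<in> J"
proof -
  have "f = (\<Sum>b\<le>degree f. monom (coeff f b) b)" by (simp add: poly_as_sum_of_monoms)
  also have "\<dots> = (\<Sum>b\<le>degree f. \<Sum>a\<le>degree (coeff f b). [:[:cf f a b:]:] * xymon a b)"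
  proof (rule sum.cong[OF refl])
    fix b
    have "monom (coeff f b) b = monom (\<Sum>a\<le>degree (coeff f b). monom (cf f a b) a) b"
      by (simp add: poly_as_sum_of_monoms cf_def)
    also have "\<dots> = (\<Sum>a\<le>degree (coeff f b). monom (monom (cf f a b) a) b)"
      by (rule poly_eqI) (simp add: coeff_sum)
    also have "\<dots> = (\<Sum>a\<le>degree (coeff f b). [:[:cf f a b:]:] * xymon a b)"
      by (simp add: xymon_monom smult_monom)
    finally show "monom (coeff f b) b = \<dots>" .
  qed
  finally have f: "f = \<dots>" .
  have "[:[:cf f a b:]:] * xymon a b \<in> J" for a b
    by (cases "cf f a b = 0") (simp add: class_ideal_zero[OF J], rule class_ideal_mult[OF J mon])
  then have "(\<Sum>b\<le>degree f. \<Sum>a\<le>degree (coeff f b). [:[:cf f a b:]:] * xymon a b) \<in> J"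
    by (intro class_ideal_sum[OF J])
  then show ?thesis using f by simp
qed

lemma Idl_monomials:
  fixes E :: "(nat \<times> nat) set"
  shows "Idl\<^bsub>class_ring\<^esub> ((\<lambda>(a, b). varx ^ a * vary ^ b) ` E)
     = {f :: 'k::field poly poly. \<forall>a b. cf f a b \<noteq> 0 \<longrightarrow> (\<exists>(c, d)\<in>E. c \<le> a \<and> d \<le> b)}"
    (is "?I = ?J")
proof
  have ideal: "ideal ?J class_ring"
  proof (rule class_idealI)
    show "f + g \<in> ?J" if "f \<in> ?J" "g \<in> ?J" for f g :: "'k poly poly"
    proof (clarify)
      fix a b assume "cf (f + g) a b \<noteq> 0"
      then have "cf f a b \<noteq> 0 \<or> cf g a b \<noteq> 0" by (auto simp: cf_add)
      then show "\<exists>(c, d)\<in>E. c \<le> a \<and> d \<le> b" using that by blast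
    qed
    show "r * f \<in> ?J" if f: "f \<in> ?J" for r f :: "'k poly poly"
    proof (clarify)
      fix a b assume "cf (r * f) a b \<noteq> 0"
      then obtain i j where ij: "i \<le> a" "j \<le> b" "cf f (a - i) (b - j) \<noteq> 0"
        unfolding cf_mult
        by (metis (no_types, lifting) atMost_iff mult_zero_right sum.not_neutral_contains_not_neutral)
      then obtain c d where "(c, d) \<in> E" "c \<le> a - i" "d \<le> b - j" using f by fast
      then show "\<exists>(c, d)\<in>E. c \<le> a \<and> d \<le> b" by (intro bexI[of _ "(c, d)"]) auto
    qed
  qed simp
  show "?I \<subseteq> ?J"
    by (rule Idl_least[OF ideal]) (auto simp: xymon_def[symmetric] cf_xymon split: if_splits)
  show "?J \<subseteq> ?I"
  proof
    fix f assume f: "f \<in> ?J"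
    show "f \<in> ?I"
    proof (rule mem_ideal_if_monomials_mem[OF ideal_Idl])
      fix a b assume "cf f a b \<noteq> 0"
      then obtain c d where cd: "(c, d) \<in> E" "c \<le> a" "d \<le> b" using f by fast
      have "xymon c d \<in> ?I"
        using cd(1) by (intro subsetD[OF Idl_superset]) (auto simp: xymon_def)
      then show "xymon a b \<in> ?I" by (rule class_ideal_dvd[OF ideal_Idl]) (simp add: xymon_dvd_xymon cd)
    qed
  qed
qed

lemma monomial_ideal_ideal: "monomial_ideal I \<Longrightarrow> ideal I class_ring"
  unfolding monomial_ideal_def using ideal_Idl by auto

lemma monomial_ideal_mem_iff:
  assumes "monomial_ideal I"
  shows "f \<in> I \<longleftrightarrow> (\<forall>a b. cf f a b \<noteq> 0 \<longrightarrow> xymon a b \<in> I)"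
proof
  assume f: "f \<in> I"
  obtain E where I: "I = Idl\<^bsub>class_ring\<^esub> ((\<lambda>(a, b). varx ^ a * vary ^ b) ` E)"
    using assms unfolding monomial_ideal_def by auto
  show "\<forall>a b. cf f a b \<noteq> 0 \<longrightarrow> xymon a b \<in> I"
    using f unfolding I Idl_monomials by (auto simp: cf_xymon)
next
  assume "\<forall>a b. cf f a b \<noteq> 0 \<longrightarrow> xymon a b \<in> I"
  then show "f \<in> I"
    using mem_ideal_if_monomials_mem[OF monomial_ideal_ideal[OF assms]] by blast
qed

lemma xymon_dvd_iff:
  "(xymon p q :: 'k::field poly poly) dvd f \<longleftrightarrow> (\<forall>a b. cf f a b \<noteq> 0 \<longrightarrow> p \<le> a \<and> q \<le> b)"
proof -
  have "{f :: 'k poly poly. xymon p q dvd f} = Idl\<^bsub>class_ring\<^esub> ((\<lambda>(a, b). varx ^ a * vary ^ b) ` {(p, q)})"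
    by (simp add: Idl_singleton xymon_def)
  then show ?thesis unfolding Idl_monomials by auto
qed

lemma irrelevant_ideal_iff: "f \<in> irrelevant_ideal \<longleftrightarrow> cf f 0 0 = 0"
proof -
  have *: "{varx, vary} = (\<lambda>(a, b). varx ^ a * vary ^ b :: 'a poly poly) ` {(1, 0), (0, 1)}"
    by simp
  show ?thesis unfolding irrelevant_ideal_def * Idl_monomials
    by (auto simp: Suc_le_eq) (metis gr0I)
qed

lemma prime_varx: "prime_elem (varx :: 'k::field poly poly)"
  by (rule lift_prime_elem_poly) (simp add: prime_elem_linear_field_poly)

lemma vary_dvd_iff: "(vary :: 'k::field poly poly) dvd f \<longleftrightarrow> coeff f 0 = 0"
  using poly_eq_0_iff_dvd[of f 0] by (simp add: poly_0_coeff_0)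

lemma prime_vary: "prime_elem (vary :: 'k::field poly poly)"
proof (rule prime_elemI)
  show "vary dvd a \<or> vary dvd b" if "(vary :: 'k poly poly) dvd a * b" for a b
    using that unfolding vary_dvd_iff by (simp add: coeff_mult_0)
  show "\<not> (vary :: 'k poly poly) dvd 1" unfolding vary_dvd_iff by simp
qed simp

text \<open>Powers of the two variables are coprime: in degree \<open>(i, j + M)\<close> the equation reads
  \<open>cf s i j = cf t (i - N) (j + M)\<close>, and the right-hand side vanishes for \<open>i < N\<close>.\<close>

lemma xpower_dvd_of_ypower_mult:
  fixes s t :: "'k::field poly poly"
  assumes "s * xymon 0 M = t * xymon N 0"
  shows "xymon N 0 dvd s"
  unfolding xymon_dvd_iff
proof (intro allI impI conjI)
  fix i j assume nz: "cf s i j \<noteq> 0"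
  have "cf s i j = cf (xymon 0 M * s) i (j + M)" by (simp add: cf_xymon_mult)
  also have "\<dots> = cf (xymon N 0 * t) i (j + M)" using assms by (simp add: mult.commute)
  finally show "N \<le> i" using nz by (auto simp: cf_xymon_mult split: if_splits)
qed simp

section \<open>Krull dimension and depth of monomial quotients\<close>

lemma primeideal_classI:
  fixes Q :: "'a::comm_ring_1 set"
  assumes "ideal Q class_ring" "1 \<notin> Q" "\<And>a b. a * b \<in> Q \<Longrightarrow> a \<in> Q \<or> b \<in> Q"
  shows "primeideal Q class_ring"
  by (rule primeidealI[OF assms(1) class_cring.is_cring]) (use assms in auto)

lemma primeideal_multiples:
  fixes p :: "'a::comm_ring_1"
  assumes "prime_elem p"
  shows "primeideal {f. p dvd f} class_ring"
proof (rule primeideal_classI)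
  show "ideal {f. p dvd f} class_ring" by (rule class_idealI) auto
  show "1 \<notin> {f. p dvd f}" using assms by (simp add: prime_elem_def)
qed (use assms in \<open>auto dest: prime_elem_dvd_multD\<close>)

lemma cf_mult_00: "cf (f * g) 0 0 = cf f 0 0 * cf g 0 0"
  by (simp add: cf_mult)

lemma primeideal_irrelevant: "primeideal (irrelevant_ideal :: 'k::field poly poly set) class_ring"
proof (rule primeideal_classI)
  show "ideal (irrelevant_ideal :: 'k poly poly set) class_ring"
    unfolding irrelevant_ideal_def by (rule ideal_Idl)
  show "1 \<notin> (irrelevant_ideal :: 'k poly poly set)"
    unfolding irrelevant_ideal_iff by (simp add: cf_def)
qed (auto simp: irrelevant_ideal_iff cf_mult_00)

lemma primeideal_coset_image:
  assumes I: "ideal I class_ring" and Q: "primeideal Q class_ring" and sub: "I \<subseteq> Q"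
  shows "primeideal (coset I ` Q) (class_ring Quot I)"
proof -
  interpret Q: primeideal Q class_ring by (rule Q)
  have Qi: "ideal Q class_ring" by (rule Q.is_ideal)
  note mem = coset_in_image_iff[OF I Qi sub]
  show ?thesis
  proof (rule primeidealI[OF ideal_coset_image[OF I Qi] cring_Quot[OF I]])
    obtain a where "a \<notin> Q" using Q.I_notcarr by auto
    then have "coset I a \<notin> coset I ` Q" by (simp add: mem)
    then show "carrier (class_ring Quot I) \<noteq> coset I ` Q" unfolding carrier_Quot[OF I] by auto
    fix A B assume "A \<in> carrier (class_ring Quot I)" "B \<in> carrier (class_ring Quot I)"
      and AB: "A \<otimes>\<^bsub>class_ring Quot I\<^esub> B \<in> coset I ` Q"
    then obtain a b where ab: "A = coset I a" "B = coset I b" unfolding carrier_Quot[OF I] by auto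
    then have "a * b \<in> Q" using AB by (simp add: mult_Quot[OF I] mem)
    then have "a \<in> Q \<or> b \<in> Q" using Q.I_prime[of a b] by simp
    then show "A \<in> coset I ` Q \<or> B \<in> coset I ` Q" using ab by auto
  qed
qed

lemma primeideal_coset_preimage:
  assumes I: "ideal I class_ring" and P: "primeideal P (class_ring Quot I)"
  shows "primeideal {s. coset I s \<in> P} class_ring"
  using ring_hom_ring.primeideal_vimage[OF ideal.rcos_ring_hom_ring[OF I] class_cring.is_cring P] by simp

lemma krull_dim_Quot_ge_1:
  fixes I :: "'a::comm_ring_1 set"
  assumes "ideal I class_ring" "primeideal P class_ring" "primeideal Q class_ring"
    "I \<subseteq> P" "P \<subset> Q"
  shows "krull_dim (class_ring Quot I) \<ge> 1"
proof -
  have PQ: "ideal P class_ring" "ideal Q class_ring"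
    using assms(2,3) by (simp_all add: primeideal_def)
  obtain q where "q \<in> Q" "q \<notin> P" using assms(5) by auto
  then have "coset I q \<in> coset I ` Q" "coset I q \<notin> coset I ` P"
    using coset_in_image_iff[OF assms(1) PQ(1) assms(4)] by auto
  then have "coset I ` P \<noteq> coset I ` Q" by metis
  then have "coset I ` P \<subset> coset I ` Q" using assms(5) by auto
  moreover have "primeideal (coset I ` P) (class_ring Quot I)" "primeideal (coset I ` Q) (class_ring Quot I)"
    using primeideal_coset_image assms by auto
  ultimately have "\<exists>C :: nat \<Rightarrow> _. (\<forall>i\<le>1. primeideal (C i) (class_ring Quot I)) \<and> (\<forall>i<1. C i \<subset> C (Suc i))"
    by (intro exI[of _ "\<lambda>i::nat. if i = 0 then coset I ` P else coset I ` Q"]) auto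
  then have "enat 1 \<le> krull_dim (class_ring Quot I)"
    unfolding krull_dim_def by (intro Sup_upper) blast
  then show ?thesis by (simp add: one_enat_def)
qed

lemma krull_dim_Quot_le_1:
  fixes I :: "'a::comm_ring_1 set"
  assumes I: "ideal I class_ring"
    and no: "\<And>P Q R. primeideal P class_ring \<Longrightarrow> primeideal Q class_ring \<Longrightarrow> primeideal R class_ring
      \<Longrightarrow> I \<subseteq> P \<Longrightarrow> P \<subset> Q \<Longrightarrow> Q \<subset> R \<Longrightarrow> False"
  shows "krull_dim (class_ring Quot I) \<le> 1"
  unfolding krull_dim_def
proof (rule Sup_least, clarify)
  fix n and C :: "nat \<Rightarrow> 'a set set"
  assume C: "\<forall>i\<le>n. primeideal (C i) (class_ring Quot I)" "\<forall>i<n. C i \<subset> C (Suc i)"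
  let ?D = "\<lambda>i. {s. coset I s \<in> C i}"
  show "enat n \<le> 1"
  proof (rule ccontr)
    assume "\<not> enat n \<le> 1"
    then have n: "2 \<le> n" by (simp add: one_enat_def)
    have prime: "primeideal (?D i) class_ring" if "i \<le> 2" for i
      using primeideal_coset_preimage[OF I] C(1) that n by auto
    have pre: "C i = coset I ` ?D i" "I \<subseteq> ?D i" if "i \<le> 2" for i
      using ideal_coset_preimage(2,3)[OF I, of "C i"] C(1) that n by (auto simp: primeideal_def)
    have less: "?D i \<subset> ?D (Suc i)" if "i < 2" for i
    proof -
      have s: "C i \<subset> C (Suc i)" using C(2) that n by auto
      then have "?D i \<noteq> ?D (Suc i)" using pre(1)[of i] pre(1)[of "Suc i"] that by auto
      then show ?thesis using s by auto
    qed
    show False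
      using no[OF prime[of 0] prime[of 1] prime[of 2] pre(2)[of 0]] less[of 0] less[of 1]
      by (simp add: numeral_2_eq_2)
  qed
qed

text \<open>Primes above \<open>P\<close> are determined by their contractions to \<open>K[t]\<close>, where a nonzero prime is
  maximal. In the proof, \<open>p\<close> and \<open>e\<close> generate the contractions of \<open>Q\<close> and \<open>R\<close>; from \<open>p = e c\<close> and
  the primality of \<open>Q\<close> it follows that \<open>e\<close> lies in the smaller prime or is a unit.\<close>

lemma no_prime_chain_above_affine_line:
  fixes j :: "'k::field poly \<Rightarrow> 'a::comm_ring_1"
  assumes P: "ideal P class_ring" and Q: "primeideal Q class_ring" and R: "primeideal R class_ring"
    and less: "P \<subset> Q" "Q \<subset> R"
    and hom: "j 0 = 0" "j 1 = 1" "\<And>a b. j (a + b) = j a + j b" "\<And>a b. j (a * b) = j a * j b"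
    and surj: "\<And>s. \<exists>h. s - j h \<in> P"
  shows False
proof -
  interpret Q: primeideal Q class_ring by (rule Q)
  interpret R: primeideal R class_ring by (rule R)
  have Qi: "ideal Q class_ring" and Ri: "ideal R class_ring" by (rule Q.is_ideal, rule R.is_ideal)
  have diff: "j (a - b) = j a - j b" for a b
    using hom(3)[of "a - b" b] by (simp add: algebra_simps)
  have generator: "\<exists>p. p \<noteq> 0 \<and> j p \<in> A \<and> (\<forall>h. j h \<in> A \<longrightarrow> p dvd h)"
    if A: "ideal A class_ring" and h0: "h0 \<noteq> 0" "j h0 \<in> A" for A h0
  proof -
    define d where "d = (LEAST d. \<exists>p. p \<noteq> 0 \<and> j p \<in> A \<and> degree p = d)"
    have "\<exists>p. p \<noteq> 0 \<and> j p \<in> A \<and> degree p = d"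
      unfolding d_def by (rule LeastI[of _ "degree h0"]) (use h0 in auto)
    then obtain p where p: "p \<noteq> 0" "j p \<in> A" "degree p = d" by auto
    have "p dvd h" if h: "j h \<in> A" for h
    proof (rule ccontr)
      assume "\<not> p dvd h"
      then have nz: "h mod p \<noteq> 0" by (simp add: mod_eq_0_iff_dvd)
      have "h mod p = h - (h div p) * p" by (simp add: minus_div_mult_eq_mod)
      then have "j (h mod p) \<in> A"
        using class_ideal_diff[OF A h class_ideal_mult[OF A p(2)]] by (simp add: diff hom)
      then have "d \<le> degree (h mod p)" unfolding d_def using nz by (intro Least_le) auto
      moreover have "degree (h mod p) < degree p"
        using degree_mod_less[OF p(1), of h] nz by auto
      ultimately show False using p(3) by simp
    qed
    then show ?thesis using p by auto
  qed
  obtain g where g: "g \<in> Q" "g \<notin> P" using less by auto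
  obtain h where h: "g - j h \<in> P" using surj by blast
  have "j h \<in> Q"
    using class_ideal_diff[OF Qi g(1), of "g - j h"] h less by auto
  moreover have "h \<noteq> 0" using g(2) h hom(1) by auto
  ultimately obtain p where p: "p \<noteq> 0" "j p \<in> Q" "\<And>h. j h \<in> Q \<Longrightarrow> p dvd h"
    using generator[OF Qi] by blast
  obtain g' where g': "g' \<in> R" "g' \<notin> Q" using less by auto
  obtain h' where h': "g' - j h' \<in> P" using surj by blast
  have h'R: "j h' \<in> R" using class_ideal_diff[OF Ri g'(1), of "g' - j h'"] h' less by auto
  have h'Q: "j h' \<notin> Q"
    using class_ideal_add[OF Qi, of "g' - j h'" "j h'"] h' less g'(2) by auto
  obtain e where e: "j e \<in> R" "\<And>h. j h \<in> R \<Longrightarrow> e dvd h"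
    using generator[OF Ri p(1)] p(2) less by auto
  obtain c where c: "p = e * c" using e(2)[of p] p(2) less by (auto elim: dvdE)
  have "j e \<in> Q \<or> j c \<in> Q" using Q.I_prime[of "j e" "j c"] p(2) by (simp add: c hom)
  then show False
  proof
    assume "j e \<in> Q"
    moreover obtain k where "h' = e * k" using e(2)[OF h'R] by (auto elim: dvdE)
    ultimately have "j h' \<in> Q" by (simp add: hom class_ideal_mult_right[OF Qi])
    then show False using h'Q by simp
  next
    assume "j c \<in> Q"
    then obtain k where "c = p * k" using p(3) by (auto elim: dvdE)
    then have "p * (e * k) = p" using c by (metis mult.left_commute)
    then have "e * k = 1" using p(1) by simp
    then have "1 = j e * j k" using hom(2,4) by metis
    then have "1 \<in> R" using class_ideal_mult_right[OF Ri e(1)] by metis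
    then show False using class_ideal_one_imp_UNIV[OF Ri] R.I_notcarr by simp
  qed
qed

lemma no_prime_chain_above_varx:
  assumes P: "primeideal P class_ring" and Q: "primeideal Q class_ring" and R: "primeideal R class_ring"
    and less: "P \<subset> Q" "Q \<subset> R" and x: "(varx :: 'k::field poly poly) \<in> P"
  shows False
proof -
  let ?j = "map_poly (\<lambda>c :: 'k. [:c:])"
  have cfj: "coeff (?j a) i = [:coeff a i:]" for a i by (simp add: coeff_map_poly)
  have Pi: "ideal P class_ring" using P by (simp add: primeideal_def)
  have one: "?j 1 = 1" by (rule poly_eqI) (simp add: coeff_map_poly one_pCons coeff_pCons split: nat.split)
  have add: "?j (a + b) = ?j a + ?j b" for a b by (rule poly_eqI) (simp add: cfj)
  have sum: "(\<Sum>i\<in>A. [:f i:]) = [:\<Sum>i\<in>A. f i:]" for f :: "nat \<Rightarrow> 'k" and A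
    by (induction A rule: infinite_finite_induct) auto
  have mult: "?j (a * b) = ?j a * ?j b" for a b
    by (rule poly_eqI) (simp add: cfj coeff_mult sum mult.commute)
  have surj: "\<exists>h. s - ?j h \<in> P" for s
  proof
    have "varx dvd s - ?j (map_poly (\<lambda>c. coeff c 0) s)"
      using xymon_dvd_iff[of 1 0 "s - ?j (map_poly (\<lambda>c. coeff c 0) s)"]
      by (auto simp: xymon_def cf_def coeff_map_poly coeff_pCons Suc_le_eq intro: gr0I)
    then show "s - ?j (map_poly (\<lambda>c. coeff c 0) s) \<in> P"
      by (rule class_ideal_dvd[OF Pi x])
  qed
  show False
    by (rule no_prime_chain_above_affine_line[OF Pi Q R less _ one add mult surj]) simp
qed

lemma no_prime_chain_above_vary:
  assumes P: "primeideal P class_ring" and Q: "primeideal Q class_ring" and R: "primeideal R class_ring"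
    and less: "P \<subset> Q" "Q \<subset> R" and y: "(vary :: 'k::field poly poly) \<in> P"
  shows False
proof -
  let ?j = "\<lambda>h :: 'k poly. [:h:]"
  have Pi: "ideal P class_ring" using P by (simp add: primeideal_def)
  have surj: "\<exists>h. s - ?j h \<in> P" for s
  proof
    have "vary dvd s - ?j (coeff s 0)" by (simp add: vary_dvd_iff)
    then show "s - ?j (coeff s 0) \<in> P" by (rule class_ideal_dvd[OF Pi y])
  qed
  show False
    by (rule no_prime_chain_above_affine_line[OF Pi Q R less, of ?j, OF _ _ _ _ surj])
      (simp_all add: one_pCons)
qed

lemma
  shows multiples_varx_psubset: "{f. varx dvd f} \<subset> (irrelevant_ideal :: 'k::field poly poly set)"
    and multiples_vary_psubset: "{f. vary dvd f} \<subset> (irrelevant_ideal :: 'k::field poly poly set)"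
proof -
  have x: "varx dvd f \<Longrightarrow> cf f 0 0 = 0" and y: "vary dvd f \<Longrightarrow> cf f 0 0 = 0" for f :: "'k poly poly"
    using xymon_dvd_iff[of 1 0 f] xymon_dvd_iff[of 0 1 f] by (auto simp: xymon_def)
  have "\<not> varx dvd (vary :: 'k poly poly)" "\<not> vary dvd (varx :: 'k poly poly)"
    using xymon_dvd_iff[of 1 0 "xymon 0 1 :: 'k poly poly"] xymon_dvd_iff[of 0 1 "xymon 1 0 :: 'k poly poly"]
    by (simp_all add: cf_xymon) (simp_all add: xymon_def)
  moreover have "vary \<in> (irrelevant_ideal :: 'k poly poly set)" "varx \<in> (irrelevant_ideal :: 'k poly poly set)"
    by (simp_all add: irrelevant_ideal_iff cf_def)
  moreover have "{f. varx dvd f} \<subseteq> (irrelevant_ideal :: 'k poly poly set)"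
    "{f. vary dvd f} \<subseteq> (irrelevant_ideal :: 'k poly poly set)"
    using x y irrelevant_ideal_iff by blast+
  ultimately show "{f. varx dvd f} \<subset> (irrelevant_ideal :: 'k poly poly set)"
    "{f. vary dvd f} \<subset> (irrelevant_ideal :: 'k poly poly set)"
    by blast+
qed

lemma krull_dim_ge_1_if_multiples:
  fixes I :: "'k::field poly poly set"
  assumes "ideal I class_ring" "I \<subseteq> {f. varx dvd f} \<or> I \<subseteq> {f. vary dvd f}"
  shows "krull_dim (class_ring Quot I) \<ge> 1"
  using assms(2)
proof
  assume "I \<subseteq> {f. varx dvd f}"
  from krull_dim_Quot_ge_1[OF assms(1) primeideal_multiples[OF prime_varx] primeideal_irrelevant
      this multiples_varx_psubset] show ?thesis .
next
  assume "I \<subseteq> {f. vary dvd f}"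
  from krull_dim_Quot_ge_1[OF assms(1) primeideal_multiples[OF prime_vary] primeideal_irrelevant
      this multiples_vary_psubset] show ?thesis .
qed

text \<open>A prime ideal above \<open>x\<^sup>a y\<^sup>b\<close> contains one of the variables, and modulo a variable \<open>S\<close> becomes a
  polynomial ring in one variable. So there is no chain of three primes.\<close>

lemma krull_dim_principal:
  assumes "(a, b) \<noteq> (0, 0)"
  shows "krull_dim (class_ring Quot {f :: 'k::field poly poly. xymon a b dvd f}) = 1" (is "krull_dim (_ Quot ?I) = 1")
proof -
  have I: "ideal ?I class_ring" by (rule class_idealI) auto
  have "krull_dim (class_ring Quot ?I) \<ge> 1"
  proof (rule krull_dim_ge_1_if_multiples[OF I])
    have "varx dvd (xymon a b :: 'k poly poly) \<or> vary dvd (xymon a b :: 'k poly poly)"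
    proof (cases "a = 0")
      case True
      then have "vary dvd (vary ^ b :: 'k poly poly)" using assms by (intro dvd_power) simp
      then show ?thesis unfolding xymon_def using dvd_mult by blast
    next
      case False
      then have "varx dvd (varx ^ a :: 'k poly poly)" by (intro dvd_power) simp
      then show ?thesis unfolding xymon_def using dvd_mult2 by blast
    qed
    then show "?I \<subseteq> {f. varx dvd f} \<or> ?I \<subseteq> {f. vary dvd f}" using dvd_trans by blast
  qed
  moreover have "krull_dim (class_ring Quot ?I) \<le> 1"
  proof (rule krull_dim_Quot_le_1[OF I])
    fix P Q R :: "'k poly poly set"
    assume pr: "primeideal P class_ring" "primeideal Q class_ring" "primeideal R class_ring"
      and less: "P \<subset> Q" "Q \<subset> R" and sub: "?I \<subseteq> P"
    interpret P: primeideal P class_ring by (rule pr)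
    have pow: "z \<in> P" if "z ^ n \<in> P" for z n
      using that
    proof (induction n)
      case 0
      then show ?case using P.I_notcarr class_ideal_one_imp_UNIV[OF P.is_ideal] by simp
    next
      case (Suc n)
      then show ?case using P.I_prime[of z "z ^ n"] by auto
    qed
    have "varx ^ a * vary ^ b \<in> P" using sub by (auto simp: xymon_def)
    then have "varx \<in> P \<or> vary \<in> P" using P.I_prime[of "varx ^ a" "vary ^ b"] pow by auto
    then show False
      using no_prime_chain_above_varx[OF pr less] no_prime_chain_above_vary[OF pr less] by auto
  qed
  ultimately show ?thesis by simp
qed

text \<open>A nonzero element that is annihilated by \<open>M\<close> leaves no regular element in \<open>M\<close>.\<close>

lemma depth_eq_0_if_socle:
  assumes I: "ideal I class_ring" and b: "b \<notin> I" "\<And>s. s \<in> M \<Longrightarrow> s * b \<in> I"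
  shows "depth_in (coset I ` M) (class_ring Quot I) = 0"
proof -
  let ?R = "class_ring Quot I"
  have Idl0: "Idl\<^bsub>?R\<^esub> {} = {\<zero>\<^bsub>?R\<^esub>}"
  proof -
    interpret cring ?R by (rule cring_Quot[OF I])
    show ?thesis using genideal_minimal[OF zeroideal, of "{}"]
        additive_subgroup.zero_closed[OF ideal.axioms(1)[OF genideal_ideal[of "{}"]]] by auto
  qed
  have "xs = []" if xs: "regular_sequence ?R xs" "set xs \<subseteq> coset I ` M" for xs
  proof (cases xs)
    case (Cons z zs)
    then obtain s where s: "z = coset I s" "s \<in> M" using xs(2) by auto
    have "coset I b \<in> carrier ?R" unfolding carrier_Quot[OF I] by auto
    moreover have "z \<otimes>\<^bsub>?R\<^esub> coset I b = \<zero>\<^bsub>?R\<^esub>"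
      unfolding s mult_Quot[OF I] zero_Quot[OF I] coset_eq_iff[OF I] using b(2)[OF s(2)] by simp
    moreover have "\<forall>i<length xs. \<forall>c\<in>carrier ?R. xs ! i \<otimes>\<^bsub>?R\<^esub> c \<in> Idl\<^bsub>?R\<^esub> (set (take i xs))
        \<longrightarrow> c \<in> Idl\<^bsub>?R\<^esub> (set (take i xs))"
      using xs(1) unfolding regular_sequence_def by blast
    from this[rule_format, of 0 "coset I b"]
    have "coset I b \<in> carrier ?R \<Longrightarrow> z \<otimes>\<^bsub>?R\<^esub> coset I b \<in> Idl\<^bsub>?R\<^esub> {} \<Longrightarrow> coset I b \<in> Idl\<^bsub>?R\<^esub> {}"
      unfolding Cons by simp
    ultimately have "coset I b \<in> Idl\<^bsub>?R\<^esub> {}" unfolding Idl0 by simp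
    then have "coset I b = coset I 0" by (simp add: Idl0 zero_Quot[OF I])
    then show ?thesis using b(1) coset_eq_iff[OF I, of b 0] by simp
  qed simp
  then have "depth_in (coset I ` M) ?R \<le> 0"
    unfolding depth_in_def by (intro Sup_least) (auto simp: zero_enat_def)
  then show ?thesis by simp
qed

text \<open>A staircase with more than one step has an inner corner, which gives a socle element of
  \<open>S/I\<close>: with the least exponents \<open>a\<close> of \<open>x\<close> and \<open>b\<close> of \<open>y\<close>, take the largest \<open>q\<close> with
  \<open>x\<^sup>a y\<^sup>q \<notin> I\<close> and then the largest \<open>p\<close> with \<open>x\<^sup>p y\<^sup>q \<notin> I\<close>.\<close>

lemma monomial_ideal_principal_or_socle:
  fixes I :: "'k::field poly poly set"
  assumes mono: "monomial_ideal I" and nz: "I \<noteq> {0}"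
  shows "(\<exists>a b. I = {z. xymon a b dvd z}) \<or>
    (\<exists>p q. xymon p q \<notin> I \<and> xymon (Suc p) q \<in> I \<and> xymon p (Suc q) \<in> I)"
proof -
  note I = monomial_ideal_ideal[OF mono] and mem = monomial_ideal_mem_iff[OF mono]
  have up: "xymon c d \<in> I" if "xymon a b \<in> I" "a \<le> c" "b \<le> d" for a b c d
    using class_ideal_dvd[OF I that(1) xymon_dvd_xymon[OF that(2,3)]] .
  obtain z where "z \<in> I" "z \<noteq> 0" using nz class_ideal_zero[OF I] by auto
  then obtain a1 b1 where "cf z a1 b1 \<noteq> 0" using cf_eqI[of z 0] by auto
  with \<open>z \<in> I\<close> have ex: "xymon a1 b1 \<in> I" using mem by blast
  define a where "a = (LEAST a. \<exists>b. xymon a b \<in> I)"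
  define b where "b = (LEAST b. \<exists>a. xymon a b \<in> I)"
  have a_le: "a \<le> c" and b_le: "b \<le> d" if "xymon c d \<in> I" for c d
    unfolding a_def b_def using that by (auto intro: Least_le)
  have "\<exists>d. xymon a d \<in> I" unfolding a_def by (rule LeastI[of _ a1]) (use ex in auto)
  then obtain d where d: "xymon a d \<in> I" ..
  have "\<exists>c. xymon c b \<in> I" unfolding b_def by (rule LeastI[of _ b1]) (use ex in auto)
  then obtain c where c: "xymon c b \<in> I" ..
  show ?thesis
  proof (cases "xymon a b \<in> I")
    case True
    have "I = {z. xymon a b dvd z}"
    proof (intro subset_antisym subsetI)
      fix z assume "z \<in> I"
      then have "xymon a' b' \<in> I" if "cf z a' b' \<noteq> 0" for a' b' using mem that by blast
      then show "z \<in> {z. xymon a b dvd z}" unfolding xymon_dvd_iff using a_le b_le by blast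
    qed (use class_ideal_dvd[OF I True] in blast)
    then show ?thesis by blast
  next
    case False
    define q where "q = (LEAST q. xymon a (b + Suc q) \<in> I)"
    have "xymon a (b + Suc d) \<in> I" by (rule up[OF d]) auto
    then have q: "xymon a (b + Suc q) \<in> I" unfolding q_def by (rule LeastI)
    have q': "xymon a (b + q) \<notin> I"
    proof (cases q)
      case (Suc q0)
      then show ?thesis using not_less_Least[of q0 "\<lambda>q. xymon a (b + Suc q) \<in> I"] q_def by simp
    qed (use False in simp)
    define p where "p = (LEAST p. xymon (a + Suc p) (b + q) \<in> I)"
    have "xymon (a + Suc c) (b + q) \<in> I" by (rule up[OF c]) auto
    then have p: "xymon (a + Suc p) (b + q) \<in> I" unfolding p_def by (rule LeastI)
    have p': "xymon (a + p) (b + q) \<notin> I"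
    proof (cases p)
      case (Suc p0)
      then show ?thesis using not_less_Least[of p0 "\<lambda>p. xymon (a + Suc p) (b + q) \<in> I"] p_def by simp
    qed (use q' in simp)
    have "xymon (a + p) (Suc (b + q)) \<in> I" by (rule up[OF q]) auto
    then show ?thesis using p p' by (intro disjI2 exI[of _ "a + p"] exI[of _ "b + q"]) auto
  qed
qed

text \<open>The product of \<open>x\<^sup>p y\<^sup>q\<close> with each variable lies in \<open>I\<close>, so that its class is in the socle
  of \<open>S/I\<close>. Then the depth is \<open>0\<close>, and so is the dimension by the Cohen-Macaulay property.\<close>

lemma krull_dim_0_if_socle:
  fixes I :: "'k::field poly poly set"
  assumes mono: "monomial_ideal I" and cm: "cohen_macaulay_quot I"
    and socle: "xymon p q \<notin> I" "xymon (Suc p) q \<in> I" "xymon p (Suc q) \<in> I"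
  shows "krull_dim (class_ring Quot I) = 0"
proof -
  note I = monomial_ideal_ideal[OF mono]
  have "depth_in (coset I ` irrelevant_ideal) (class_ring Quot I) = 0"
  proof (rule depth_eq_0_if_socle[OF I socle(1)])
    fix s :: "'k poly poly" assume s: "s \<in> irrelevant_ideal"
    show "s * xymon p q \<in> I"
    proof (rule mem_ideal_if_monomials_mem[OF I])
      fix a b assume "cf (s * xymon p q) a b \<noteq> 0"
      then have ab: "p \<le> a" "q \<le> b" "cf s (a - p) (b - q) \<noteq> 0"
        by (auto simp: mult.commute[of s] cf_xymon_mult split: if_splits)
      then have "a - p \<noteq> 0 \<or> b - q \<noteq> 0" using s unfolding irrelevant_ideal_iff by metis
      then have "xymon (Suc p) q dvd (xymon a b :: 'k poly poly) \<or> xymon p (Suc q) dvd (xymon a b :: 'k poly poly)"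
        using ab xymon_dvd_xymon[of "Suc p" a q b] xymon_dvd_xymon[of p a "Suc q" b] by force
      then show "xymon a b \<in> I" using class_ideal_dvd[OF I] socle(2,3) by blast
    qed
  qed
  then show ?thesis using cm unfolding cohen_macaulay_quot_def by simp
qed

text \<open>If \<open>I\<close> contains no power of \<open>x\<close>, every monomial in \<open>I\<close> is divisible by \<open>y\<close>, and \<open>(y) \<subset> (x, y)\<close> is
  a chain of primes above \<open>I\<close>; likewise with the variables exchanged.\<close>

lemma pure_powers_if_krull_dim_0:
  fixes I :: "'k::field poly poly set"
  assumes mono: "monomial_ideal I" and dim: "krull_dim (class_ring Quot I) = 0"
  shows "(\<exists>N. xymon N 0 \<in> I) \<and> (\<exists>M. xymon 0 M \<in> I)"
proof (rule ccontr)
  assume no: "\<not> ?thesis"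
  note I = monomial_ideal_ideal[OF mono] and mem = monomial_ideal_mem_iff[OF mono]
  have x: "varx dvd z \<longleftrightarrow> (\<forall>a b. cf z a b \<noteq> 0 \<longrightarrow> 1 \<le> a)" for z :: "'k poly poly"
    using xymon_dvd_iff[of 1 0 z] by (simp add: xymon_def)
  have y: "vary dvd z \<longleftrightarrow> (\<forall>a b. cf z a b \<noteq> 0 \<longrightarrow> 1 \<le> b)" for z :: "'k poly poly"
    using xymon_dvd_iff[of 0 1 z] by (simp add: xymon_def)
  have "I \<subseteq> {z. varx dvd z} \<or> I \<subseteq> {z. vary dvd z}"
  proof (cases "\<exists>N. xymon N 0 \<in> I")
    case True
    then have nM: "xymon 0 M \<notin> I" for M using no by blast
    have "varx dvd z" if z: "z \<in> I" for z
      unfolding x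
    proof (intro allI impI)
      fix a b assume "cf z a b \<noteq> 0"
      then have "xymon a b \<in> I" using mem z by blast
      then show "1 \<le> a" using nM[of b] by (cases a) auto
    qed
    then show ?thesis by blast
  next
    case False
    have "vary dvd z" if z: "z \<in> I" for z
      unfolding y
    proof (intro allI impI)
      fix a b assume "cf z a b \<noteq> 0"
      then have "xymon a b \<in> I" using mem z by blast
      then show "1 \<le> b" using False by (cases b) auto
    qed
    then show ?thesis by blast
  qed
  then have "krull_dim (class_ring Quot I) \<ge> 1" by (rule krull_dim_ge_1_if_multiples[OF I])
  then show False using dim by simp
qed

section \<open>Linear algebra over a commutative ring\<close>

lemma mult_mat_vec_smult:
  fixes A :: "'a::comm_ring_1 mat"
  assumes "A \<in> carrier_mat n p" "v \<in> carrier_vec p"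
  shows "A *\<^sub>v (s \<cdot>\<^sub>v v) = s \<cdot>\<^sub>v (A *\<^sub>v v)"
  using assms by (intro eq_vecI) auto

lemma mult_mat_vec_unit:
  fixes A :: "'a::comm_ring_1 mat"
  assumes "A \<in> carrier_mat n p" "j < p"
  shows "A *\<^sub>v unit_vec p j = col A j"
  using assms by (intro eq_vecI) auto

lemma mult_mat_zero_vec:
  fixes A :: "'a::comm_ring_1 mat"
  assumes "A \<in> carrier_mat n p"
  shows "A *\<^sub>v 0\<^sub>v p = 0\<^sub>v n"
  using assms by (intro eq_vecI) auto

lemma vec_eq_if_scalar_prod_eq:
  fixes v w :: "'a::comm_ring_1 vec"
  assumes "v \<in> carrier_vec n" "w \<in> carrier_vec n" "\<And>z. z \<in> carrier_vec n \<Longrightarrow> v \<bullet> z = w \<bullet> z"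
  shows "v = w"
proof (rule eq_vecI)
  fix i assume "i < dim_vec w"
  then show "v $ i = w $ i" using assms(3)[of "unit_vec n i"] assms(1,2) by simp
qed (use assms in auto)

lemma vec_diff_add_cancel:
  fixes v w :: "'a::comm_ring_1 vec"
  assumes "v \<in> carrier_vec n" "w \<in> carrier_vec n"
  shows "v - w + w = v"
  using assms by (intro eq_vecI) auto

lemma carrier_vec_0_eq: "carrier_vec 0 = {0\<^sub>v 0 :: 'a::zero vec}"
proof (intro subset_antisym subsetI)
  fix v :: "'a vec" assume "v \<in> carrier_vec 0"
  then have "v = 0\<^sub>v 0" by (intro eq_vecI) auto
  then show "v \<in> {0\<^sub>v 0}" by simp
qed simp

lemma scalar_prod_uminus_right:
  fixes v w :: "'a::comm_ring_1 vec"
  assumes "v \<in> carrier_vec n" "w \<in> carrier_vec n"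
  shows "v \<bullet> (- w) = - (v \<bullet> w)"
  using assms by (simp add: scalar_prod_def sum_negf)

lemma linear_form_factor:
  fixes u f :: "'a::comm_ring_1 vec"
  assumes u: "u \<in> carrier_vec n" and f: "f \<in> carrier_vec m"
    and mem: "\<And>l. l < n \<Longrightarrow> \<exists>p\<in>carrier_vec m. f \<bullet> p = u $ l"
  shows "\<exists>P\<in>carrier_mat m n. \<forall>v\<in>carrier_vec n. f \<bullet> (P *\<^sub>v v) = u \<bullet> v"
proof -
  obtain p where p: "\<And>l. l < n \<Longrightarrow> p l \<in> carrier_vec m \<and> f \<bullet> p l = u $ l" using mem by metis
  define P where "P = mat m n (\<lambda>(i, l). p l $ i)"
  have P: "P \<in> carrier_mat m n" by (simp add: P_def)
  have "P\<^sup>T *\<^sub>v f = u"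
  proof (rule eq_vecI)
    fix l assume "l < dim_vec u"
    then have l: "l < n" using u by simp
    have "col P l = p l" using p[OF l] l by (intro eq_vecI) (auto simp: P_def)
    then show "(P\<^sup>T *\<^sub>v f) $ l = u $ l"
      using l P p[OF l] comm_scalar_prod[OF f, of "p l"] by simp
  qed (use P u in auto)
  then have "f \<bullet> (P *\<^sub>v v) = u \<bullet> v" if "v \<in> carrier_vec n" for v
    using transpose_vec_mult_scalar[OF P that f] by simp
  then show ?thesis using P by blast
qed

lemma ideal_linear_form_image:
  fixes f :: "'a::comm_ring_1 vec"
  assumes f: "f \<in> carrier_vec n"
  shows "ideal ((\<lambda>v. f \<bullet> v) ` carrier_vec n) class_ring"
proof (rule class_idealI)
  show "0 \<in> (\<lambda>v. f \<bullet> v) ` carrier_vec n"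
    using f by (intro image_eqI[of _ _ "0\<^sub>v n"]) auto
  show "a + b \<in> (\<lambda>v. f \<bullet> v) ` carrier_vec n"
    if ab: "a \<in> (\<lambda>v. f \<bullet> v) ` carrier_vec n" "b \<in> (\<lambda>v. f \<bullet> v) ` carrier_vec n" for a b
  proof -
    obtain v w where "v \<in> carrier_vec n" "w \<in> carrier_vec n" "a = f \<bullet> v" "b = f \<bullet> w" using ab by auto
    then show ?thesis
      using scalar_prod_add_distrib[OF f] by (intro image_eqI[of _ _ "v + w"]) auto
  qed
  show "r * a \<in> (\<lambda>v. f \<bullet> v) ` carrier_vec n" if a: "a \<in> (\<lambda>v. f \<bullet> v) ` carrier_vec n" for r a
  proof -
    obtain v where "v \<in> carrier_vec n" "a = f \<bullet> v" using a by auto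
    then show ?thesis using f by (intro image_eqI[of _ _ "r \<cdot>\<^sub>v v"]) auto
  qed
qed

lemma mat_image_iff:
  assumes "A \<in> carrier_mat n p"
  shows "w \<in> mat_image A \<longleftrightarrow> (\<exists>v\<in>carrier_vec p. w = A *\<^sub>v v)"
  using assms by (auto simp: mat_image_def)

lemma mat_image_mult: "A \<in> carrier_mat n p \<Longrightarrow> v \<in> carrier_vec p \<Longrightarrow> A *\<^sub>v v \<in> mat_image A"
  by (auto simp: mat_image_def)

lemma
  fixes A :: "'a::comm_ring_1 mat"
  assumes A: "A \<in> carrier_mat n p"
  shows mat_image_carrier: "mat_image A \<subseteq> carrier_vec n"
    and mat_image_zero: "0\<^sub>v n \<in> mat_image A"
    and mat_image_add: "v \<in> mat_image A \<Longrightarrow> w \<in> mat_image A \<Longrightarrow> v + w \<in> mat_image A"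
    and mat_image_smult: "v \<in> mat_image A \<Longrightarrow> s \<cdot>\<^sub>v v \<in> mat_image A"
proof -
  show "mat_image A \<subseteq> carrier_vec n" using A by (auto simp: mat_image_def)
  show "0\<^sub>v n \<in> mat_image A"
    unfolding mat_image_iff[OF A] using mult_mat_zero_vec[OF A] by (metis zero_carrier_vec)
  show "v + w \<in> mat_image A" if vw: "v \<in> mat_image A" "w \<in> mat_image A" for v w
  proof -
    obtain a b where "a \<in> carrier_vec p" "b \<in> carrier_vec p" "v = A *\<^sub>v a" "w = A *\<^sub>v b"
      using vw unfolding mat_image_iff[OF A] by auto
    then show ?thesis unfolding mat_image_iff[OF A]
      using mult_add_distrib_mat_vec[OF A, of a b] by (intro bexI[of _ "a + b"]) auto
  qed
  show "s \<cdot>\<^sub>v v \<in> mat_image A" if v: "v \<in> mat_image A" for v s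
  proof -
    obtain a where "a \<in> carrier_vec p" "v = A *\<^sub>v a"
      using v unfolding mat_image_iff[OF A] by auto
    then show ?thesis unfolding mat_image_iff[OF A]
      using mult_mat_vec_smult[OF A, of a s] by (intro bexI[of _ "s \<cdot>\<^sub>v a"]) auto
  qed
qed

lemma mat_kernel_iff:
  assumes "A \<in> carrier_mat n p"
  shows "v \<in> mat_kernel A \<longleftrightarrow> v \<in> carrier_vec p \<and> A *\<^sub>v v = 0\<^sub>v n"
  using assms by (auto simp: mat_kernel_def)

lemma
  fixes A :: "'a::comm_ring_1 mat"
  assumes A: "A \<in> carrier_mat n p"
  shows mat_kernel_zero_vec: "0\<^sub>v p \<in> mat_kernel A"
    and mat_kernel_add: "v \<in> mat_kernel A \<Longrightarrow> w \<in> mat_kernel A \<Longrightarrow> v + w \<in> mat_kernel A"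
    and mat_kernel_smult_vec: "v \<in> mat_kernel A \<Longrightarrow> s \<cdot>\<^sub>v v \<in> mat_kernel A"
  using A by (auto simp: mat_kernel_iff[OF A] mult_mat_zero_vec mult_mat_vec_smult
      mult_add_distrib_mat_vec[OF A])

lemma mat_kernel_no_rows:
  assumes "A \<in> carrier_mat 0 p"
  shows "mat_kernel A = carrier_vec p"
  using assms by (auto simp: mat_kernel_def)

text \<open>Free modules are projective: a map \<open>B\<close> whose values lie in the image of \<open>A\<close> lifts along \<open>A\<close>.\<close>

lemma factor_through_mat_image:
  fixes A B :: "'a::comm_ring_1 mat"
  assumes A: "A \<in> carrier_mat n p" and B: "B \<in> carrier_mat n q"
    and im: "\<And>v. v \<in> carrier_vec q \<Longrightarrow> B *\<^sub>v v \<in> mat_image A"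
  shows "\<exists>C. C \<in> carrier_mat p q \<and> (\<forall>v\<in>carrier_vec q. A *\<^sub>v (C *\<^sub>v v) = B *\<^sub>v v)"
proof -
  have "\<exists>c. c \<in> carrier_vec p \<and> col B j = A *\<^sub>v c" if "j < q" for j
    using im[of "unit_vec q j"] mult_mat_vec_unit[OF B that] unfolding mat_image_iff[OF A] by auto
  then obtain c where c: "\<And>j. j < q \<Longrightarrow> c j \<in> carrier_vec p \<and> col B j = A *\<^sub>v c j" by metis
  define C where "C = mat p q (\<lambda>(i, j). c j $ i)"
  have C: "C \<in> carrier_mat p q" by (simp add: C_def)
  have colC: "col C j = c j" if "j < q" for j
    using c[OF that] that by (intro eq_vecI) (auto simp: C_def)
  have "A * C = B"
  proof (rule eq_matI)
    fix i j assume ij: "i < dim_row B" "j < dim_col B"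
    then have "(A * C) $$ (i, j) = (A *\<^sub>v c j) $ i" using A B C colC by auto
    also have "\<dots> = col B j $ i" using c[of j] ij B by auto
    finally show "(A * C) $$ (i, j) = B $$ (i, j)" using ij by simp
  qed (use A B C in auto)
  then show ?thesis using C assoc_mult_mat_vec[OF A C] by metis
qed

section \<open>Free resolutions of a cyclic module and their comparison\<close>

text \<open>A free resolution of \<open>S/I\<close> in coordinates: the augmentation \<open>S\<^sup>r\<^sup>0 \<rightarrow> S/I\<close> is
  \<open>v \<mapsto> g \<bullet> v + I\<close>.\<close>

definition quot_resolution ::
    "'a::comm_ring_1 set \<Rightarrow> 'a vec \<Rightarrow> (nat \<Rightarrow> nat) \<Rightarrow> (nat \<Rightarrow> 'a mat) \<Rightarrow> bool" where
  "quot_resolution I g r A \<longleftrightarrow>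
     (\<forall>i. A i \<in> carrier_mat (r i) (r (Suc i))) \<and>
     g \<in> carrier_vec (r 0) \<and> (\<exists>v\<in>carrier_vec (r 0). g \<bullet> v - 1 \<in> I) \<and>
     {v \<in> carrier_vec (r 0). g \<bullet> v \<in> I} = mat_image (A 0) \<and>
     (\<forall>i. mat_kernel (A i) = mat_image (A (Suc i)))"

lemma
  assumes "quot_resolution I g r A"
  shows quot_resolution_carrier: "A i \<in> carrier_mat (r i) (r (Suc i))"
    and quot_resolution_aug: "g \<in> carrier_vec (r 0)"
    and quot_resolution_one: "\<exists>v\<in>carrier_vec (r 0). g \<bullet> v - 1 \<in> I"
    and quot_resolution_exact_0: "v \<in> carrier_vec (r 0) \<Longrightarrow> g \<bullet> v \<in> I \<longleftrightarrow> v \<in> mat_image (A 0)"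
    and quot_resolution_exact: "mat_kernel (A i) = mat_image (A (Suc i))"
  using assms unfolding quot_resolution_def by blast+

lemma quot_resolution_complex:
  assumes R: "quot_resolution I g r A" and v: "v \<in> carrier_vec (r (Suc (Suc i)))"
  shows "A i *\<^sub>v (A (Suc i) *\<^sub>v v) = 0\<^sub>v (r i)"
proof -
  have "A (Suc i) *\<^sub>v v \<in> mat_kernel (A i)"
    unfolding quot_resolution_exact[OF R] using mat_image_mult[OF quot_resolution_carrier[OF R] v] .
  then show ?thesis using mat_kernel_iff[OF quot_resolution_carrier[OF R]] by blast
qed

text \<open>Chain maps that lift the identity of \<open>S/I\<close>.\<close>

definition quot_chain_map ::
    "'a::comm_ring_1 set \<Rightarrow> 'a vec \<Rightarrow> (nat \<Rightarrow> nat) \<Rightarrow> (nat \<Rightarrow> 'a mat) \<Rightarrow>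
     'a vec \<Rightarrow> (nat \<Rightarrow> nat) \<Rightarrow> (nat \<Rightarrow> 'a mat) \<Rightarrow> (nat \<Rightarrow> 'a mat) \<Rightarrow> bool" where
  "quot_chain_map I g r A g' r' A' F \<longleftrightarrow>
     (\<forall>n. F n \<in> carrier_mat (r' n) (r n)) \<and>
     (\<forall>v\<in>carrier_vec (r 0). g' \<bullet> (F 0 *\<^sub>v v) - g \<bullet> v \<in> I) \<and>
     (\<forall>n. \<forall>v\<in>carrier_vec (r (Suc n)). A' n *\<^sub>v (F (Suc n) *\<^sub>v v) = F n *\<^sub>v (A n *\<^sub>v v))"

lemma quot_chain_mapD:
  assumes "quot_chain_map I g r A g' r' A' F"
  shows "F n \<in> carrier_mat (r' n) (r n)"
    and "v \<in> carrier_vec (r 0) \<Longrightarrow> g' \<bullet> (F 0 *\<^sub>v v) - g \<bullet> v \<in> I"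
    and "v \<in> carrier_vec (r (Suc n)) \<Longrightarrow> A' n *\<^sub>v (F (Suc n) *\<^sub>v v) = F n *\<^sub>v (A n *\<^sub>v v)"
  using assms unfolding quot_chain_map_def by blast+

text \<open>In degree \<open>0\<close>, a vector \<open>v\<close> can be sent to \<open>(g \<bullet> v) u\<close> for a preimage \<open>u\<close> of \<open>1\<close>. Above that, exactness
  of the target and projectivity of the source extend the map degree by degree.\<close>

lemma resolution_chain_map:
  fixes I :: "'a::comm_ring_1 set"
  assumes I: "ideal I class_ring" and R: "quot_resolution I g r A" and R': "quot_resolution I g' r' A'"
  obtains F where "quot_chain_map I g r A g' r' A' F"
proof -
  note cA = quot_resolution_carrier[OF R] and cA' = quot_resolution_carrier[OF R']
  note g = quot_resolution_aug[OF R] and g' = quot_resolution_aug[OF R']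
  obtain u where u: "u \<in> carrier_vec (r' 0)" "g' \<bullet> u - 1 \<in> I" using quot_resolution_one[OF R'] by auto
  define F0 where "F0 = mat (r' 0) (r 0) (\<lambda>(i, j). u $ i * g $ j)"
  have F0: "F0 \<in> carrier_mat (r' 0) (r 0)" by (simp add: F0_def)
  have F0v: "F0 *\<^sub>v v = (g \<bullet> v) \<cdot>\<^sub>v u" if "v \<in> carrier_vec (r 0)" for v
    using that u g by (intro eq_vecI)
      (auto simp: F0_def scalar_prod_def sum_distrib_left sum_distrib_right ac_simps)
  have aug: "g' \<bullet> (F0 *\<^sub>v v) - g \<bullet> v \<in> I" if "v \<in> carrier_vec (r 0)" for v
  proof -
    have "g' \<bullet> (F0 *\<^sub>v v) - g \<bullet> v = (g \<bullet> v) * (g' \<bullet> u - 1)"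
      using u g' F0v[OF that] by (simp add: algebra_simps)
    then show ?thesis using class_ideal_mult[OF I u(2)] by simp
  qed
  define P where "P n F \<longleftrightarrow> fst F \<in> carrier_mat (r' n) (r n) \<and> snd F \<in> carrier_mat (r' (Suc n)) (r (Suc n))
      \<and> (\<forall>v \<in> carrier_vec (r (Suc n)). A' n *\<^sub>v (snd F *\<^sub>v v) = fst F *\<^sub>v (A n *\<^sub>v v)) \<and> (n = 0 \<longrightarrow> fst F = F0)"
    for n and F :: "'a mat \<times> 'a mat"
  have lift: "\<exists>C. C \<in> carrier_mat (r' (Suc n)) (r (Suc n))
      \<and> (\<forall>v \<in> carrier_vec (r (Suc n)). A' n *\<^sub>v (C *\<^sub>v v) = F *\<^sub>v (A n *\<^sub>v v))"
    if F: "F \<in> carrier_mat (r' n) (r n)"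
      and im: "\<And>v. v \<in> carrier_vec (r (Suc n)) \<Longrightarrow> F *\<^sub>v (A n *\<^sub>v v) \<in> mat_image (A' n)" for n F
  proof -
    have FA: "(F * A n) *\<^sub>v v = F *\<^sub>v (A n *\<^sub>v v)" if "v \<in> carrier_vec (r (Suc n))" for v
      by (rule assoc_mult_mat_vec[OF F cA that])
    then show ?thesis
      using factor_through_mat_image[OF cA' mult_carrier_mat[OF F cA]] im by simp
  qed
  have "\<exists>f. \<forall>n. P n (f n) \<and> fst (f (Suc n)) = snd (f n)"
  proof (rule dependent_nat_choice)
    have "F0 *\<^sub>v (A 0 *\<^sub>v v) \<in> mat_image (A' 0)" if v: "v \<in> carrier_vec (r (Suc 0))" for v
    proof -
      note Av = mult_mat_vec_carrier[OF cA v]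
      have "g \<bullet> (A 0 *\<^sub>v v) \<in> I"
        using quot_resolution_exact_0[OF R Av] mat_image_mult[OF cA v] by simp
      then have "g' \<bullet> (F0 *\<^sub>v (A 0 *\<^sub>v v)) \<in> I"
        using class_ideal_add[OF I aug[OF Av], of "g \<bullet> (A 0 *\<^sub>v v)"] by simp
      then show ?thesis using quot_resolution_exact_0[OF R'] mult_mat_vec_carrier[OF F0 Av] by blast
    qed
    then obtain C where "C \<in> carrier_mat (r' (Suc 0)) (r (Suc 0))"
      "\<forall>v \<in> carrier_vec (r (Suc 0)). A' 0 *\<^sub>v (C *\<^sub>v v) = F0 *\<^sub>v (A 0 *\<^sub>v v)"
      using lift[OF F0] by auto
    then show "\<exists>F. P 0 F" unfolding P_def using F0 by (intro exI[of _ "(F0, C)"]) auto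
  next
    fix F :: "'a mat \<times> 'a mat" and n assume F: "P n F"
    then have c: "fst F \<in> carrier_mat (r' n) (r n)" "snd F \<in> carrier_mat (r' (Suc n)) (r (Suc n))"
      and comm: "\<And>v. v \<in> carrier_vec (r (Suc n)) \<Longrightarrow> A' n *\<^sub>v (snd F *\<^sub>v v) = fst F *\<^sub>v (A n *\<^sub>v v)"
      by (auto simp: P_def)
    have "snd F *\<^sub>v (A (Suc n) *\<^sub>v v) \<in> mat_image (A' (Suc n))" if v: "v \<in> carrier_vec (r (Suc (Suc n)))" for v
    proof -
      note Av = mult_mat_vec_carrier[OF cA v]
      have "A' n *\<^sub>v (snd F *\<^sub>v (A (Suc n) *\<^sub>v v)) = 0\<^sub>v (r' n)"
        unfolding comm[OF Av] quot_resolution_complex[OF R v] by (rule mult_mat_zero_vec[OF c(1)])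
      then show ?thesis
        unfolding quot_resolution_exact[OF R', symmetric] mat_kernel_iff[OF cA']
        using mult_mat_vec_carrier[OF c(2) Av] by simp
    qed
    then obtain C where "C \<in> carrier_mat (r' (Suc (Suc n))) (r (Suc (Suc n)))"
      "\<forall>v \<in> carrier_vec (r (Suc (Suc n))). A' (Suc n) *\<^sub>v (C *\<^sub>v v) = snd F *\<^sub>v (A (Suc n) *\<^sub>v v)"
      using lift[OF c(2)] by auto
    then show "\<exists>E. P (Suc n) E \<and> fst E = snd F"
      unfolding P_def using c by (intro exI[of _ "(snd F, C)"]) auto
  qed
  then obtain f where f: "\<And>n. P n (f n)" "\<And>n. fst (f (Suc n)) = snd (f n)" by auto
  have "quot_chain_map I g r A g' r' A' (\<lambda>n. fst (f n))"
    unfolding quot_chain_map_def using f aug by (simp add: P_def)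
  then show thesis by (rule that)
qed

text \<open>The values of \<open>D - H A\<close> lie in the kernel of \<open>A\<close>, so that \<open>H\<close> can be continued by lifting along
  the next differential. The case of interest is \<open>D = 1 - G F\<close>.\<close>

lemma resolution_null_homotopy:
  fixes I :: "'a::comm_ring_1 set"
  assumes R: "quot_resolution I g r A"
    and D: "\<And>n. D n \<in> carrier_mat (r n) (r n)"
    and aug: "\<And>v. v \<in> carrier_vec (r 0) \<Longrightarrow> g \<bullet> (D 0 *\<^sub>v v) \<in> I"
    and comm: "\<And>n v. v \<in> carrier_vec (r (Suc n)) \<Longrightarrow> A n *\<^sub>v (D (Suc n) *\<^sub>v v) = D n *\<^sub>v (A n *\<^sub>v v)"
  obtains H where "\<And>n. H n \<in> carrier_mat (r (Suc n)) (r n)"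
    "\<And>n v. v \<in> carrier_vec (r (Suc n)) \<Longrightarrow>
       D (Suc n) *\<^sub>v v = A (Suc n) *\<^sub>v (H (Suc n) *\<^sub>v v) + H n *\<^sub>v (A n *\<^sub>v v)"
proof -
  note cA = quot_resolution_carrier[OF R]
  define P where "P n H \<longleftrightarrow> fst H \<in> carrier_mat (r (Suc n)) (r n)
      \<and> snd H \<in> carrier_mat (r (Suc (Suc n))) (r (Suc n))
      \<and> (\<forall>v \<in> carrier_vec (r (Suc n)). A (Suc n) *\<^sub>v (snd H *\<^sub>v v) = D (Suc n) *\<^sub>v v - fst H *\<^sub>v (A n *\<^sub>v v))"
    for n and H :: "'a mat \<times> 'a mat"
  have lift: "\<exists>C. C \<in> carrier_mat (r (Suc (Suc n))) (r (Suc n))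
      \<and> (\<forall>v \<in> carrier_vec (r (Suc n)). A (Suc n) *\<^sub>v (C *\<^sub>v v) = D (Suc n) *\<^sub>v v - H *\<^sub>v (A n *\<^sub>v v))"
    if H: "H \<in> carrier_mat (r (Suc n)) (r n)"
      and ker: "\<And>v. v \<in> carrier_vec (r (Suc n)) \<Longrightarrow>
        A n *\<^sub>v (D (Suc n) *\<^sub>v v) = A n *\<^sub>v (H *\<^sub>v (A n *\<^sub>v v))" for n H
  proof -
    have HA: "H * A n \<in> carrier_mat (r (Suc n)) (r (Suc n))" using H cA by auto
    have B: "D (Suc n) - H * A n \<in> carrier_mat (r (Suc n)) (r (Suc n))"
      by (rule minus_carrier_mat[OF HA])
    have Bv: "(D (Suc n) - H * A n) *\<^sub>v v = D (Suc n) *\<^sub>v v - H *\<^sub>v (A n *\<^sub>v v)"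
      if "v \<in> carrier_vec (r (Suc n))" for v
      using minus_mult_distrib_mat_vec[OF D HA that] assoc_mult_mat_vec[OF H cA that] by simp
    have "\<exists>C. C \<in> carrier_mat (r (Suc (Suc n))) (r (Suc n))
        \<and> (\<forall>v\<in>carrier_vec (r (Suc n)). A (Suc n) *\<^sub>v (C *\<^sub>v v) = (D (Suc n) - H * A n) *\<^sub>v v)"
    proof (rule factor_through_mat_image[OF cA B])
      fix v :: "'a vec" assume v: "v \<in> carrier_vec (r (Suc n))"
      note Dv = mult_mat_vec_carrier[OF D v]
      note Av = mult_mat_vec_carrier[OF cA v]
      note HAv = mult_mat_vec_carrier[OF H Av]
      have "A n *\<^sub>v (H *\<^sub>v (A n *\<^sub>v v)) \<in> carrier_vec (r n)" using cA HAv by (rule mult_mat_vec_carrier)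
      then have "A n *\<^sub>v (D (Suc n) *\<^sub>v v - H *\<^sub>v (A n *\<^sub>v v)) = 0\<^sub>v (r n)"
        unfolding mult_minus_distrib_mat_vec[OF cA Dv HAv] ker[OF v] by simp
      then show "(D (Suc n) - H * A n) *\<^sub>v v \<in> mat_image (A (Suc n))"
        unfolding quot_resolution_exact[OF R, symmetric] mat_kernel_iff[OF cA] Bv[OF v]
        using Dv HAv by simp
    qed
    then show ?thesis by (simp add: Bv)
  qed
  have "\<exists>f. \<forall>n. P n (f n) \<and> fst (f (Suc n)) = snd (f n)"
  proof (rule dependent_nat_choice)
    have "\<exists>H0. H0 \<in> carrier_mat (r (Suc 0)) (r 0) \<and> (\<forall>v\<in>carrier_vec (r 0). A 0 *\<^sub>v (H0 *\<^sub>v v) = D 0 *\<^sub>v v)"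
    proof (rule factor_through_mat_image[OF cA D])
      fix v :: "'a vec" assume "v \<in> carrier_vec (r 0)"
      then show "D 0 *\<^sub>v v \<in> mat_image (A 0)"
        using quot_resolution_exact_0[OF R, of "D 0 *\<^sub>v v"] aug mult_mat_vec_carrier[OF D] by blast
    qed
    then obtain H0 where H0: "H0 \<in> carrier_mat (r (Suc 0)) (r 0)"
      "\<And>v. v \<in> carrier_vec (r 0) \<Longrightarrow> A 0 *\<^sub>v (H0 *\<^sub>v v) = D 0 *\<^sub>v v" by auto
    have "A 0 *\<^sub>v (D (Suc 0) *\<^sub>v v) = A 0 *\<^sub>v (H0 *\<^sub>v (A 0 *\<^sub>v v))" if v: "v \<in> carrier_vec (r (Suc 0))" for v
      using comm[OF v] H0(2)[OF mult_mat_vec_carrier[OF cA v]] by simp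
    then obtain C where "C \<in> carrier_mat (r (Suc (Suc 0))) (r (Suc 0))"
      "\<forall>v \<in> carrier_vec (r (Suc 0)). A (Suc 0) *\<^sub>v (C *\<^sub>v v) = D (Suc 0) *\<^sub>v v - H0 *\<^sub>v (A 0 *\<^sub>v v)"
      using lift[OF H0(1)] by auto
    then show "\<exists>H. P 0 H" unfolding P_def using H0 by (intro exI[of _ "(H0, C)"]) auto
  next
    fix H :: "'a mat \<times> 'a mat" and n assume "P n H"
    then have c: "fst H \<in> carrier_mat (r (Suc n)) (r n)" "snd H \<in> carrier_mat (r (Suc (Suc n))) (r (Suc n))"
      and H: "\<And>v. v \<in> carrier_vec (r (Suc n)) \<Longrightarrow>
        A (Suc n) *\<^sub>v (snd H *\<^sub>v v) = D (Suc n) *\<^sub>v v - fst H *\<^sub>v (A n *\<^sub>v v)"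
      by (auto simp: P_def)
    have "A (Suc n) *\<^sub>v (D (Suc (Suc n)) *\<^sub>v v) = A (Suc n) *\<^sub>v (snd H *\<^sub>v (A (Suc n) *\<^sub>v v))"
      if v: "v \<in> carrier_vec (r (Suc (Suc n)))" for v
    proof -
      note Av = mult_mat_vec_carrier[OF cA v]
      have "D (Suc n) *\<^sub>v (A (Suc n) *\<^sub>v v) \<in> carrier_vec (r (Suc n))" using D Av by (rule mult_mat_vec_carrier)
      then show ?thesis
        unfolding H[OF Av] comm[OF v] quot_resolution_complex[OF R v] mult_mat_zero_vec[OF c(1)] by simp
    qed
    then obtain C where "C \<in> carrier_mat (r (Suc (Suc (Suc n)))) (r (Suc (Suc n)))"
      "\<forall>v \<in> carrier_vec (r (Suc (Suc n))). A (Suc (Suc n)) *\<^sub>v (C *\<^sub>v v)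
         = D (Suc (Suc n)) *\<^sub>v v - snd H *\<^sub>v (A (Suc n) *\<^sub>v v)"
      using lift[OF c(2)] by auto
    then show "\<exists>E. P (Suc n) E \<and> fst E = snd H"
      unfolding P_def using c by (intro exI[of _ "(snd H, C)"]) auto
  qed
  then obtain f where f: "\<And>n. P n (f n)" "\<And>n. fst (f (Suc n)) = snd (f n)" by auto
  have c: "fst (f n) \<in> carrier_mat (r (Suc n)) (r n)" for n using f(1) by (simp add: P_def)
  show thesis
  proof (rule that[of "\<lambda>n. fst (f n)", OF c])
    fix n and v :: "'a vec" assume v: "v \<in> carrier_vec (r (Suc n))"
    have 1: "A (Suc n) *\<^sub>v (fst (f (Suc n)) *\<^sub>v v) = D (Suc n) *\<^sub>v v - fst (f n) *\<^sub>v (A n *\<^sub>v v)"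
      using f(1)[of n] v by (simp add: P_def f(2))
    have "D (Suc n) *\<^sub>v v \<in> carrier_vec (r (Suc n))" using D v by (rule mult_mat_vec_carrier)
    moreover have "fst (f n) *\<^sub>v (A n *\<^sub>v v) \<in> carrier_vec (r (Suc n))"
      using c mult_mat_vec_carrier[OF cA v] by (rule mult_mat_vec_carrier)
    ultimately show "D (Suc n) *\<^sub>v v
        = A (Suc n) *\<^sub>v (fst (f (Suc n)) *\<^sub>v v) + fst (f n) *\<^sub>v (A n *\<^sub>v v)"
      unfolding 1 by (rule vec_diff_add_cancel[symmetric])
  qed
qed

lemma transpose_chain_map:
  fixes A A' F F' :: "'a::comm_ring_1 mat"
  assumes c: "A \<in> carrier_mat p q" "A' \<in> carrier_mat p' q'" "F \<in> carrier_mat p' p" "F' \<in> carrier_mat q' q"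
    and comm: "\<And>v. v \<in> carrier_vec q \<Longrightarrow> A' *\<^sub>v (F' *\<^sub>v v) = F *\<^sub>v (A *\<^sub>v v)"
    and u: "u \<in> carrier_vec p'"
  shows "A\<^sup>T *\<^sub>v (F\<^sup>T *\<^sub>v u) = F'\<^sup>T *\<^sub>v (A'\<^sup>T *\<^sub>v u)"
proof (rule vec_eq_if_scalar_prod_eq[of _ q])
  have t: "A\<^sup>T \<in> carrier_mat q p" "A'\<^sup>T \<in> carrier_mat q' p'" "F\<^sup>T \<in> carrier_mat p p'" "F'\<^sup>T \<in> carrier_mat q q'"
    using c by auto
  have Fu: "F\<^sup>T *\<^sub>v u \<in> carrier_vec p" and Au: "A'\<^sup>T *\<^sub>v u \<in> carrier_vec q'"
    using mult_mat_vec_carrier[OF t(3) u] mult_mat_vec_carrier[OF t(2) u] .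
  show "A\<^sup>T *\<^sub>v (F\<^sup>T *\<^sub>v u) \<in> carrier_vec q" "F'\<^sup>T *\<^sub>v (A'\<^sup>T *\<^sub>v u) \<in> carrier_vec q"
    using mult_mat_vec_carrier[OF t(1) Fu] mult_mat_vec_carrier[OF t(4) Au] .
  fix v :: "'a vec" assume v: "v \<in> carrier_vec q"
  have Av: "A *\<^sub>v v \<in> carrier_vec p" and Fv: "F' *\<^sub>v v \<in> carrier_vec q'"
    using mult_mat_vec_carrier[OF c(1) v] mult_mat_vec_carrier[OF c(4) v] .
  show "(A\<^sup>T *\<^sub>v (F\<^sup>T *\<^sub>v u)) \<bullet> v = (F'\<^sup>T *\<^sub>v (A'\<^sup>T *\<^sub>v u)) \<bullet> v"
    using transpose_vec_mult_scalar[OF c(1) v Fu] transpose_vec_mult_scalar[OF c(3) Av u]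
      transpose_vec_mult_scalar[OF c(4) v Au] transpose_vec_mult_scalar[OF c(2) Fv u] comm[OF v] by simp
qed

lemma transpose_chain_map_kernel_image:
  fixes A A' F :: "nat \<Rightarrow> 'a::comm_ring_1 mat"
  assumes R: "quot_resolution I g r A" and R': "quot_resolution I g' r' A'"
    and F: "quot_chain_map I g r A g' r' A' F"
  shows "u \<in> mat_kernel ((A' n)\<^sup>T) \<Longrightarrow> (F n)\<^sup>T *\<^sub>v u \<in> mat_kernel ((A n)\<^sup>T)"
    and "u \<in> mat_image ((A' n)\<^sup>T) \<Longrightarrow> (F (Suc n))\<^sup>T *\<^sub>v u \<in> mat_image ((A n)\<^sup>T)"
proof -
  note c = quot_resolution_carrier[OF R] quot_resolution_carrier[OF R'] quot_chain_mapD(1)[OF F]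
  have t: "(A n)\<^sup>T \<in> carrier_mat (r (Suc n)) (r n)" "(A' n)\<^sup>T \<in> carrier_mat (r' (Suc n)) (r' n)"
    "(F n)\<^sup>T \<in> carrier_mat (r n) (r' n)" "(F (Suc n))\<^sup>T \<in> carrier_mat (r (Suc n)) (r' (Suc n))" for n
    using c(1,2)[of n] c(3)[of n] c(3)[of "Suc n"] by auto
  note eq = transpose_chain_map[OF c(1,2,3,3) quot_chain_mapD(3)[OF F]]
  show "(F n)\<^sup>T *\<^sub>v u \<in> mat_kernel ((A n)\<^sup>T)" if "u \<in> mat_kernel ((A' n)\<^sup>T)"
    using that mult_mat_vec_carrier[OF t(3), of u n] eq[of n u] mult_mat_zero_vec[OF t(4)]
    unfolding mat_kernel_iff[OF t(1)] mat_kernel_iff[OF t(2)] by simp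
  show "(F (Suc n))\<^sup>T *\<^sub>v u \<in> mat_image ((A n)\<^sup>T)" if "u \<in> mat_image ((A' n)\<^sup>T)"
    using that eq[of n] mult_mat_vec_carrier[OF t(3)]
    unfolding mat_image_iff[OF t(1)] mat_image_iff[OF t(2)] by metis
qed

text \<open>If \<open>1 - G F = A H + H A\<close>, then dually \<open>u - F\<^sup>T G\<^sup>T u\<close> is a coboundary for every cocycle \<open>u\<close>. So the
  maps that \<open>F\<close> and \<open>G\<close> induce on \<open>Ext\<^sup>n\<^sup>+\<^sup>1\<close> are inverse to each other; the other composite is covered
  by exchanging the two resolutions.\<close>

lemma resolution_homotopy_identity:
  fixes I :: "'a::comm_ring_1 set"
  assumes I: "ideal I class_ring" and R: "quot_resolution I g r A" and R': "quot_resolution I g' r' A'"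
    and F': "quot_chain_map I g r A g' r' A' F" and G': "quot_chain_map I g' r' A' g r A G"
    and u: "u \<in> mat_kernel ((A (Suc n))\<^sup>T)"
  shows "u - (F (Suc n))\<^sup>T *\<^sub>v ((G (Suc n))\<^sup>T *\<^sub>v u) \<in> mat_image ((A n)\<^sup>T)"
proof -
  note cA = quot_resolution_carrier[OF R] and cA' = quot_resolution_carrier[OF R']
  note g = quot_resolution_aug[OF R] and g' = quot_resolution_aug[OF R']
  note F = quot_chain_mapD[OF F'] and G = quot_chain_mapD[OF G']
  define D where "D n = 1\<^sub>m (r n) - G n * F n" for n
  have GF: "G n * F n \<in> carrier_mat (r n) (r n)" for n using mult_carrier_mat[OF G(1) F(1)] .
  have D: "D n \<in> carrier_mat (r n) (r n)" for n unfolding D_def by (rule minus_carrier_mat[OF GF])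
  have Dv: "D n *\<^sub>v v = v - G n *\<^sub>v (F n *\<^sub>v v)" if "v \<in> carrier_vec (r n)" for n v
    unfolding D_def using minus_mult_distrib_mat_vec[OF one_carrier_mat GF that]
      assoc_mult_mat_vec[OF G(1) F(1) that] that by simp
  note FV = mult_mat_vec_carrier[OF F(1)] and GV = mult_mat_vec_carrier[OF G(1)]
    and AV = mult_mat_vec_carrier[OF cA]
  have aug: "g \<bullet> (D 0 *\<^sub>v v) \<in> I" if v: "v \<in> carrier_vec (r 0)" for v
  proof -
    have "g \<bullet> (D 0 *\<^sub>v v) = - ((g \<bullet> (G 0 *\<^sub>v (F 0 *\<^sub>v v)) - g' \<bullet> (F 0 *\<^sub>v v)) + (g' \<bullet> (F 0 *\<^sub>v v) - g \<bullet> v))"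
      unfolding Dv[OF v] using scalar_prod_minus_distrib[OF g v GV[OF FV[OF v]]] by simp
    then show ?thesis
      using class_ideal_uminus[OF I class_ideal_add[OF I G(2)[OF FV[OF v]] F(2)[OF v]]] by simp
  qed
  have comm: "A n *\<^sub>v (D (Suc n) *\<^sub>v v) = D n *\<^sub>v (A n *\<^sub>v v)" if v: "v \<in> carrier_vec (r (Suc n))" for n v
    unfolding Dv[OF v] Dv[OF AV[OF v]]
    using mult_minus_distrib_mat_vec[OF cA v GV[OF FV[OF v]]] G(3)[OF FV[OF v]] F(3)[OF v] by simp
  obtain H where H: "\<And>n. H n \<in> carrier_mat (r (Suc n)) (r n)"
    and HD: "\<And>n v. v \<in> carrier_vec (r (Suc n)) \<Longrightarrow>
       D (Suc n) *\<^sub>v v = A (Suc n) *\<^sub>v (H (Suc n) *\<^sub>v v) + H n *\<^sub>v (A n *\<^sub>v v)"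
    using resolution_null_homotopy[OF R D aug comm] by metis
  let ?m = "Suc n"
  have t: "(A n)\<^sup>T \<in> carrier_mat (r ?m) (r n)" "(A ?m)\<^sup>T \<in> carrier_mat (r (Suc ?m)) (r ?m)"
    "(F ?m)\<^sup>T \<in> carrier_mat (r ?m) (r' ?m)" "(G ?m)\<^sup>T \<in> carrier_mat (r' ?m) (r ?m)"
    "(H n)\<^sup>T \<in> carrier_mat (r n) (r ?m)"
    using F(1)[of ?m] G(1)[of ?m] H[of n] cA[of n] cA[of ?m] by auto
  have uc: "u \<in> carrier_vec (r ?m)" and u0: "(A ?m)\<^sup>T *\<^sub>v u = 0\<^sub>v (r (Suc ?m))"
    using u unfolding mat_kernel_iff[OF t(2)] by auto
  have Gu: "(G ?m)\<^sup>T *\<^sub>v u \<in> carrier_vec (r' ?m)" and Hu: "(H n)\<^sup>T *\<^sub>v u \<in> carrier_vec (r n)"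
    using mult_mat_vec_carrier[OF t(4) uc] mult_mat_vec_carrier[OF t(5) uc] .
  have FGu: "(F ?m)\<^sup>T *\<^sub>v ((G ?m)\<^sup>T *\<^sub>v u) \<in> carrier_vec (r ?m)"
    using mult_mat_vec_carrier[OF t(3) Gu] .
  have "u - (F ?m)\<^sup>T *\<^sub>v ((G ?m)\<^sup>T *\<^sub>v u) = (A n)\<^sup>T *\<^sub>v ((H n)\<^sup>T *\<^sub>v u)"
  proof (rule vec_eq_if_scalar_prod_eq[of _ "r ?m"])
    show "u - (F ?m)\<^sup>T *\<^sub>v ((G ?m)\<^sup>T *\<^sub>v u) \<in> carrier_vec (r ?m)" using uc FGu by simp
    show "(A n)\<^sup>T *\<^sub>v ((H n)\<^sup>T *\<^sub>v u) \<in> carrier_vec (r ?m)" using mult_mat_vec_carrier[OF t(1) Hu] .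
    fix v :: "'a vec" assume v: "v \<in> carrier_vec (r ?m)"
    note Av = AV[OF v] and Fv = FV[OF v] and GFv = GV[OF FV[OF v]]
    note Hv = mult_mat_vec_carrier[OF H v]
    note HAv = mult_mat_vec_carrier[OF H Av]
    note AHv = mult_mat_vec_carrier[OF cA Hv]
    have "(u - (F ?m)\<^sup>T *\<^sub>v ((G ?m)\<^sup>T *\<^sub>v u)) \<bullet> v = u \<bullet> v - u \<bullet> (G ?m *\<^sub>v (F ?m *\<^sub>v v))"
      using minus_scalar_prod_distrib[OF uc FGu v] transpose_vec_mult_scalar[OF F(1) v Gu]
        transpose_vec_mult_scalar[OF G(1) Fv uc] by simp
    also have "\<dots> = u \<bullet> (D ?m *\<^sub>v v)"
      unfolding Dv[OF v] using scalar_prod_minus_distrib[OF uc v GFv] by simp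
    also have "\<dots> = u \<bullet> (A ?m *\<^sub>v (H ?m *\<^sub>v v)) + u \<bullet> (H n *\<^sub>v (A n *\<^sub>v v))"
      unfolding HD[OF v] using scalar_prod_add_distrib[OF uc AHv HAv] .
    also have "u \<bullet> (A ?m *\<^sub>v (H ?m *\<^sub>v v)) = 0"
      using transpose_vec_mult_scalar[OF cA Hv uc] u0 Hv by simp
    also have "u \<bullet> (H n *\<^sub>v (A n *\<^sub>v v)) = ((A n)\<^sup>T *\<^sub>v ((H n)\<^sup>T *\<^sub>v u)) \<bullet> v"
      using transpose_vec_mult_scalar[OF H Av uc] transpose_vec_mult_scalar[OF cA v Hu] by simp
    finally show "(u - (F ?m)\<^sup>T *\<^sub>v ((G ?m)\<^sup>T *\<^sub>v u)) \<bullet> v = ((A n)\<^sup>T *\<^sub>v ((H n)\<^sup>T *\<^sub>v u)) \<bullet> v" by simp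
  qed
  then show ?thesis using mat_image_mult[OF t(1) Hu] by simp
qed

section \<open>The canonical module as a cokernel and its trace\<close>

text \<open>An \<open>S\<close>-linear map \<open>S\<^sup>n \<rightarrow> S/I\<close> is determined by representatives \<open>g\<^sub>k\<close> of the images of the basis
  vectors.\<close>

lemma coset_functional:
  assumes I: "ideal I class_ring"
    and car: "\<And>v. v \<in> carrier_vec n \<Longrightarrow> \<phi> v \<in> range (coset I)"
    and add: "\<And>v w. v \<in> carrier_vec n \<Longrightarrow> w \<in> carrier_vec n \<Longrightarrow> \<phi> (v + w) = \<phi> v \<oplus>\<^bsub>class_ring Quot I\<^esub> \<phi> w"
    and smult: "\<And>s v. v \<in> carrier_vec n \<Longrightarrow> \<phi> (s \<cdot>\<^sub>v v) = coset I s \<otimes>\<^bsub>class_ring Quot I\<^esub> \<phi> v"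
  shows "\<exists>g\<in>carrier_vec n. \<forall>v\<in>carrier_vec n. \<phi> v = coset I (g \<bullet> v)"
proof -
  have "\<exists>c. \<phi> (unit_vec n k) = coset I c" for k using car[of "unit_vec n k"] by auto
  then obtain c where c: "\<And>k. \<phi> (unit_vec n k) = coset I (c k)" by metis
  define g where "g = vec n c"
  have "\<phi> v = coset I (g \<bullet> v)" if v: "v \<in> carrier_vec n" for v
  proof -
    let ?v = "\<lambda>k. vec n (\<lambda>i. if i < k then v $ i else 0)"
    have "k \<le> n \<Longrightarrow> \<phi> (?v k) = coset I (\<Sum>i<k. c i * v $ i)" for k
    proof (induction k)
      case 0
      obtain z where z: "\<phi> (0\<^sub>v n) = coset I z" using car[of "0\<^sub>v n"] by auto
      have "\<phi> (0 \<cdot>\<^sub>v 0\<^sub>v n) = coset I 0" using smult[of "0\<^sub>v n" 0] by (simp add: z mult_Quot[OF I])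
      moreover have "?v 0 = 0 \<cdot>\<^sub>v 0\<^sub>v n" by (intro eq_vecI) auto
      ultimately show ?case by simp
    next
      case (Suc k)
      have eq: "?v (Suc k) = ?v k + v $ k \<cdot>\<^sub>v unit_vec n k"
        using Suc.prems by (intro eq_vecI) (auto simp: less_Suc_eq)
      have "\<phi> (?v (Suc k)) = coset I (\<Sum>i<k. c i * v $ i) \<oplus>\<^bsub>class_ring Quot I\<^esub> coset I (v $ k * c k)"
        unfolding eq using Suc add[of "?v k" "v $ k \<cdot>\<^sub>v unit_vec n k"] smult[of "unit_vec n k" "v $ k"]
        by (simp add: c mult_Quot[OF I])
      then show ?case by (simp add: add_Quot[OF I] mult.commute)
    qed
    from this[of n] have "\<phi> (?v n) = coset I (\<Sum>i<n. c i * v $ i)" by simp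
    moreover have "?v n = v" using v by (intro eq_vecI) auto
    moreover have "(\<Sum>i<n. c i * v $ i) = g \<bullet> v"
      using v by (simp add: g_def scalar_prod_def atLeast0LessThan)
    ultimately show ?thesis by simp
  qed
  then show ?thesis by (intro bexI[of _ g]) (auto simp: g_def)
qed

lemma free_resolution_imp_quot_resolution:
  assumes I: "ideal I class_ring"
    and R: "free_resolution (restrict_scalars (coset I) (regular_module (class_ring Quot I))) r A"
  obtains g where "quot_resolution I g r A"
proof -
  let ?M = "restrict_scalars (coset I) (regular_module (class_ring Quot I))"
  have M: "carrier ?M = range (coset I)" "\<zero>\<^bsub>?M\<^esub> = coset I 0"
    "x \<oplus>\<^bsub>?M\<^esub> y = x \<oplus>\<^bsub>class_ring Quot I\<^esub> y" "s \<odot>\<^bsub>?M\<^esub> x = coset I s \<otimes>\<^bsub>class_ring Quot I\<^esub> x" for x y s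
    by (simp_all add: restrict_scalars_def regular_module_def carrier_Quot[OF I] zero_Quot[OF I])
  obtain \<epsilon> where \<epsilon>: "\<epsilon> \<in> module_hom class_ring (module_vec TYPE('a) (r 0)) ?M"
    and onto: "\<epsilon> ` carrier_vec (r 0) = carrier ?M"
    and ker: "{v \<in> carrier_vec (r 0). \<epsilon> v = \<zero>\<^bsub>?M\<^esub>} = mat_image (A 0)"
    using R unfolding free_resolution_def by auto
  have "\<exists>g\<in>carrier_vec (r 0). \<forall>v\<in>carrier_vec (r 0). \<epsilon> v = coset I (g \<bullet> v)"
  proof (rule coset_functional[OF I])
    show "\<epsilon> v \<in> range (coset I)" if "v \<in> carrier_vec (r 0)" for v
      using that onto unfolding M by blast
  qed (use \<epsilon> in \<open>auto simp: module_hom_def module_vec_simps M\<close>)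
  then obtain g where g: "g \<in> carrier_vec (r 0)" "\<And>v. v \<in> carrier_vec (r 0) \<Longrightarrow> \<epsilon> v = coset I (g \<bullet> v)"
    by auto
  have "coset I 1 \<in> \<epsilon> ` carrier_vec (r 0)" unfolding onto M by simp
  then obtain v where "v \<in> carrier_vec (r 0)" "coset I 1 = coset I (g \<bullet> v)" using g by auto
  then have "\<exists>v\<in>carrier_vec (r 0). g \<bullet> v - 1 \<in> I" using coset_eq_iff[OF I] by metis
  moreover have "{v \<in> carrier_vec (r 0). g \<bullet> v \<in> I} = mat_image (A 0)"
    unfolding ker[symmetric] M by (simp add: g(2) coset_eq_iff[OF I] cong: conj_cong)
  ultimately have "quot_resolution I g r A"
    using R g(1) unfolding quot_resolution_def free_resolution_def by auto
  then show thesis by (rule that)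
qed

text \<open>The map \<open>\<eta>\<close> induces an isomorphism \<open>K/(K \<inter> N) \<rightarrow> W\<close> of \<open>S\<close>-modules. Working with representing
  vectors in place of cosets keeps the later arguments in terms of matrices.\<close>

definition linear_cover ::
    "'a::comm_ring_1 set \<Rightarrow> ('a set, 'w) module \<Rightarrow> 'a vec set \<Rightarrow> 'a vec set \<Rightarrow> ('a vec \<Rightarrow> 'w) \<Rightarrow> bool" where
  "linear_cover I W K N \<eta> \<longleftrightarrow>
     (\<forall>v\<in>K. \<forall>w\<in>K. \<eta> (v + w) = \<eta> v \<oplus>\<^bsub>W\<^esub> \<eta> w) \<and>
     (\<forall>s. \<forall>v\<in>K. \<eta> (s \<cdot>\<^sub>v v) = coset I s \<odot>\<^bsub>W\<^esub> \<eta> v) \<and>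
     \<eta> ` K = carrier W \<and> (\<forall>v\<in>K. \<eta> v = \<zero>\<^bsub>W\<^esub> \<longleftrightarrow> v \<in> N)"

lemma
  assumes "linear_cover I W K N \<eta>"
  shows linear_cover_add: "v \<in> K \<Longrightarrow> w \<in> K \<Longrightarrow> \<eta> (v + w) = \<eta> v \<oplus>\<^bsub>W\<^esub> \<eta> w"
    and linear_cover_smult: "v \<in> K \<Longrightarrow> \<eta> (s \<cdot>\<^sub>v v) = coset I s \<odot>\<^bsub>W\<^esub> \<eta> v"
    and linear_cover_onto: "\<eta> ` K = carrier W"
    and linear_cover_kernel: "v \<in> K \<Longrightarrow> \<eta> v = \<zero>\<^bsub>W\<^esub> \<longleftrightarrow> v \<in> N"
  using assms unfolding linear_cover_def by blast+

lemma linear_cover_quotient_module: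
  fixes I :: "'a::comm_ring_1 set" and W :: "('a set, 'w) module" and n :: nat
  defines "V \<equiv> module_vec TYPE('a) n"
  assumes I: "ideal I class_ring" and W: "Module.module (class_ring Quot I) W"
    and K: "K \<subseteq> carrier_vec n" "0\<^sub>v n \<in> K" "\<And>v w. v \<in> K \<Longrightarrow> w \<in> K \<Longrightarrow> v + w \<in> K"
      "\<And>s v. v \<in> K \<Longrightarrow> s \<cdot>\<^sub>v v \<in> K"
    and N: "N \<subseteq> carrier_vec n" "0\<^sub>v n \<in> N" "\<And>v w. v \<in> N \<Longrightarrow> w \<in> N \<Longrightarrow> v + w \<in> N"
      "\<And>s v. v \<in> N \<Longrightarrow> s \<cdot>\<^sub>v v \<in> N"
    and h: "h \<in> module_hom class_ring (quotient_module (V\<lparr>carrier := K\<rparr>) N) (restrict_scalars (coset I) W)"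
    and bij: "bij_betw h (carrier (quotient_module (V\<lparr>carrier := K\<rparr>) N)) (carrier W)"
  shows "\<exists>\<eta>. linear_cover I W K N \<eta>"
proof -
  interpret W: Module.module "class_ring Quot I" W by (rule W)
  let ?M = "V\<lparr>carrier := K\<rparr>" and ?Q = "quotient_module (V\<lparr>carrier := K\<rparr>) N"
  let ?c = "\<lambda>v. {u + v | u. u \<in> N}"
  have c: "N +>\<^bsub>?M\<^esub> v = ?c v" for v
    by (auto simp: a_r_coset_def r_coset_def V_def module_vec_simps)
  have Ncar: "u \<in> carrier_vec n" if "u \<in> N" for u using that N(1) by auto
  have Kcar: "v \<in> carrier_vec n" if "v \<in> K" for v using that K(1) by auto
  have mem: "?c v = ?c (0\<^sub>v n) \<longleftrightarrow> v \<in> N" if v: "v \<in> carrier_vec n" for v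
  proof
    assume eq: "?c v = ?c (0\<^sub>v n)"
    have "0\<^sub>v n + v \<in> ?c v" using N(2) by blast
    then obtain u where "0\<^sub>v n + v = u + 0\<^sub>v n" "u \<in> N" unfolding eq by blast
    then show "v \<in> N" using v Ncar by simp
  next
    assume vN: "v \<in> N"
    show "?c v = ?c (0\<^sub>v n)"
    proof (intro subset_antisym subsetI)
      fix x assume "x \<in> ?c v"
      then obtain u where u: "u \<in> N" "x = u + v" by auto
      then have "x = (u + v) + 0\<^sub>v n" using v Ncar[OF u(1)] by simp
      then show "x \<in> ?c (0\<^sub>v n)" using N(3)[OF u(1) vN] by blast
    next
      fix x assume "x \<in> ?c (0\<^sub>v n)"
      then obtain u where u: "u \<in> N" "x = u + 0\<^sub>v n" by auto
      then have "x = (u + (- 1) \<cdot>\<^sub>v v) + v" using v Ncar[OF u(1)] by (intro eq_vecI) auto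
      then show "x \<in> ?c v" using N(3)[OF u(1) N(4)[OF vN]] by blast
    qed
  qed
  have car: "carrier ?Q = ?c ` K"
    by (auto simp: quotient_module_def A_RCOSETS_def' c)
  have addQ: "?c v \<oplus>\<^bsub>?Q\<^esub> ?c w = ?c (v + w)" if "v \<in> K" "w \<in> K" for v w
  proof -
    have "?c v \<oplus>\<^bsub>?Q\<^esub> ?c w = {x + y | x y. x \<in> ?c v \<and> y \<in> ?c w}"
      by (auto simp: quotient_module_def set_add_def' V_def module_vec_simps)
    also have "\<dots> = ?c (v + w)"
    proof (intro subset_antisym subsetI)
      fix z assume "z \<in> {x + y | x y. x \<in> ?c v \<and> y \<in> ?c w}"
      then obtain a b where ab: "a \<in> N" "b \<in> N" "z = (a + v) + (b + w)" by auto
      then have "z = (a + b) + (v + w)"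
        using Ncar[of a] Ncar[of b] Kcar[OF that(1)] Kcar[OF that(2)] by (intro eq_vecI) auto
      then show "z \<in> ?c (v + w)" using N(3)[OF ab(1,2)] by blast
    next
      fix z assume "z \<in> ?c (v + w)"
      then obtain a where a: "a \<in> N" "z = a + (v + w)" by auto
      then have "z = (a + v) + (0\<^sub>v n + w)"
        using Ncar[of a] Kcar[OF that(1)] Kcar[OF that(2)] by (intro eq_vecI) auto
      then show "z \<in> {x + y | x y. x \<in> ?c v \<and> y \<in> ?c w}" using a(1) N(2) by blast
    qed
    finally show ?thesis .
  qed
  have smultQ: "s \<odot>\<^bsub>?Q\<^esub> ?c v = ?c (s \<cdot>\<^sub>v v)" if v: "v \<in> K" for s v
  proof -
    have "s \<odot>\<^bsub>?Q\<^esub> ?c v = (\<Union>x\<in>?c v. ?c (s \<cdot>\<^sub>v x))"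
      by (simp add: quotient_module_def c) (simp add: V_def module_vec_simps)
    also have "\<dots> = ?c (s \<cdot>\<^sub>v v)"
    proof (intro subset_antisym subsetI)
      fix z assume "z \<in> (\<Union>x\<in>?c v. ?c (s \<cdot>\<^sub>v x))"
      then obtain a b where ab: "a \<in> N" "b \<in> N" "z = b + s \<cdot>\<^sub>v (a + v)" by auto
      then have "z = (b + s \<cdot>\<^sub>v a) + s \<cdot>\<^sub>v v"
        using Ncar[of a] Ncar[of b] Kcar[OF v] by (intro eq_vecI) (auto simp: algebra_simps)
      then show "z \<in> ?c (s \<cdot>\<^sub>v v)" using N(3)[OF ab(2) N(4)[OF ab(1)]] by blast
    next
      fix z assume z: "z \<in> ?c (s \<cdot>\<^sub>v v)"
      have "0\<^sub>v n + v = v" using Kcar[OF v] by simp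
      then have "v \<in> ?c v" using N(2) by (metis (mono_tags, lifting) mem_Collect_eq)
      then show "z \<in> (\<Union>x\<in>?c v. ?c (s \<cdot>\<^sub>v x))" using z by blast
    qed
    finally show ?thesis .
  qed
  define \<eta> where "\<eta> v = h (?c v)" for v
  have cQ: "?c v \<in> carrier ?Q" if "v \<in> K" for v unfolding car using that by blast
  have add: "\<eta> (v + w) = \<eta> v \<oplus>\<^bsub>W\<^esub> \<eta> w" if "v \<in> K" "w \<in> K" for v w
    using module_hom_add[OF h cQ[OF that(1)] cQ[OF that(2)]] unfolding addQ[OF that]
    by (simp add: \<eta>_def restrict_scalars_def)
  have smult: "\<eta> (s \<cdot>\<^sub>v v) = coset I s \<odot>\<^bsub>W\<^esub> \<eta> v" if "v \<in> K" for s v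
    using module_hom_smult[OF h _ cQ[OF that], of s] unfolding smultQ[OF that]
    by (simp add: \<eta>_def restrict_scalars_def)
  have onto: "\<eta> ` K = carrier W"
  proof -
    have "\<eta> ` K = h ` (?c ` K)" by (auto simp: \<eta>_def)
    then show ?thesis using bij_betw_imp_surj_on[OF bij] unfolding car by simp
  qed
  have "\<eta> (0\<^sub>v n) = \<zero>\<^bsub>W\<^esub>"
  proof -
    have "(0 :: 'a) \<cdot>\<^sub>v 0\<^sub>v n = 0\<^sub>v n" by (intro eq_vecI) auto
    then have "\<eta> (0\<^sub>v n) = coset I 0 \<odot>\<^bsub>W\<^esub> \<eta> (0\<^sub>v n)" using smult[OF K(2), of 0] by simp
    also have "\<dots> = \<zero>\<^bsub>W\<^esub>"
      using W.smult_l_null[of "\<eta> (0\<^sub>v n)"] onto K(2) unfolding zero_Quot[OF I] by blast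
    finally show ?thesis .
  qed
  then have ker: "\<eta> v = \<zero>\<^bsub>W\<^esub> \<longleftrightarrow> v \<in> N" if "v \<in> K" for v
    using inj_on_eq_iff[OF bij_betw_imp_inj_on[OF bij] cQ[OF that] cQ[OF K(2)]] mem[OF Kcar[OF that]]
    unfolding \<eta>_def by simp
  show ?thesis unfolding linear_cover_def using add smult onto ker by blast
qed

text \<open>By the comparison of resolutions, the canonical module can be computed from any resolution.
  If that resolution ends in degree \<open>i + 1 = 2 - d\<close>, the relevant \<open>Ext\<close> module is the cokernel
  of its last dual differential.\<close>

lemma canonical_module_linear_cover:
  fixes I :: "'k::field poly poly set" and \<omega> :: "('k poly poly set, 'w) module"
  assumes I: "ideal I class_ring" and \<omega>: "canonical_module I \<omega>"
    and d: "krull_dim (class_ring Quot I) = enat d" "2 - d = Suc i"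
    and R': "quot_resolution I g' r' A'" and last: "r' (Suc (Suc i)) = 0"
  shows "\<exists>\<eta>. linear_cover I \<omega> (carrier_vec (r' (Suc i))) (mat_image ((A' i)\<^sup>T)) \<eta>"
proof -
  let ?n = "Suc i"
  obtain d' r A h where W: "Module.module (class_ring Quot I) \<omega>"
    and d': "krull_dim (class_ring Quot I) = enat d'"
    and R0: "free_resolution (restrict_scalars (coset I) (regular_module (class_ring Quot I))) r A"
    and h: "h \<in> module_hom class_ring (ext_of_resolution r A (2 - d')) (restrict_scalars (coset I) \<omega>)"
    and bij: "bij_betw h (carrier (ext_of_resolution r A (2 - d'))) (carrier \<omega>)"
    using \<omega> unfolding canonical_module_def by blast
  have n: "2 - d' = ?n" using d' d by simp
  obtain g where R: "quot_resolution I g r A" using free_resolution_imp_quot_resolution[OF I R0] .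
  note cA = quot_resolution_carrier[OF R] and cA' = quot_resolution_carrier[OF R']
  have t: "(A n)\<^sup>T \<in> carrier_mat (r (Suc n)) (r n)" "(A' n)\<^sup>T \<in> carrier_mat (r' (Suc n)) (r' n)" for n
    using cA[of n] cA'[of n] by auto
  let ?K = "mat_kernel ((A ?n)\<^sup>T)" and ?N = "mat_image ((A i)\<^sup>T)"
  have ext: "ext_of_resolution r A (2 - d')
      = quotient_module ((module_vec TYPE('k poly poly) (r ?n))\<lparr>carrier := ?K\<rparr>) ?N"
    by (simp add: n ext_of_resolution_def)
  have "\<exists>\<eta>. linear_cover I \<omega> ?K ?N \<eta>"
    by (rule linear_cover_quotient_module[OF I W mat_kernel_carrier[OF t(1)] mat_kernel_zero_vec[OF t(1)]
          mat_kernel_add[OF t(1)] mat_kernel_smult_vec[OF t(1)] mat_image_carrier[OF t(1)]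
          mat_image_zero[OF t(1)] mat_image_add[OF t(1)] mat_image_smult[OF t(1)]
          h[unfolded ext] bij[unfolded ext]])
  then obtain \<eta> where \<eta>: "linear_cover I \<omega> ?K ?N \<eta>" by auto
  obtain F where F: "quot_chain_map I g r A g' r' A' F" using resolution_chain_map[OF I R R'] .
  obtain G where G: "quot_chain_map I g' r' A' g r A G" using resolution_chain_map[OF I R' R] .
  have K': "mat_kernel ((A' ?n)\<^sup>T) = carrier_vec (r' ?n)"
    by (rule mat_kernel_no_rows) (use cA'[of ?n] last in simp)
  have tF: "(F ?n)\<^sup>T \<in> carrier_mat (r ?n) (r' ?n)" and tG: "(G ?n)\<^sup>T \<in> carrier_mat (r' ?n) (r ?n)"
    using quot_chain_mapD(1)[OF F, of ?n] quot_chain_mapD(1)[OF G, of ?n] by auto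
  note trF = transpose_chain_map_kernel_image[OF R R' F]
    and trG = transpose_chain_map_kernel_image(2)[OF R' R G]
  have FK: "(F ?n)\<^sup>T *\<^sub>v v \<in> ?K" if "v \<in> carrier_vec (r' ?n)" for v
    using trF(1)[of v ?n] that unfolding K' by simp
  have FN: "(F ?n)\<^sup>T *\<^sub>v v \<in> ?N" if "v \<in> mat_image ((A' i)\<^sup>T)" for v
    using trF(2)[OF that] .
  have GK: "(G ?n)\<^sup>T *\<^sub>v u \<in> carrier_vec (r' ?n)" if "u \<in> ?K" for u
    using mult_mat_vec_carrier[OF tG] mat_kernel_carrier[OF t(1)] that by blast
  have GN: "(G ?n)\<^sup>T *\<^sub>v u \<in> mat_image ((A' i)\<^sup>T)" if "u \<in> ?N" for u
    using trG[OF that] .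
  have FG: "u - (F ?n)\<^sup>T *\<^sub>v ((G ?n)\<^sup>T *\<^sub>v u) \<in> ?N" if "u \<in> ?K" for u
    by (rule resolution_homotopy_identity[OF I R R' F G that])
  have GF: "v - (G ?n)\<^sup>T *\<^sub>v ((F ?n)\<^sup>T *\<^sub>v v) \<in> mat_image ((A' i)\<^sup>T)" if "v \<in> carrier_vec (r' ?n)" for v
    by (rule resolution_homotopy_identity[OF I R' R G F]) (use that K' in simp)
  define \<theta> where "\<theta> v = \<eta> ((F ?n)\<^sup>T *\<^sub>v v)" for v
  have "linear_cover I \<omega> (carrier_vec (r' ?n)) (mat_image ((A' i)\<^sup>T)) \<theta>"
    unfolding linear_cover_def
  proof (intro conjI ballI allI)
    fix v w :: "'k poly poly vec" and s
    assume v: "v \<in> carrier_vec (r' ?n)"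
    show "\<theta> (s \<cdot>\<^sub>v v) = coset I s \<odot>\<^bsub>\<omega>\<^esub> \<theta> v"
      using linear_cover_smult[OF \<eta> FK[OF v]] mult_mat_vec_smult[OF tF v] by (simp add: \<theta>_def)
    show "\<theta> v = \<zero>\<^bsub>\<omega>\<^esub> \<longleftrightarrow> v \<in> mat_image ((A' i)\<^sup>T)"
    proof
      assume "\<theta> v = \<zero>\<^bsub>\<omega>\<^esub>"
      then have "(G ?n)\<^sup>T *\<^sub>v ((F ?n)\<^sup>T *\<^sub>v v) \<in> mat_image ((A' i)\<^sup>T)"
        using GN linear_cover_kernel[OF \<eta> FK[OF v]] by (simp add: \<theta>_def)
      from mat_image_add[OF t(2) GF[OF v] this]
      show "v \<in> mat_image ((A' i)\<^sup>T)"
        unfolding vec_diff_add_cancel[OF v GK[OF FK[OF v]]] .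
    next
      assume "v \<in> mat_image ((A' i)\<^sup>T)"
      then show "\<theta> v = \<zero>\<^bsub>\<omega>\<^esub>" using FN linear_cover_kernel[OF \<eta> FK[OF v]] by (simp add: \<theta>_def)
    qed
    assume w: "w \<in> carrier_vec (r' ?n)"
    show "\<theta> (v + w) = \<theta> v \<oplus>\<^bsub>\<omega>\<^esub> \<theta> w"
      using linear_cover_add[OF \<eta> FK[OF v] FK[OF w]] mult_add_distrib_mat_vec[OF tF v w]
      by (simp add: \<theta>_def)
  next
    show "\<theta> ` carrier_vec (r' ?n) = carrier \<omega>"
    proof (intro subset_antisym subsetI)
      show "x \<in> carrier \<omega>" if "x \<in> \<theta> ` carrier_vec (r' ?n)" for x
        using that FK linear_cover_onto[OF \<eta>] by (auto simp: \<theta>_def)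
      fix x assume "x \<in> carrier \<omega>"
      then obtain u where u: "u \<in> ?K" "x = \<eta> u" using linear_cover_onto[OF \<eta>] by auto
      let ?u' = "(F ?n)\<^sup>T *\<^sub>v ((G ?n)\<^sup>T *\<^sub>v u)"
      have uc: "u \<in> carrier_vec (r ?n)" using u(1) mat_kernel_carrier[OF t(1)] by blast
      have u'K: "?u' \<in> ?K" using FK[OF GK[OF u(1)]] .
      have u'c: "?u' \<in> carrier_vec (r ?n)" using u'K mat_kernel_carrier[OF t(1)] by blast
      have diffK: "u - ?u' \<in> ?K"
        using u(1) u'K mult_minus_distrib_mat_vec[OF t(1) uc u'c] uc u'c
        unfolding mat_kernel_iff[OF t(1)] by simp
      interpret W: Module.module "class_ring Quot I" \<omega> by (rule W)
      have "x = \<eta> (u - ?u' + ?u')" using u(2) vec_diff_add_cancel[OF uc u'c] by simp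
      also have "\<dots> = \<eta> (u - ?u') \<oplus>\<^bsub>\<omega>\<^esub> \<eta> ?u'" by (rule linear_cover_add[OF \<eta> diffK u'K])
      also have "\<eta> (u - ?u') = \<zero>\<^bsub>\<omega>\<^esub>" using linear_cover_kernel[OF \<eta> diffK] FG[OF u(1)] by simp
      also have "\<zero>\<^bsub>\<omega>\<^esub> \<oplus>\<^bsub>\<omega>\<^esub> \<eta> ?u' = \<theta> ((G ?n)\<^sup>T *\<^sub>v u)"
      proof -
        have "\<eta> ?u' \<in> carrier \<omega>" using linear_cover_onto[OF \<eta>] u'K by blast
        then show ?thesis unfolding \<theta>_def by (rule W.M.l_zero)
      qed
      finally show "x \<in> \<theta> ` carrier_vec (r' ?n)" using GK[OF u(1)] by blast
    qed
  qed
  then show ?thesis by auto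
qed

lemma trace_ideal_preimage:
  fixes I :: "'a::comm_ring_1 set" and W :: "('a set, 'w) module"
  assumes I: "ideal I class_ring"
  shows "ideal {s. coset I s \<in> trace_ideal (class_ring Quot I) W} class_ring"
    and "trace_ideal (class_ring Quot I) W = coset I ` {s. coset I s \<in> trace_ideal (class_ring Quot I) W}"
proof -
  have "ideal (trace_ideal (class_ring Quot I) W) (class_ring Quot I)"
    unfolding trace_ideal_def
    by (rule ring.genideal_ideal[OF cring.axioms(1)[OF cring_Quot[OF I]]])
      (auto simp: module_hom_def regular_module_def)
  from ideal_coset_preimage(1,3)[OF I this]
  show "ideal {s. coset I s \<in> trace_ideal (class_ring Quot I) W} class_ring"
    "trace_ideal (class_ring Quot I) W = coset I ` {s. coset I s \<in> trace_ideal (class_ring Quot I) W}" .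
qed

text \<open>A vector \<open>w\<close> with \<open>Y w\<close> in \<open>I S\<^sup>p\<close> defines the functional \<open>v \<mapsto> w \<bullet> v + I\<close> on the cokernel of
  the transpose of \<open>Y\<close>; its values on the basis vectors are the entries of \<open>w\<close>.\<close>

lemma coset_mem_trace_ideal:
  fixes I :: "'a::comm_ring_1 set" and W :: "('a set, 'w) module"
  assumes I: "ideal I class_ring"
    and \<eta>: "linear_cover I W (carrier_vec q) (mat_image (Y\<^sup>T)) \<eta>"
    and Y: "Y \<in> carrier_mat p q" and w: "w \<in> carrier_vec q"
    and Yw: "\<And>i. i < p \<Longrightarrow> (Y *\<^sub>v w) $ i \<in> I" and k: "k < q"
    and W: "Module.module (class_ring Quot I) W"
  shows "coset I (w $ k) \<in> trace_ideal (class_ring Quot I) W"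
proof -
  interpret W: Module.module "class_ring Quot I" W by (rule W)
  let ?R = "class_ring Quot I"
  note onto = linear_cover_onto[OF \<eta>]
  have tY: "Y\<^sup>T \<in> carrier_mat q p" using Y by simp
  have well: "coset I (w \<bullet> v) = coset I (w \<bullet> v')"
    if v: "v \<in> carrier_vec q" "v' \<in> carrier_vec q" and eq: "\<eta> v = \<eta> v'" for v v'
  proof -
    have m: "(- 1) \<cdot>\<^sub>v v' \<in> carrier_vec q" using v(2) by simp
    have e0: "v' + (- 1) \<cdot>\<^sub>v v' = 0\<^sub>v q" "v + (- 1) \<cdot>\<^sub>v v' = v - v'" using v by (auto intro!: eq_vecI)
    have "\<eta> (v - v') = \<eta> v' \<oplus>\<^bsub>W\<^esub> \<eta> ((- 1) \<cdot>\<^sub>v v')"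
      using linear_cover_add[OF \<eta> v(1) m] eq e0 by simp
    also have "\<dots> = \<eta> (0\<^sub>v q)" using linear_cover_add[OF \<eta> v(2) m] e0 by simp
    also have "\<dots> = \<zero>\<^bsub>W\<^esub>"
      using linear_cover_kernel[OF \<eta>, of "0\<^sub>v q"] mat_image_zero[OF tY] by simp
    finally have "v - v' \<in> mat_image (Y\<^sup>T)"
      using linear_cover_kernel[OF \<eta>, of "v - v'"] v by simp
    then obtain z where z: "z \<in> carrier_vec p" "v - v' = Y\<^sup>T *\<^sub>v z" unfolding mat_image_iff[OF tY] by auto
    have "w \<bullet> v - w \<bullet> v' = w \<bullet> (Y\<^sup>T *\<^sub>v z)"
      using scalar_prod_minus_distrib[OF w v] z(2) by simp
    also have "\<dots> = (Y *\<^sub>v w) \<bullet> z"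
      using transpose_vec_mult_scalar[OF tY z(1) w] by simp
    also have "\<dots> = (\<Sum>i<p. (Y *\<^sub>v w) $ i * z $ i)"
      using z(1) by (simp add: scalar_prod_def atLeast0LessThan)
    also have "\<dots> \<in> I" by (intro class_ideal_sum[OF I] class_ideal_mult_right[OF I] Yw) simp
    finally show ?thesis using coset_eq_iff[OF I] by simp
  qed
  define pre where "pre x = (SOME v. v \<in> carrier_vec q \<and> \<eta> v = x)" for x
  have pre: "pre x \<in> carrier_vec q \<and> \<eta> (pre x) = x" if "x \<in> carrier W" for x
    unfolding pre_def by (rule someI_ex) (use that in \<open>auto simp: onto[symmetric]\<close>)
  define \<phi> where "\<phi> x = coset I (w \<bullet> pre x)" for x
  have \<phi>\<eta>: "\<phi> (\<eta> v) = coset I (w \<bullet> v)" if "v \<in> carrier_vec q" for v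
  proof -
    have "\<eta> v \<in> carrier W" using onto that by blast
    then show ?thesis unfolding \<phi>_def using pre[of "\<eta> v"] well[OF _ that] by blast
  qed
  have "\<phi> \<in> module_hom ?R W (regular_module ?R)"
    unfolding module_hom_def regular_module_def
  proof (clarsimp, intro conjI allI impI)
    show "\<phi> \<in> carrier W \<rightarrow> carrier ?R" by (auto simp: \<phi>_def carrier_Quot[OF I])
  next
    fix x y assume xy: "x \<in> carrier W \<and> y \<in> carrier W"
    then obtain v v' where v: "v \<in> carrier_vec q" "v' \<in> carrier_vec q" "x = \<eta> v" "y = \<eta> v'"
      unfolding onto[symmetric] by auto
    then have "\<phi> (x \<oplus>\<^bsub>W\<^esub> y) = coset I (w \<bullet> (v + v'))"
      using \<phi>\<eta>[of "v + v'"] linear_cover_add[OF \<eta> v(1,2)] by simp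
    then show "\<phi> (x \<oplus>\<^bsub>W\<^esub> y) = \<phi> x \<oplus>\<^bsub>?R\<^esub> \<phi> y"
      using v \<phi>\<eta> scalar_prod_add_distrib[OF w v(1,2)] by (simp add: add_Quot[OF I])
  next
    fix s x assume sx: "s \<in> carrier ?R \<and> x \<in> carrier W"
    then obtain t v where v: "s = coset I t" "v \<in> carrier_vec q" "x = \<eta> v"
      unfolding onto[symmetric] carrier_Quot[OF I] by auto
    then have "\<phi> (s \<odot>\<^bsub>W\<^esub> x) = coset I (w \<bullet> (t \<cdot>\<^sub>v v))"
      using \<phi>\<eta>[of "t \<cdot>\<^sub>v v"] linear_cover_smult[OF \<eta> v(2)] by simp
    then show "\<phi> (s \<odot>\<^bsub>W\<^esub> x) = s \<otimes>\<^bsub>?R\<^esub> \<phi> x"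
      using v \<phi>\<eta> w by (simp add: mult_Quot[OF I])
  qed
  moreover have "\<eta> (unit_vec q k) \<in> carrier W" using onto by auto
  moreover have "\<phi> (\<eta> (unit_vec q k)) = coset I (w $ k)" using \<phi>\<eta>[of "unit_vec q k"] k w by simp
  ultimately have mem: "coset I (w $ k) \<in> (\<Union>\<phi>\<in>module_hom ?R W (regular_module ?R). \<phi> ` carrier W)"
    by (metis UN_I imageI)
  have "(\<Union>\<phi>\<in>module_hom ?R W (regular_module ?R). \<phi> ` carrier W) \<subseteq> carrier ?R"
    by (auto simp: module_hom_def regular_module_def)
  from ring.genideal_self[OF cring.axioms(1)[OF cring_Quot[OF I]] this]
  show ?thesis unfolding trace_ideal_def using mem by blast
qed

text \<open>Conversely, every homomorphism \<open>W \<rightarrow> S/I\<close> pulls back along \<open>\<eta>\<close> to \<open>v \<mapsto> w \<bullet> v + I\<close> for some \<open>w\<close>, and it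
  kills the image of the transpose of \<open>Y\<close> precisely when \<open>Y w \<in> I S\<^sup>p\<close>.\<close>

lemma trace_ideal_subset:
  fixes I :: "'a::comm_ring_1 set" and W :: "('a set, 'w) module"
  assumes I: "ideal I class_ring"
    and \<eta>: "linear_cover I W (carrier_vec q) (mat_image (Y\<^sup>T)) \<eta>"
    and Y: "Y \<in> carrier_mat p q" and W: "Module.module (class_ring Quot I) W"
    and J: "ideal J class_ring"
    and entries: "\<And>w k. w \<in> carrier_vec q \<Longrightarrow> (\<And>i. i < p \<Longrightarrow> (Y *\<^sub>v w) $ i \<in> I) \<Longrightarrow> k < q \<Longrightarrow> w $ k \<in> J"
  shows "trace_ideal (class_ring Quot I) W \<subseteq> coset I ` J"
proof -
  interpret W: Module.module "class_ring Quot I" W by (rule W)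
  let ?R = "class_ring Quot I"
  note onto = linear_cover_onto[OF \<eta>]
  have tY: "Y\<^sup>T \<in> carrier_mat q p" using Y by simp
  have "\<phi> x \<in> coset I ` J" if \<phi>: "\<phi> \<in> module_hom ?R W (regular_module ?R)" and x: "x \<in> carrier W" for \<phi> x
  proof -
    have \<phi>car: "\<phi> y \<in> range (coset I)" if "y \<in> carrier W" for y
      using \<phi> that by (auto simp: module_hom_def regular_module_def carrier_Quot[OF I])
    have \<phi>add: "\<phi> (y \<oplus>\<^bsub>W\<^esub> z) = \<phi> y \<oplus>\<^bsub>?R\<^esub> \<phi> z" if "y \<in> carrier W" "z \<in> carrier W" for y z
      using \<phi> that by (auto simp: module_hom_def regular_module_def)
    have \<phi>smult: "\<phi> (s \<odot>\<^bsub>W\<^esub> y) = s \<otimes>\<^bsub>?R\<^esub> \<phi> y" if "s \<in> carrier ?R" "y \<in> carrier W" for s y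
      using \<phi> that by (auto simp: module_hom_def regular_module_def)
    have \<eta>car: "\<eta> v \<in> carrier W" if "v \<in> carrier_vec q" for v using onto that by blast
    have "\<exists>w\<in>carrier_vec q. \<forall>v\<in>carrier_vec q. \<phi> (\<eta> v) = coset I (w \<bullet> v)"
    proof (rule coset_functional[OF I])
      show "\<phi> (\<eta> v) \<in> range (coset I)" if "v \<in> carrier_vec q" for v using \<phi>car[OF \<eta>car[OF that]] .
      show "\<phi> (\<eta> (v + w)) = \<phi> (\<eta> v) \<oplus>\<^bsub>?R\<^esub> \<phi> (\<eta> w)" if "v \<in> carrier_vec q" "w \<in> carrier_vec q" for v w
        using linear_cover_add[OF \<eta> that] \<phi>add[OF \<eta>car \<eta>car] that by simp
      show "\<phi> (\<eta> (s \<cdot>\<^sub>v v)) = coset I s \<otimes>\<^bsub>?R\<^esub> \<phi> (\<eta> v)" if "v \<in> carrier_vec q" for s v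
        using linear_cover_smult[OF \<eta> that] \<phi>smult[OF _ \<eta>car[OF that], of "coset I s"]
        by (simp add: carrier_Quot[OF I])
    qed
    then obtain w where w: "w \<in> carrier_vec q" "\<And>v. v \<in> carrier_vec q \<Longrightarrow> \<phi> (\<eta> v) = coset I (w \<bullet> v)"
      by auto
    have "(Y *\<^sub>v w) $ i \<in> I" if i: "i < p" for i
    proof -
      let ?v = "Y\<^sup>T *\<^sub>v unit_vec p i"
      have v: "?v \<in> carrier_vec q" using mult_mat_vec_carrier[OF tY] by simp
      have 0: "0\<^sub>v q \<in> mat_image (Y\<^sup>T)" by (rule mat_image_zero[OF tY])
      have "\<eta> ?v = \<zero>\<^bsub>W\<^esub>" "\<eta> (0\<^sub>v q) = \<zero>\<^bsub>W\<^esub>"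
        using linear_cover_kernel[OF \<eta>] mat_image_mult[OF tY, of "unit_vec p i"] v 0 by auto
      then have "coset I (w \<bullet> ?v) = coset I (w \<bullet> 0\<^sub>v q)" using w(2)[OF v] w(2)[of "0\<^sub>v q"] by simp
      then have "w \<bullet> ?v \<in> I" using coset_eq_iff[OF I] w(1) by simp
      also have "w \<bullet> ?v = (Y *\<^sub>v w) \<bullet> unit_vec p i"
        using transpose_vec_mult_scalar[OF tY unit_vec_carrier w(1)] by simp
      finally show ?thesis using i by simp
    qed
    then have wJ: "w $ k \<in> J" if "k < q" for k using entries[OF w(1) _ that] by blast
    obtain v where v: "v \<in> carrier_vec q" "x = \<eta> v" using x onto by auto
    have "w \<bullet> v = (\<Sum>k<q. w $ k * v $ k)" using v(1) by (simp add: scalar_prod_def atLeast0LessThan)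
    also have "\<dots> \<in> J" by (intro class_ideal_sum[OF J] class_ideal_mult_right[OF J] wJ) simp
    finally show ?thesis using w(2)[OF v(1)] v(2) by simp
  qed
  then show ?thesis unfolding trace_ideal_def
    by (intro ring.genideal_minimal[OF cring.axioms(1)[OF cring_Quot[OF I]] ideal_coset_image[OF I J]]) blast
qed

section \<open>Ideals of minors\<close>

lemma minors_ideal_ideal: "ideal (minors_ideal X j) class_ring"
  by (simp add: minors_ideal_def ideal_Idl class_ideal_UNIV)

lemma enumeration_by_pick:
  fixes \<rho> :: "nat \<Rightarrow> nat"
  assumes inj: "inj_on \<rho> {..<k}"
  obtains p where "p permutes {0..<k}" "\<And>i. i < k \<Longrightarrow> \<rho> i = pick (\<rho> ` {..<k}) (p i)"
proof -
  let ?A = "\<rho> ` {..<k}"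
  define p where "p i = (if i < k then card {a \<in> ?A. a < \<rho> i} else i)" for i
  have pick: "\<rho> i = pick ?A (p i)" if "i < k" for i
    using pick_card_in_set[of "\<rho> i" ?A] that by (simp add: p_def)
  have cardA: "card ?A = k" using card_image[OF inj] by simp
  have lt: "p i < k" if "i < k" for i
  proof -
    have "{a \<in> ?A. a < \<rho> i} \<subset> ?A" using that by blast
    then show ?thesis using psubset_card_mono[of ?A] cardA that by (simp add: p_def)
  qed
  have "inj_on p {0..<k}"
    using pick inj by (intro inj_onI) (metis atLeastLessThan_iff inj_onD lessThan_iff)
  moreover have "p ` {0..<k} \<subseteq> {0..<k}" using lt by auto
  ultimately have "bij_betw p {0..<k} {0..<k}"
    using endo_inj_surj[of "{0..<k}" p] by (simp add: bij_betw_def)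
  then have "p permutes {0..<k}" by (rule bij_imp_permutes) (simp add: p_def)
  then show thesis using pick that by blast
qed

lemma det_permute_columns:
  assumes A: "(A :: 'a::comm_ring_1 mat) \<in> carrier_mat n n" and p: "p permutes {0..<n}"
  shows "det (mat n n (\<lambda>(i, j). A $$ (i, p j))) = signof p * det A"
proof -
  have "det (mat n n (\<lambda>(i, j). A $$ (i, p j))) = det ((mat n n (\<lambda>(i, j). A $$ (i, p j)))\<^sup>T)"
    by (rule det_transpose[symmetric]) auto
  also have "(mat n n (\<lambda>(i, j). A $$ (i, p j)))\<^sup>T = mat n n (\<lambda>(i, j). A\<^sup>T $$ (p i, j))"
    using A permutes_in_image[OF p] by (intro eq_matI) auto
  also have "det \<dots> = signof p * det (A\<^sup>T)" by (rule det_permute_rows) (use A p in auto)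
  finally show ?thesis using det_transpose[OF A] by simp
qed

text \<open>Up to sign, a minor with an arbitrary enumeration of rows and columns is \<open>0\<close> or the
  determinant of a submatrix.\<close>

lemma indexed_minor_mem:
  fixes X :: "'a::comm_ring_1 mat"
  assumes X: "X \<in> carrier_mat nr nc"
    and \<rho>: "\<And>i. i < k \<Longrightarrow> \<rho> i < nr" and \<kappa>: "\<And>j. j < k \<Longrightarrow> \<kappa> j < nc"
  shows "det (mat k k (\<lambda>(i, j). X $$ (\<rho> i, \<kappa> j))) \<in> minors_ideal X (int k)" (is "det ?Z \<in> _")
proof -
  have Z: "?Z \<in> carrier_mat k k" by simp
  note zero = class_ideal_zero[OF minors_ideal_ideal]
  consider "k = 0" | "\<not> inj_on \<rho> {..<k}" | "\<not> inj_on \<kappa> {..<k}"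
    | "k > 0" "inj_on \<rho> {..<k}" "inj_on \<kappa> {..<k}" by blast
  then show ?thesis
  proof cases
    case 1
    then show ?thesis by (simp add: minors_ideal_def)
  next
    case 2
    then obtain i j where "i < k" "j < k" "i \<noteq> j" "\<rho> i = \<rho> j" by (auto simp: inj_on_def)
    then have "det ?Z = 0" by (intro det_identical_rows[OF Z, of i j]) auto
    then show ?thesis using zero by simp
  next
    case 3
    then obtain i j where "i < k" "j < k" "i \<noteq> j" "\<kappa> i = \<kappa> j" by (auto simp: inj_on_def)
    then have "det ?Z = 0" by (intro det_identical_columns[OF Z, of i j]) auto
    then show ?thesis using zero by simp
  next
    case 4
    let ?A = "\<rho> ` {..<k}" and ?B = "\<kappa> ` {..<k}"
    obtain p where p: "p permutes {0..<k}" "\<And>i. i < k \<Longrightarrow> \<rho> i = pick ?A (p i)"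
      using enumeration_by_pick[OF 4(2)] by metis
    obtain q where q: "q permutes {0..<k}" "\<And>i. i < k \<Longrightarrow> \<kappa> i = pick ?B (q i)"
      using enumeration_by_pick[OF 4(3)] by metis
    have cards: "card ?A = k" "card ?B = k" using card_image[OF 4(2)] card_image[OF 4(3)] by auto
    have rows: "{i. i < nr \<and> i \<in> ?A} = ?A" "{j. j < nc \<and> j \<in> ?B} = ?B" using \<rho> \<kappa> by auto
    let ?M = "submatrix X ?A ?B"
    have M: "?M \<in> carrier_mat k k" using X cards rows by (auto simp: dim_submatrix)
    have Mij: "?M $$ (i, j) = X $$ (pick ?A i, pick ?B j)" if "i < k" "j < k" for i j
      using submatrix_index[of i X ?A j ?B] that X cards rows by simp
    have Zij: "X $$ (\<rho> i, \<kappa> j) = ?M $$ (p i, q j)" if ij: "i < k" "j < k" for i j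
    proof -
      have "p i < k" "q j < k"
        using permutes_in_image[OF p(1), of i] permutes_in_image[OF q(1), of j] ij by auto
      from Mij[OF this] show ?thesis unfolding p(2)[OF ij(1), symmetric] q(2)[OF ij(2), symmetric] by simp
    qed
    let ?M' = "mat k k (\<lambda>(i, j). ?M $$ (i, q j))"
    have "?Z = mat k k (\<lambda>(i, j). ?M' $$ (p i, j))"
      using permutes_in_image[OF p(1)] by (intro eq_matI) (auto simp: Zij)
    then have "det ?Z = signof p * det ?M'" using det_permute_rows[OF _ p(1), of ?M'] by simp
    also have "det ?M' = signof q * det ?M" by (rule det_permute_columns[OF M q(1)])
    finally have det: "det ?Z = signof p * (signof q * det ?M)" .
    have "det ?M \<in> minors_ideal X (int k)"
    proof -
      have AB: "?A \<subseteq> {..<dim_row X}" "?B \<subseteq> {..<dim_col X}" using X \<rho> \<kappa> by auto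
      then have "det ?M \<in> {det (submatrix X A B) | A B. A \<subseteq> {..<dim_row X} \<and> B \<subseteq> {..<dim_col X} \<and>
          int (card A) = int k \<and> int (card B) = int k}"
        by (intro CollectI exI[of _ ?A] exI[of _ ?B] conjI refl AB) (simp_all only: cards)
      from subsetD[OF Idl_superset this] show ?thesis using 4(1) by (simp add: minors_ideal_def)
    qed
    then show ?thesis unfolding det by (intro class_ideal_mult[OF minors_ideal_ideal])
  qed
qed

lemma minors_ideal_subset:
  fixes X :: "'a::comm_ring_1 mat"
  assumes X: "X \<in> carrier_mat nr nc" and J: "ideal J class_ring"
    and mem: "\<And>A B. A \<subseteq> {..<nr} \<Longrightarrow> B \<subseteq> {..<nc} \<Longrightarrow> card A = k \<Longrightarrow> card B = k \<Longrightarrow>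
      det (mat k k (\<lambda>(i, j). X $$ (pick A i, pick B j))) \<in> J"
  shows "minors_ideal X (int k) \<subseteq> J"
proof (cases "k = 0")
  case True
  then have "1 \<in> J" using mem[of "{}" "{}"] by simp
  then show ?thesis using class_ideal_one_imp_UNIV[OF J] by simp
next
  case False
  have "det (submatrix X A B) \<in> J"
    if "A \<subseteq> {..<nr}" "B \<subseteq> {..<nc}" "card A = k" "card B = k" for A B
  proof -
    have "{i. i < nr \<and> i \<in> A} = A" "{i. i < nc \<and> i \<in> B} = B" using that by auto
    then show ?thesis using mem[OF that] X that by (simp add: submatrix_def)
  qed
  then have "{det (submatrix X A B) | A B. A \<subseteq> {..<dim_row X} \<and> B \<subseteq> {..<dim_col X} \<and>
      int (card A) = int k \<and> int (card B) = int k} \<subseteq> J" using X by auto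
  from Idl_least[OF J this] show ?thesis using False by (simp add: minors_ideal_def)
qed

lemma det_column_linear_combination:
  fixes C :: "'a::comm_ring_1 mat"
  assumes C: "C \<in> carrier_mat k k" and t: "t < k"
    and col: "\<And>i. i < k \<Longrightarrow> C $$ (i, t) = (\<Sum>l\<in>L. a l * b l i)"
  shows "det C = (\<Sum>l\<in>L. a l * det (mat k k (\<lambda>(i, c). if c = t then b l i else C $$ (i, c))))"
proof -
  let ?C = "\<lambda>l. mat k k (\<lambda>(i, c). if c = t then b l i else C $$ (i, c))"
  have cof: "cofactor C i t = cofactor (?C l) i t" if "i < k" for i l
  proof -
    have "mat_delete C i t = mat_delete (?C l) i t"
      using C t that by (intro eq_matI) (auto simp: mat_delete_def)
    then show ?thesis by (simp add: cofactor_def)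
  qed
  have "det C = (\<Sum>i<k. C $$ (i, t) * cofactor C i t)" by (rule laplace_expansion_column[OF C t])
  also have "\<dots> = (\<Sum>i<k. \<Sum>l\<in>L. a l * (b l i * cofactor C i t))"
    by (intro sum.cong refl) (simp add: col sum_distrib_right mult.assoc)
  also have "\<dots> = (\<Sum>l\<in>L. \<Sum>i<k. a l * (b l i * cofactor C i t))" by (rule sum.swap)
  also have "\<dots> = (\<Sum>l\<in>L. a l * det (?C l))"
  proof (intro sum.cong refl)
    fix l
    have "det (?C l) = (\<Sum>i<k. ?C l $$ (i, t) * cofactor (?C l) i t)"
      by (rule laplace_expansion_column[OF _ t]) simp
    also have "\<dots> = (\<Sum>i<k. b l i * cofactor C i t)"
      by (intro sum.cong refl) (use t cof[of _ l] in auto)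
    finally show "(\<Sum>i<k. a l * (b l i * cofactor C i t)) = a l * det (?C l)"
      by (simp add: sum_distrib_left)
  qed
  finally show ?thesis .
qed

text \<open>By multilinearity the combinations in the columns \<open>T\<close> are replaced one after the other by columns
  of \<open>X\<close>.\<close>

lemma det_combination_columns_mem:
  fixes X :: "'a::comm_ring_1 mat"
  assumes X: "X \<in> carrier_mat nr q" and \<rho>: "\<And>i. i < k \<Longrightarrow> \<rho> i < nr"
    and T: "finite T" "T \<subseteq> {..<k}"
    and C: "C \<in> carrier_mat k k"
    and colX: "\<And>i c. i < k \<Longrightarrow> c < k \<Longrightarrow> c \<notin> T \<Longrightarrow> \<kappa> c < q \<and> C $$ (i, c) = X $$ (\<rho> i, \<kappa> c)"
    and colT: "\<And>i c. i < k \<Longrightarrow> c \<in> T \<Longrightarrow> C $$ (i, c) = (\<Sum>l<q. a c l * X $$ (\<rho> i, l))"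
  shows "det C \<in> minors_ideal X (int k)"
  using T C colX colT
proof (induction T arbitrary: C \<kappa> rule: finite_induct)
  case empty
  have "C = mat k k (\<lambda>(i, j). X $$ (\<rho> i, \<kappa> j))" using empty by (intro eq_matI) auto
  moreover have "\<kappa> j < q" if "j < k" for j using empty(3)[of j j] that by simp
  ultimately show ?case using indexed_minor_mem[OF X, of k \<rho> \<kappa>] \<rho> by simp
next
  case (insert t T)
  let ?C = "\<lambda>l. mat k k (\<lambda>(i, c). if c = t then X $$ (\<rho> i, l) else C $$ (i, c))"
  have t: "t < k" using insert.prems by auto
  have "det C = (\<Sum>l<q. a t l * det (?C l))"
    by (rule det_column_linear_combination[OF insert.prems(2) t]) (use insert.prems(4) in auto)
  moreover have "det (?C l) \<in> minors_ideal X (int k)" if l: "l < q" for l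
  proof (rule insert.IH[of _ "\<kappa>(t := l)"])
    show "T \<subseteq> {..<k}" using insert.prems(1) by auto
    show "(\<kappa>(t := l)) c < q \<and> ?C l $$ (i, c) = X $$ (\<rho> i, (\<kappa>(t := l)) c)"
      if "i < k" "c < k" "c \<notin> T" for i c
      using insert.prems(3)[of i c] that l by auto
    show "?C l $$ (i, c) = (\<Sum>l<q. a c l * X $$ (\<rho> i, l))" if "i < k" "c \<in> T" for i c
    proof -
      have "c \<noteq> t" "c < k" using that insert.hyps insert.prems(1) by auto
      then show ?thesis using insert.prems(4)[of i c] that by simp
    qed
  qed simp
  ultimately show ?case
    by (auto intro!: class_ideal_sum[OF minors_ideal_ideal] class_ideal_mult[OF minors_ideal_ideal])
qed

text \<open>Call the rows in \<open>R\<close> and the columns in \<open>B\<close> bad: nothing is assumed about their entries, while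
  all other columns agree in the other rows with vectors in the image of \<open>X\<close>.
  Expanding along a bad row or column removes at least one of them and lowers the size by one;
  what remains in the end are \<open>k \<times> k\<close> determinants whose columns are combinations of columns
  of \<open>X\<close>. Once no bad rows and columns are left, the size is reduced to \<open>k\<close> by arbitrary
  expansions.\<close>

lemma det_mem_minors_ideal:
  fixes X :: "'a::comm_ring_1 mat"
  assumes X: "X \<in> carrier_mat nr q"
    and "C \<in> carrier_mat s s" and "R \<subseteq> {..<s}" and "B \<subseteq> {..<s}"
    and "\<And>i. i < s \<Longrightarrow> i \<notin> R \<Longrightarrow> \<rho> i < nr"
    and "\<And>c. c < s \<Longrightarrow> c \<notin> B \<Longrightarrow> v c \<in> carrier_vec q"
    and "\<And>i c. i < s \<Longrightarrow> c < s \<Longrightarrow> i \<notin> R \<Longrightarrow> c \<notin> B \<Longrightarrow> C $$ (i, c) = (X *\<^sub>v v c) $ \<rho> i"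
    and "k + card R + card B \<le> s"
  shows "det C \<in> minors_ideal X (int k)"
  using assms(2-)
proof (induction s arbitrary: C R B \<rho> v)
  case 0
  then show ?case by (simp add: minors_ideal_def)
next
  case (Suc s)
  note C = Suc.prems(1) and R = Suc.prems(2) and B = Suc.prems(3)
  have fin: "finite R" "finite B" using R B finite_subset by auto
  show ?case
  proof (cases "k = Suc s")
    case True
    then have "R = {}" "B = {}" using Suc.prems(7) fin by auto
    show ?thesis unfolding True
    proof (rule det_combination_columns_mem[OF X, where T = "{..<Suc s}" and \<rho> = \<rho> and a = "\<lambda>c l. v c $ l"])
      show "C $$ (i, c) = (\<Sum>l<q. v c $ l * X $$ (\<rho> i, l))" if "i < Suc s" "c \<in> {..<Suc s}" for i c
      proof -
        have vc: "v c \<in> carrier_vec q" and ri: "\<rho> i < nr"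
          using Suc.prems(4,5) that \<open>R = {}\<close> \<open>B = {}\<close> by auto
        have "C $$ (i, c) = (X *\<^sub>v v c) $ \<rho> i" using Suc.prems(6) that \<open>R = {}\<close> \<open>B = {}\<close> by auto
        also have "\<dots> = (\<Sum>l<q. v c $ l * X $$ (\<rho> i, l))"
          using X vc ri by (auto simp: scalar_prod_def atLeast0LessThan mult.commute intro!: sum.cong)
        finally show ?thesis .
      qed
    qed (use C Suc.prems(4) \<open>R = {}\<close> in auto)
  next
    case False
    let ?s = "\<lambda>i. insert_index i :: nat \<Rightarrow> nat"
    have inj: "inj_on (?s i) A" for i A by (rule insert_index_inj_on)
    have sl: "?s i j < Suc s" if "j < s" for i j using that by (auto simp: insert_index_def)
    have si: "?s i j \<noteq> i" for i j by (auto simp: insert_index_def)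
    have minor: "det (mat_delete C i c) \<in> minors_ideal X (int k)"
      if ic: "i < Suc s" "c < Suc s" and le: "k + card (R - {i}) + card (B - {c}) \<le> s" for i c
    proof (rule Suc.IH[where R = "{j. j < s \<and> ?s i j \<in> R}" and B = "{j. j < s \<and> ?s c j \<in> B}"
          and \<rho> = "\<lambda>j. \<rho> (?s i j)" and v = "\<lambda>j. v (?s c j)"])
      show "mat_delete C i c \<in> carrier_mat s s" using mat_delete_carrier[OF C] by simp
      have "card {j. j < s \<and> ?s i j \<in> R} \<le> card (R - {i})"
        by (rule card_inj_on_le[OF inj[of i]]) (use si fin in auto)
      moreover have "card {j. j < s \<and> ?s c j \<in> B} \<le> card (B - {c})"
        by (rule card_inj_on_le[OF inj[of c]]) (use si fin in auto)
      ultimately show "k + card {j. j < s \<and> ?s i j \<in> R} + card {j. j < s \<and> ?s c j \<in> B} \<le> s"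
        using le by linarith
      show "mat_delete C i c $$ (i', c') = (X *\<^sub>v v (?s c c')) $ \<rho> (?s i i')"
        if "i' < s" "c' < s" "i' \<notin> {j. j < s \<and> ?s i j \<in> R}" "c' \<notin> {j. j < s \<and> ?s c j \<in> B}" for i' c'
        using mat_delete_index[OF C ic that(1,2)] Suc.prems(6)[of "?s i i'" "?s c c'"] that sl by simp
    qed (use sl Suc.prems(4,5) in auto)
    have cof: "C $$ (i, c) * cofactor C i c \<in> minors_ideal X (int k)"
      if "i < Suc s" "c < Suc s" "k + card (R - {i}) + card (B - {c}) \<le> s" for i c
      unfolding cofactor_def by (intro class_ideal_mult[OF minors_ideal_ideal] minor that)
    have cR: "card (R - {i}) \<le> card R" and cB: "card (B - {i}) \<le> card B" for i
      using fin by (simp_all add: card_Diff1_le)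
    show ?thesis
    proof (cases "B = {}")
      case B0: False
      then obtain c where c: "c \<in> B" by auto
      then have cs: "c < Suc s" using B by auto
      have "k + card (R - {i}) + card (B - {c}) \<le> s" for i
        using Suc.prems(7) cR[of i] card_Suc_Diff1[OF fin(2) c] by linarith
      then show ?thesis unfolding laplace_expansion_column[OF C cs]
        by (intro class_ideal_sum[OF minors_ideal_ideal] cof) (use cs in auto)
    next
      case B0: True
      obtain i where i: "i < Suc s" "i \<in> R \<or> R = {}" using R by (cases "R = {}") auto
      have "k + card (R - {i}) + card (B - {c}) \<le> s" for c
      proof (cases "R = {}")
        case True
        then show ?thesis using Suc.prems(7) False B0 by simp
      next
        case False
        then show ?thesis using Suc.prems(7) B0 i(2) card_Suc_Diff1[OF fin(1), of i] by auto
      qed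
      then show ?thesis unfolding laplace_expansion_row[OF C i(1)]
        by (intro class_ideal_sum[OF minors_ideal_ideal] cof) (use i in auto)
    qed
  qed
qed

text \<open>Invariance of the second Fitting ideal, in the form needed here. Two finite systems \<open>u\<close>, \<open>f\<close>
  generate the same ideal, \<open>P\<close> and \<open>Q\<close> express one through the other, and \<open>X\<close> presents the
  relations of \<open>f\<close>. A determinant all but two of whose columns are relations of \<open>u\<close> is unchanged when
  it is enlarged to the system \<open>(u, f)\<close>; a change of generators then replaces \<open>u\<close> by \<open>0\<close>, so that
  the lower parts of all columns but two become relations of \<open>f\<close>.\<close>

lemma fitting_ideal_transfer:
  fixes X :: "'a::idom mat"
  assumes u: "u \<in> carrier_vec n" and f: "f \<in> carrier_vec m" and X: "X \<in> carrier_mat m q"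
    and syz: "\<And>v. v \<in> carrier_vec m \<Longrightarrow> f \<bullet> v = 0 \<Longrightarrow> v \<in> mat_image X"
    and P: "P \<in> carrier_mat m n" "\<And>v. v \<in> carrier_vec n \<Longrightarrow> f \<bullet> (P *\<^sub>v v) = u \<bullet> v"
    and Q: "Q \<in> carrier_mat n m" "\<And>v. v \<in> carrier_vec m \<Longrightarrow> u \<bullet> (Q *\<^sub>v v) = f \<bullet> v"
    and B: "B \<in> carrier_mat n n" and ij: "i < n" "j < n" "i \<noteq> j"
    and cols: "\<And>c. c < n \<Longrightarrow> c \<noteq> i \<Longrightarrow> c \<noteq> j \<Longrightarrow> u \<bullet> col B c = 0"
  shows "det B \<in> minors_ideal X (int m - 2)"
proof (cases "m < 2")
  case True
  then show ?thesis by (simp add: minors_ideal_def)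
next
  case False
  define D where "D = P * (- Q) + 1\<^sub>m m"
  have mQ: "- Q \<in> carrier_mat n m" using Q by simp
  have D: "D \<in> carrier_mat m m" unfolding D_def using P(1) mQ by simp
  have PB: "P * B \<in> carrier_mat m n" using P(1) B by simp
  define C where "C = four_block_mat B (- Q) (P * B) D"
  have C: "C \<in> carrier_mat (n + m) (n + m)" unfolding C_def by (rule four_block_carrier_mat[OF B D])
  let ?L = "four_block_mat (1\<^sub>m n) (0\<^sub>m n m) P (1\<^sub>m m)" and ?U = "four_block_mat B (- Q) (0\<^sub>m m n) (1\<^sub>m m)"
  have PQ: "P * (- Q) \<in> carrier_mat m m" by (rule mult_carrier_mat[OF P(1) mQ])
  have "?L * ?U = C"
    unfolding C_def D_def
    by (subst mult_four_block_mat[OF one_carrier_mat zero_carrier_mat P(1) one_carrier_mat B mQ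
          zero_carrier_mat one_carrier_mat]) (use B mQ P(1) PB PQ in simp)
  moreover have L: "?L \<in> carrier_mat (n + m) (n + m)" and U: "?U \<in> carrier_mat (n + m) (n + m)"
    using four_block_carrier_mat B by auto
  ultimately have "det C = det ?L * det ?U" using det_mult[OF L U] by simp
  also have "det ?L = 1"
    using det_four_block_mat_upper_right_zero[OF one_carrier_mat refl P(1) one_carrier_mat] by simp
  also have "det ?U = det B"
    using det_four_block_mat_lower_left_zero[OF B mQ refl one_carrier_mat] by simp
  finally have detC: "det C = det B" by simp
  define y where "y c = vec m (\<lambda>i. C $$ (n + i, c))" for c
  have y: "y c \<in> mat_image X" if c: "c < n + m" "c \<noteq> i" "c \<noteq> j" for c
  proof (rule syz)
    show "y c \<in> carrier_vec m" by (simp add: y_def)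
    show "f \<bullet> y c = 0"
    proof (cases "c < n")
      case True
      have "y c = P *\<^sub>v col B c"
        using True B P(1) D by (intro eq_vecI) (auto simp: y_def C_def)
      moreover have "col B c \<in> carrier_vec n" using B by (intro carrier_vecI) simp
      ultimately show ?thesis using P(2)[of "col B c"] cols[OF True c(2,3)] by simp
    next
      case False
      let ?e = "unit_vec m (c - n)"
      have e: "?e \<in> carrier_vec m" by simp
      have Qe: "Q *\<^sub>v ?e \<in> carrier_vec n" using mult_mat_vec_carrier[OF Q(1) e] .
      have PQe: "P *\<^sub>v (Q *\<^sub>v ?e) \<in> carrier_vec m" using mult_mat_vec_carrier[OF P(1) Qe] .
      have colQ: "Q *\<^sub>v ?e = col Q (c - n)" using mult_mat_vec_unit[OF Q(1)] False c(1) by simp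
      have "y c = ?e - P *\<^sub>v (Q *\<^sub>v ?e)"
        unfolding colQ using False c(1) B P(1) Q(1) D
        by (intro eq_vecI) (auto simp: y_def C_def D_def unit_vec_def scalar_prod_def sum_negf)
      then show ?thesis
        using scalar_prod_minus_distrib[OF f e PQe] P(2)[OF Qe] Q(2)[OF e] by simp
    qed
  qed
  have "\<exists>v. v \<in> carrier_vec q \<and> y c = X *\<^sub>v v" if "c < n + m" "c \<notin> {i, j}" for c
    using y[of c] that unfolding mat_image_iff[OF X] by auto
  then obtain v where v: "\<And>c. c < n + m \<Longrightarrow> c \<notin> {i, j} \<Longrightarrow> v c \<in> carrier_vec q \<and> y c = X *\<^sub>v v c"
    by metis
  have "det C \<in> minors_ideal X (int (m - 2))"
  proof (rule det_mem_minors_ideal[OF X C, where R = "{..<n}" and B = "{i, j}" and \<rho> = "\<lambda>i. i - n" and v = v])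
    show "C $$ (i', c) = (X *\<^sub>v v c) $ (i' - n)"
      if "i' < n + m" "c < n + m" "i' \<notin> {..<n}" "c \<notin> {i, j}" for i' c
    proof -
      have "n + (i' - n) = i'" "i' - n < m" using that by auto
      then show ?thesis using v[OF that(2,4), THEN conjunct2, symmetric] by (simp add: y_def)
    qed
    show "m - 2 + card {..<n} + card {i, j} \<le> n + m" using ij False by simp
  qed (use v ij in auto)
  moreover have "int (m - 2) = int m - 2" using False by simp
  ultimately show ?thesis using detC by simp
qed

section \<open>Minors of a Hilbert-Burch matrix lie in the trace\<close>

text \<open>Let \<open>\<Delta>\<close> be the minor that omits the row \<open>i\<close>. By Cramer's rule \<open>f\<^sub>i\<close> divides \<open>f\<^sub>l \<Delta>\<close> for all \<open>l\<close>, hence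
  \<open>z \<Delta>\<close> for all \<open>z \<in> I\<close>. As \<open>I\<close> contains the coprime elements \<open>x\<^sup>N\<close> and \<open>y\<^sup>M\<close>, \<open>f\<^sub>i\<close> divides \<open>\<Delta>\<close>.\<close>

lemma maximal_minor_mem:
  fixes X :: "'k::field poly poly mat"
  assumes f: "f \<in> carrier_vec m" and m: "0 < m"
    and I: "ideal I class_ring" "I = (\<lambda>v. f \<bullet> v) ` carrier_vec m"
    and pure: "xymon N 0 \<in> I" "xymon 0 M \<in> I"
    and X: "X \<in> carrier_mat m (m - 1)" and syz: "\<And>t. t < m - 1 \<Longrightarrow> f \<bullet> col X t = 0"
    and \<rho>: "\<And>s. s < m - 1 \<Longrightarrow> \<rho> s < m"
  shows "det (mat (m - 1) (m - 1) (\<lambda>(s, t). X $$ (\<rho> s, t))) \<in> I" (is "det ?Z \<in> I")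
proof (cases "inj_on \<rho> {..<m - 1}")
  case False
  then obtain s s' where "s < m - 1" "s' < m - 1" "s \<noteq> s'" "\<rho> s = \<rho> s'" by (auto simp: inj_on_def)
  then have "det ?Z = 0" by (intro det_identical_rows[of _ "m - 1" s s']) auto
  then show ?thesis using class_ideal_zero[OF I(1)] by simp
next
  case True
  let ?A = "\<rho> ` {..<m - 1}"
  have A: "?A \<subseteq> {..<m}" "card ?A = m - 1" using \<rho> card_image[OF True] by auto
  then have "card ({..<m} - ?A) = 1" using m by (simp add: card_Diff_subset)
  then obtain i where i: "{..<m} - ?A = {i}" by (auto simp: card_1_singleton_iff)
  then have im: "i < m" "i \<notin> ?A" and all: "{..<m} = insert i ?A" using A(1) by auto
  have Z: "?Z \<in> carrier_mat (m - 1) (m - 1)" by simp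
  \<comment> \<open>The relation \<open>\<Sum>\<^sub>l f\<^sub>l X\<^sub>l = 0\<close> between the rows of \<open>X\<close>, solved for row \<open>i\<close>.\<close>
  have rel: "(\<Sum>s<m - 1. f $ \<rho> s * X $$ (\<rho> s, t)) = - (f $ i * X $$ (i, t))" if t: "t < m - 1" for t
  proof -
    have "0 = (\<Sum>l<m. f $ l * X $$ (l, t))"
      using syz[OF t] X t by (simp add: scalar_prod_def atLeast0LessThan)
    also have "\<dots> = f $ i * X $$ (i, t) + (\<Sum>l\<in>?A. f $ l * X $$ (l, t))"
      unfolding all using im(2) by (subst sum.insert) auto
    also have "(\<Sum>l\<in>?A. f $ l * X $$ (l, t)) = (\<Sum>s<m - 1. f $ \<rho> s * X $$ (\<rho> s, t))"
      by (subst sum.reindex[OF True]) simp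
    finally show ?thesis by (simp add: eq_neg_iff_add_eq_0 add.commute)
  qed
  have dvd: "f $ i dvd f $ l * det ?Z" if "l < m" for l
  proof (cases "l = i")
    case False
    then have "l \<in> ?A" using all that by blast
    then obtain s0 where s0: "s0 < m - 1" "l = \<rho> s0" by blast
    let ?adj = "adj_mat ?Z"
    have adj: "?adj \<in> carrier_mat (m - 1) (m - 1)" "?Z * ?adj = det ?Z \<cdot>\<^sub>m 1\<^sub>m (m - 1)"
      using adj_mat[OF Z] by auto
    have entry: "(\<Sum>t<m - 1. X $$ (\<rho> s, t) * ?adj $$ (t, s0)) = (if s = s0 then det ?Z else 0)"
      if "s < m - 1" for s
    proof -
      have "(\<Sum>t<m - 1. X $$ (\<rho> s, t) * ?adj $$ (t, s0)) = (?Z * ?adj) $$ (s, s0)"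
        using that s0 adj(1) by (simp add: scalar_prod_def atLeast0LessThan)
      then show ?thesis using that s0 unfolding adj(2) by simp
    qed
    have "f $ l * d = (\<Sum>s<m - 1. f $ \<rho> s * (if s = s0 then d else 0))" for d
      using s0 by (simp add: if_distrib[of "(*) _"] cong: if_cong)
    then have "f $ l * det ?Z = (\<Sum>s<m - 1. f $ \<rho> s * (if s = s0 then det ?Z else 0))" .
    also have "\<dots> = (\<Sum>s<m - 1. \<Sum>t<m - 1. f $ \<rho> s * (X $$ (\<rho> s, t) * ?adj $$ (t, s0)))"
      by (intro sum.cong refl) (simp add: entry[symmetric] sum_distrib_left)
    also have "\<dots> = (\<Sum>t<m - 1. \<Sum>s<m - 1. f $ \<rho> s * (X $$ (\<rho> s, t) * ?adj $$ (t, s0)))"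
      by (rule sum.swap)
    also have "\<dots> = (\<Sum>t<m - 1. - (f $ i * X $$ (i, t)) * ?adj $$ (t, s0))"
      by (intro sum.cong refl) (simp add: rel[symmetric] sum_distrib_right mult.assoc)
    also have "f $ i dvd \<dots>" by (intro dvd_sum) simp
    finally show ?thesis .
  qed simp
  have dvdI: "f $ i dvd z * det ?Z" if "z \<in> I" for z
  proof -
    obtain v where v: "v \<in> carrier_vec m" "z = f \<bullet> v" using \<open>z \<in> I\<close> I(2) by auto
    then have "z * det ?Z = (\<Sum>l<m. v $ l * (f $ l * det ?Z))"
      by (simp add: scalar_prod_def atLeast0LessThan sum_distrib_right algebra_simps)
    also have "f $ i dvd \<dots>" using dvd by (intro dvd_sum) simp
    finally show ?thesis .
  qed
  obtain s t where s: "xymon N 0 * det ?Z = f $ i * s" and t: "xymon 0 M * det ?Z = f $ i * t"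
    using dvdI[OF pure(1)] dvdI[OF pure(2)] by (auto elim!: dvdE)
  have fi: "f $ i \<in> I" using I(2) im(1) f by (auto intro!: image_eqI[of _ _ "unit_vec m i"])
  show ?thesis
  proof (cases "f $ i = 0")
    case True
    then have "det ?Z = 0" using s by simp
    then show ?thesis using class_ideal_zero[OF I(1)] by simp
  next
    case False
    have "f $ i * (s * xymon 0 M) = xymon N 0 * (xymon 0 M * det ?Z)"
      using s by (simp add: ac_simps)
    also have "\<dots> = f $ i * (t * xymon N 0)" unfolding t by (simp add: ac_simps)
    finally have "s * xymon 0 M = t * xymon N 0" using False by simp
    then obtain s' where "s = xymon N 0 * s'" using xpower_dvd_of_ypower_mult by (metis dvdE)
    then have "xymon N 0 * det ?Z = xymon N 0 * (f $ i * s')" using s by (simp add: ac_simps)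
    then have "det ?Z = f $ i * s'" by simp
    then show ?thesis using class_ideal_mult_right[OF I(1) fi] by simp
  qed
qed

lemma pick_complement_singleton:
  assumes k: "k < Suc n" and t: "t < n"
  shows "pick ({..<Suc n} - {k}) t = insert_index k t"
proof -
  let ?B = "{..<Suc n} - {k}"
  have "insert_index k t \<in> ?B" using t by (auto simp: insert_index_def)
  moreover have "{a \<in> ?B. a < insert_index k t} = insert_index k ` {..<t}"
  proof (intro subset_antisym subsetI)
    fix a assume "a \<in> {a \<in> ?B. a < insert_index k t}"
    then have "a = insert_index k (if a < k then a else a - 1)" "(if a < k then a else a - 1) < t"
      by (auto simp: insert_index_def split: if_splits)
    then show "a \<in> insert_index k ` {..<t}" by blast
  qed (use t k in \<open>auto simp: insert_index_def split: if_splits\<close>)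
  ultimately show ?thesis
    using pick_card_in_set[of "insert_index k t" ?B] card_image[OF insert_index_inj_on[of k "{..<t}"]] by simp
qed

text \<open>Fix \<open>m - 2\<close> rows of \<open>X\<close>. The vector \<open>w\<close> of the signed \<open>(m - 2)\<close>-minors of these rows satisfies
  \<open>X w \<in> I S\<^sup>m\<close>: by Laplace expansion the entries of \<open>X w\<close> are maximal minors of \<open>X\<close>, which lie
  in \<open>I\<close>.\<close>

lemma minor_is_entry:
  fixes X :: "'k::field poly poly mat"
  assumes f: "f \<in> carrier_vec m" and m: "2 \<le> m"
    and I: "ideal I class_ring" "I = (\<lambda>v. f \<bullet> v) ` carrier_vec m"
    and pure: "xymon N 0 \<in> I" "xymon 0 M \<in> I"
    and X: "X \<in> carrier_mat m (m - 1)" and syz: "\<And>t. t < m - 1 \<Longrightarrow> f \<bullet> col X t = 0"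
    and A: "A \<subseteq> {..<m}" "card A = m - 2" and B: "B \<subseteq> {..<m - 1}" "card B = m - 2"
  obtains w k where "w \<in> carrier_vec (m - 1)" "\<And>l. l < m \<Longrightarrow> (X *\<^sub>v w) $ l \<in> I" "k < m - 1"
    "w $ k = (- 1) ^ k * det (mat (m - 2) (m - 2) (\<lambda>(i, j). X $$ (pick A i, pick B j)))"
proof -
  obtain n where n: "m = Suc (Suc n)" using m by (metis add_2_eq_Suc le_Suc_ex)
  define Z where "Z l = mat (Suc n) (Suc n) (\<lambda>(s, t). X $$ ((case s of 0 \<Rightarrow> l | Suc s' \<Rightarrow> pick A s'), t))" for l
  have Z: "Z l \<in> carrier_mat (Suc n) (Suc n)" for l by (simp add: Z_def)
  have pickA: "pick A s < m" if "s < n" for s using pick_in_set_le[of s A] A that n by auto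
  define w where "w = vec (Suc n) (\<lambda>t. cofactor (Z 0) 0 t)"
  have cof: "cofactor (Z l) 0 t = cofactor (Z 0) 0 t" if "t < Suc n" for l t
  proof -
    have "mat_delete (Z l) 0 t = mat_delete (Z 0) 0 t"
      using that by (intro eq_matI) (auto simp: mat_delete_def Z_def)
    then show ?thesis by (simp add: cofactor_def)
  qed
  have Xw: "(X *\<^sub>v w) $ l \<in> I" if l: "l < m" for l
  proof -
    have "(X *\<^sub>v w) $ l = (\<Sum>t<Suc n. X $$ (l, t) * cofactor (Z 0) 0 t)"
      using X l n by (simp add: w_def scalar_prod_def atLeast0LessThan)
    also have "\<dots> = (\<Sum>t<Suc n. Z l $$ (0, t) * cofactor (Z l) 0 t)"
    proof (intro sum.cong refl)
      fix t assume "t \<in> {..<Suc n}"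
      then show "X $$ (l, t) * cofactor (Z 0) 0 t = Z l $$ (0, t) * cofactor (Z l) 0 t"
        using cof[of t l] by (simp add: Z_def)
    qed
    also have "\<dots> = det (Z l)" by (rule laplace_expansion_row[OF Z, symmetric]) simp
    also have "\<dots> \<in> I"
    proof -
      have "det (mat (m - 1) (m - 1) (\<lambda>(s, t). X $$ ((case s of 0 \<Rightarrow> l | Suc s' \<Rightarrow> pick A s'), t))) \<in> I"
        by (rule maximal_minor_mem[OF f _ I pure X syz])
          (use l pickA n in \<open>auto split: nat.split\<close>)
      then show ?thesis using n by (simp add: Z_def)
    qed
    finally show ?thesis .
  qed
  have "card ({..<Suc n} - B) = 1" using B n finite_subset[OF B(1)] by (simp add: card_Diff_subset)
  then obtain k where k: "{..<Suc n} - B = {k}" by (auto simp: card_1_singleton_iff)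
  then have kn: "k < Suc n" and Bk: "B = {..<Suc n} - {k}" using B n by auto
  have "mat_delete (Z 0) 0 k = mat n n (\<lambda>(i, j). X $$ (pick A i, pick B j))"
  proof (rule eq_matI)
    fix i j assume "i < dim_row (mat n n (\<lambda>(i, j). X $$ (pick A i, pick B j)))"
      "j < dim_col (mat n n (\<lambda>(i, j). X $$ (pick A i, pick B j)))"
    then have ij: "i < n" "j < n" by auto
    have "mat_delete (Z 0) 0 k $$ (i, j) = Z 0 $$ (insert_index 0 i, insert_index k j)"
      using mat_delete_index[OF Z _ kn ij, of 0] by simp
    also have "\<dots> = X $$ (pick A i, pick B j)"
      using ij unfolding Bk pick_complement_singleton[OF kn ij(2)] by (simp add: Z_def insert_index_def)
    finally show "mat_delete (Z 0) 0 k $$ (i, j) = mat n n (\<lambda>(i, j). X $$ (pick A i, pick B j)) $$ (i, j)"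
      using ij by simp
  qed (simp_all add: Z_def)
  then have "w $ k = (- 1) ^ k * det (mat (m - 2) (m - 2) (\<lambda>(i, j). X $$ (pick A i, pick B j)))"
    using kn n by (simp add: w_def cofactor_def)
  then show thesis using that[of w k] Xw kn n by (simp add: w_def)
qed

section \<open>Staircase generators of an Artinian monomial ideal\<close>

text \<open>The sum of the values of \<open>\<phi>\<close> is invariant under permutations, but a permutation other than the
  identity with a nonzero term in the Leibniz formula would increase it.\<close>

lemma det_acyclic:
  fixes B :: "'a::comm_ring_1 mat" and \<phi> :: "nat \<Rightarrow> nat"
  assumes B: "B \<in> carrier_mat n n"
    and acyclic: "\<And>r c. r < n \<Longrightarrow> c < n \<Longrightarrow> B $$ (r, c) \<noteq> 0 \<Longrightarrow> r = c \<or> \<phi> r < \<phi> c"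
  shows "det B = (\<Prod>c<n. B $$ (c, c))"
proof -
  have zero: "(\<Prod>i = 0..<n. B $$ (i, p i)) = 0" if p: "p permutes {0..<n}" "p \<noteq> id" for p
  proof (rule ccontr)
    assume "(\<Prod>i = 0..<n. B $$ (i, p i)) \<noteq> 0"
    then have nz: "B $$ (i, p i) \<noteq> 0" if "i < n" for i using that by (meson atLeastLessThan_iff finite_atLeastLessThan le0 prod_zero)
    have pn: "p i < n" if "i < n" for i using permutes_in_image[OF p(1), of i] that by simp
    have step: "i = p i \<or> \<phi> i < \<phi> (p i)" if "i < n" for i using acyclic[OF that pn[OF that] nz[OF that]] .
    obtain i where i: "p i \<noteq> i" using p(2) by (metis eq_id_iff)
    then have "i < n" using p(1) by (meson atLeastLessThan_iff le0 not_le permutes_not_in)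
    have "(\<Sum>i = 0..<n. \<phi> i) < (\<Sum>i = 0..<n. \<phi> (p i))"
    proof (rule sum_strict_mono_ex1)
      show "\<forall>i\<in>{0..<n}. \<phi> i \<le> \<phi> (p i)" using step by (auto intro: less_imp_le) (metis le_refl less_imp_le)
      show "\<exists>i\<in>{0..<n}. \<phi> i < \<phi> (p i)" using step[OF \<open>i < n\<close>] i \<open>i < n\<close> by (intro bexI[of _ i]) auto
    qed simp
    moreover have "(\<Sum>i = 0..<n. \<phi> (p i)) = (\<Sum>i = 0..<n. \<phi> i)"
      using sum.permute[OF p(1), of \<phi>] by (simp add: o_def)
    ultimately show False by simp
  qed
  have "det B = (\<Sum>p\<in>{p. p permutes {0..<n}}. signof p * (\<Prod>i = 0..<n. B $$ (i, p i)))"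
    by (rule det_def'[OF B])
  also have "\<dots> = (\<Sum>p\<in>{p. p permutes {0..<n}}. if p = id then (\<Prod>i = 0..<n. B $$ (i, i)) else 0)"
    by (intro sum.cong refl) (use zero in \<open>auto simp: sign_id\<close>)
  also have "\<dots> = (\<Prod>i = 0..<n. B $$ (i, i))"
    using finite_permutations[of "{0..<n}"] permutes_id[of "{0..<n}"] by (simp add: sum.delta')
  finally show ?thesis by (simp add: atLeast0LessThan)
qed

lemma prod_xymon: "(\<Prod>c\<in>A. xymon (a c) (b c)) = xymon (\<Sum>c\<in>A. a c) (\<Sum>c\<in>A. b c)"
  by (induction A rule: infinite_finite_induct) (auto simp: xymon_mult)

lemma sum_antimono_telescope:
  fixes \<beta> :: "nat \<Rightarrow> nat"
  assumes "antimono \<beta>" "i \<le> k"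
  shows "(\<Sum>c\<in>{i<..k}. \<beta> (c - 1) - \<beta> c) = \<beta> i - \<beta> k"
  using assms(2)
proof (induction k rule: dec_induct)
  case (step k)
  have "{i<..Suc k} = insert (Suc k) {i<..k}" using step by auto
  moreover have "\<beta> (Suc k) \<le> \<beta> k" "\<beta> k \<le> \<beta> i" using antimonoD[OF assms(1)] step by auto
  ultimately show ?case using step by simp
qed simp

text \<open>The monomials \<open>x\<^sup>l y\<^sup>\<beta>\<^sup>l\<close> with \<open>l \<le> N\<close> generate \<open>I\<close>. They need not be minimal generators, but their relations
  are generated by those between neighbours, since consecutive exponents of \<open>x\<close> differ by one. This
  makes the relation matrix \<open>X\<^sub>0\<close> bidiagonal.\<close>

locale staircase =
  fixes I :: "'k::field poly poly set" and N :: nat and \<beta> :: "nat \<Rightarrow> nat"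
  assumes monomial: "monomial_ideal I" and N_pos: "0 < N"
    and anti: "antimono \<beta>" and \<beta>_N: "\<beta> N = 0"
    and mem_iff: "xymon a b \<in> I \<longleftrightarrow> (\<exists>s\<le>N. s \<le> a \<and> \<beta> s \<le> b)"
begin

definition u :: "'k poly poly vec" where
  "u = vec (Suc N) (\<lambda>l. xymon l (\<beta> l))"

definition X0 :: "'k poly poly mat" where
  "X0 = mat (Suc N) N (\<lambda>(i, l). if i = l then xymon 1 0
     else if i = Suc l then - xymon 0 (\<beta> l - \<beta> (Suc l)) else 0)"

lemma u_carrier: "u \<in> carrier_vec (Suc N)"
  by (simp add: u_def)

lemma X0_carrier: "X0 \<in> carrier_mat (Suc N) N"
  by (simp add: X0_def)

lemma ideal_I: "ideal I class_ring"
  using monomial by (rule monomial_ideal_ideal)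

lemma \<beta>_le: "i \<le> j \<Longrightarrow> \<beta> j \<le> \<beta> i"
  using anti by (rule antimonoD)

lemma X0_mult_index:
  assumes w: "w \<in> carrier_vec N" and i: "i \<le> N"
  shows "(X0 *\<^sub>v w) $ i = (if i < N then xymon 1 0 * w $ i else 0)
    - (if 0 < i then xymon 0 (\<beta> (i - 1) - \<beta> i) * w $ (i - 1) else 0)"
proof -
  have "(X0 *\<^sub>v w) $ i = (\<Sum>l<N. X0 $$ (i, l) * w $ l)"
    using w i X0_carrier by (simp add: scalar_prod_def atLeast0LessThan)
  also have "\<dots> = (\<Sum>l<N. (if l = i then xymon 1 0 * w $ l else 0)
      - (if l = i - 1 \<and> 0 < i then xymon 0 (\<beta> l - \<beta> (Suc l)) * w $ l else 0))"
    by (intro sum.cong refl) (use i in \<open>auto simp: X0_def\<close>)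
  also have "\<dots> = (\<Sum>l<N. if l = i then xymon 1 0 * w $ l else 0)
      - (\<Sum>l<N. if l = i - 1 \<and> 0 < i then xymon 0 (\<beta> l - \<beta> (Suc l)) * w $ l else 0)"
    by (rule sum_subtractf)
  also have "(\<Sum>l<N. if l = i then xymon 1 0 * w $ l else 0) = (if i < N then xymon 1 0 * w $ i else 0)"
    by simp
  also have "(\<Sum>l<N. if l = i - 1 \<and> 0 < i then xymon 0 (\<beta> l - \<beta> (Suc l)) * w $ l else 0)
      = (if 0 < i then xymon 0 (\<beta> (i - 1) - \<beta> i) * w $ (i - 1) else 0)"
    using i by (cases i) auto
  finally show ?thesis .
qed

lemma u_col_X0:
  assumes l: "l < N"
  shows "u \<bullet> col X0 l = 0"
proof -
  have "u \<bullet> col X0 l = (\<Sum>i<Suc N. xymon i (\<beta> i) * X0 $$ (i, l))"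
    using X0_carrier l by (simp add: scalar_prod_def u_def atLeast0LessThan)
  also have "\<dots> = (\<Sum>i<Suc N. (if i = l then xymon i (\<beta> i) * xymon 1 0 else 0)
      + (if i = Suc l then - (xymon i (\<beta> i) * xymon 0 (\<beta> l - \<beta> (Suc l))) else 0))"
    by (intro sum.cong refl) (use l in \<open>auto simp: X0_def\<close>)
  also have "\<dots> = xymon l (\<beta> l) * xymon 1 0
      - xymon (Suc l) (\<beta> (Suc l)) * xymon 0 (\<beta> l - \<beta> (Suc l))"
    using l by (simp only: sum.distrib) simp
  also have "\<dots> = 0" using \<beta>_le[of l "Suc l"] by (simp add: xymon_mult)
  finally show ?thesis .
qed

lemma u_X0_mult:
  assumes v: "v \<in> carrier_vec N"
  shows "u \<bullet> (X0 *\<^sub>v v) = 0"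
proof -
  have tX: "X0\<^sup>T \<in> carrier_mat N (Suc N)" using X0_carrier by simp
  have "X0\<^sup>T *\<^sub>v u = 0\<^sub>v N"
    using u_col_X0 X0_carrier u_carrier
    by (intro eq_vecI) (auto simp: comm_scalar_prod[of _ "Suc N" u])
  then show ?thesis using transpose_vec_mult_scalar[OF X0_carrier v u_carrier] v by simp
qed

lemma ideal_eq_image: "I = (\<lambda>v. u \<bullet> v) ` carrier_vec (Suc N)"
proof (intro subset_antisym subsetI)
  have J: "ideal ((\<lambda>v. u \<bullet> v) ` carrier_vec (Suc N)) class_ring"
    by (rule ideal_linear_form_image[OF u_carrier])
  fix z assume z: "z \<in> I"
  show "z \<in> (\<lambda>v. u \<bullet> v) ` carrier_vec (Suc N)"
  proof (rule mem_ideal_if_monomials_mem[OF J])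
    fix a b assume "cf z a b \<noteq> 0"
    then have "xymon a b \<in> I" using z monomial_ideal_mem_iff[OF monomial] by blast
    then obtain s where s: "s \<le> N" "s \<le> a" "\<beta> s \<le> b" unfolding mem_iff by auto
    have "xymon s (\<beta> s) \<in> (\<lambda>v. u \<bullet> v) ` carrier_vec (Suc N)"
      using s(1) by (intro image_eqI[of _ _ "unit_vec (Suc N) s"]) (auto simp: u_def)
    then show "xymon a b \<in> (\<lambda>v. u \<bullet> v) ` carrier_vec (Suc N)"
      by (rule class_ideal_dvd[OF J]) (simp add: xymon_dvd_xymon s)
  qed
next
  fix z assume "z \<in> (\<lambda>v. u \<bullet> v) ` carrier_vec (Suc N)"
  then obtain v where v: "v \<in> carrier_vec (Suc N)" "z = u \<bullet> v" by auto
  have "xymon l (\<beta> l) \<in> I" if "l \<le> N" for l using that mem_iff by blast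
  then have "(\<Sum>l<Suc N. xymon l (\<beta> l) * v $ l) \<in> I"
    by (intro class_ideal_sum[OF ideal_I] class_ideal_mult_right[OF ideal_I]) simp
  moreover have "z = (\<Sum>l<Suc N. xymon l (\<beta> l) * v $ l)"
    using v by (simp add: scalar_prod_def u_def atLeast0LessThan)
  ultimately show "z \<in> I" by simp
qed

end

text \<open>All monomials except the first are divisible by \<open>x\<close>, so \<open>v\<^sub>0 = x w\<^sub>0\<close>. Subtracting \<open>w\<^sub>0\<close> times the
  relation between the first two monomials and dividing by \<open>x\<close> leaves a relation between one monomial
  less.\<close>

lemma staircase_syzygy:
  fixes v :: "nat \<Rightarrow> 'k::field poly poly" and \<beta> :: "nat \<Rightarrow> nat"
  assumes "antimono \<beta>" "(\<Sum>l\<le>n. xymon l (\<beta> l) * v l) = 0"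
  shows "\<exists>w. \<forall>l\<le>n. v l = (if l < n then xymon 1 0 * w l else 0)
    - (if 0 < l then xymon 0 (\<beta> (l - 1) - \<beta> l) * w (l - 1) else 0)"
  using assms
proof (induction n arbitrary: \<beta> v)
  case 0
  then show ?case by simp
next
  case (Suc n)
  have shift: "(\<Sum>l\<le>Suc n. xymon l (\<beta> l) * v l)
      = xymon 0 (\<beta> 0) * v 0 + (\<Sum>l\<le>n. xymon (Suc l) (\<beta> (Suc l)) * v (Suc l))"
    by (rule sum.atMost_Suc_shift)
  have x: "(\<Sum>l\<le>n. xymon (Suc l) (\<beta> (Suc l)) * v (Suc l))
      = xymon 1 0 * (\<Sum>l\<le>n. xymon l (\<beta> (Suc l)) * v (Suc l))"
    by (simp add: sum_distrib_left mult.assoc[symmetric] xymon_mult)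
  have "v 0 * xymon 0 (\<beta> 0) = (- (\<Sum>l\<le>n. xymon l (\<beta> (Suc l)) * v (Suc l))) * xymon 1 0"
    using Suc.prems(2) unfolding shift x by (simp add: algebra_simps eq_neg_iff_add_eq_0)
  then obtain w0 where w0: "v 0 = xymon 1 0 * w0"
    using xpower_dvd_of_ypower_mult by (metis dvdE)
  define v' where "v' l = v (Suc l) + (if l = 0 then xymon 0 (\<beta> 0 - \<beta> 1) * w0 else 0)" for l
  have le: "\<beta> 1 \<le> \<beta> 0" using antimonoD[OF Suc.prems(1)] by simp
  have "xymon 1 0 * (\<Sum>l\<le>n. xymon l (\<beta> (Suc l)) * v' l)
      = xymon 1 0 * (\<Sum>l\<le>n. xymon l (\<beta> (Suc l)) * v (Suc l))
        + xymon 1 0 * (\<Sum>l\<le>n. if l = 0 then xymon l (\<beta> (Suc l)) * xymon 0 (\<beta> 0 - \<beta> 1) * w0 else 0)"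
    unfolding distrib_left[symmetric] sum.distrib[symmetric]
    by (intro arg_cong[of _ _ "(*) (xymon 1 0)"] sum.cong refl) (simp add: v'_def algebra_simps)
  also have "xymon 1 0 * (\<Sum>l\<le>n. if l = 0 then xymon l (\<beta> (Suc l)) * xymon 0 (\<beta> 0 - \<beta> 1) * w0 else 0)
      = xymon 0 (\<beta> 0) * v 0"
    using le by (simp add: w0 xymon_mult mult.left_commute mult.assoc[symmetric])
  also have "xymon 1 0 * (\<Sum>l\<le>n. xymon l (\<beta> (Suc l)) * v (Suc l)) + xymon 0 (\<beta> 0) * v 0 = 0"
    using Suc.prems(2) unfolding shift x by (simp add: add.commute)
  finally have "(\<Sum>l\<le>n. xymon l (\<beta> (Suc l)) * v' l) = 0" by simp
  moreover have "antimono (\<lambda>l. \<beta> (Suc l))" using Suc.prems(1) by (simp add: antimono_def)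
  ultimately obtain w' where w': "\<forall>l\<le>n. v' l = (if l < n then xymon 1 0 * w' l else 0)
      - (if 0 < l then xymon 0 (\<beta> (Suc (l - 1)) - \<beta> (Suc l)) * w' (l - 1) else 0)"
    using Suc.IH[of "\<lambda>l. \<beta> (Suc l)" v'] by auto
  show ?case
  proof (intro exI[of _ "case_nat w0 w'"] allI impI)
    fix l assume l: "l \<le> Suc n"
    show "v l = (if l < Suc n then xymon 1 0 * case_nat w0 w' l else 0)
      - (if 0 < l then xymon 0 (\<beta> (l - 1) - \<beta> l) * case_nat w0 w' (l - 1) else 0)"
    proof (cases l)
      case 0
      then show ?thesis by (simp add: w0)
    next
      case (Suc l')
      have "v l = v' l' - (if l' = 0 then xymon 0 (\<beta> 0 - \<beta> 1) * w0 else 0)" by (simp add: v'_def Suc)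
      then show ?thesis using w'[rule_format, of l'] l Suc by (cases l') auto
    qed
  qed
qed

context staircase
begin

lemma syzygies_u: "{v \<in> carrier_vec (Suc N). u \<bullet> v = 0} = mat_image X0"
proof (intro subset_antisym subsetI)
  fix v assume "v \<in> {v \<in> carrier_vec (Suc N). u \<bullet> v = 0}"
  then have v: "v \<in> carrier_vec (Suc N)" "u \<bullet> v = 0" by auto
  have "(\<Sum>l\<le>N. xymon l (\<beta> l) * v $ l) = u \<bullet> v"
    using v(1) by (simp add: scalar_prod_def u_def atLeast0LessThan lessThan_Suc_atMost)
  with v(2) obtain w where w: "\<forall>l\<le>N. v $ l = (if l < N then xymon 1 0 * w l else 0)
    - (if 0 < l then xymon 0 (\<beta> (l - 1) - \<beta> l) * w (l - 1) else 0)"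
    using staircase_syzygy[OF anti, where n = N and v = "\<lambda>l. v $ l"] by auto
  have "v = X0 *\<^sub>v vec N w"
  proof (rule eq_vecI)
    fix l assume "l < dim_vec (X0 *\<^sub>v vec N w)"
    then have l: "l \<le> N" using X0_carrier by simp
    then show "v $ l = (X0 *\<^sub>v vec N w) $ l"
      using w[rule_format, OF l] X0_mult_index[of "vec N w" l] by auto
  qed (use v X0_carrier in auto)
  then show "v \<in> mat_image X0" unfolding mat_image_iff[OF X0_carrier] by (intro bexI[of _ "vec N w"]) auto
next
  fix v assume "v \<in> mat_image X0"
  then obtain w where w: "w \<in> carrier_vec N" "v = X0 *\<^sub>v w" unfolding mat_image_iff[OF X0_carrier] by auto
  then show "v \<in> {v \<in> carrier_vec (Suc N). u \<bullet> v = 0}"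
    using u_X0_mult[OF w(1)] mult_mat_vec_carrier[OF X0_carrier w(1)] by simp
qed

lemma kernel_X0: "mat_kernel X0 = {0\<^sub>v N}"
proof (intro subset_antisym subsetI)
  fix w assume "w \<in> mat_kernel X0"
  then have w: "w \<in> carrier_vec N" and 0: "X0 *\<^sub>v w = 0\<^sub>v (Suc N)"
    unfolding mat_kernel_iff[OF X0_carrier] by auto
  have "w $ i = 0" if "i < N" for i
    using that
  proof (induction i)
    case 0
    then show ?case using X0_mult_index[OF w, of 0] \<open>X0 *\<^sub>v w = 0\<^sub>v (Suc N)\<close> by simp
  next
    case (Suc i)
    then show ?case using X0_mult_index[OF w, of "Suc i"] \<open>X0 *\<^sub>v w = 0\<^sub>v (Suc N)\<close> by simp
  qed
  then have "w = 0\<^sub>v N" using w by (intro eq_vecI) auto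
  then show "w \<in> {0\<^sub>v N}" by simp
qed (use mat_kernel_zero_vec[OF X0_carrier] in simp)

end

context staircase
begin

lemma cf_eq_0: "z \<in> I \<Longrightarrow> xymon a b \<notin> I \<Longrightarrow> cf z a b = 0"
  using monomial_ideal_mem_iff[OF monomial] by blast

text \<open>The coefficient of \<open>x\<^sup>p\<^sup>+\<^sup>1 y\<^sup>q\<close> in row \<open>k\<close> of \<open>X\<^sub>0 w\<close> combines those of \<open>w\<^sub>k\<close> and \<open>w\<^sub>k\<^sub>-\<^sub>1\<close>. Either
  this monomial is in \<open>I\<close>, or the two coefficients cancel and the search continues with \<open>w\<^sub>k\<^sub>-\<^sub>1\<close>. It
  ends in row \<open>0\<close> at the latest, to which only \<open>w\<^sub>0\<close> contributes.\<close>

lemma left_staircase_step: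
  assumes w: "w \<in> carrier_vec N" and rows: "\<And>i. i \<le> N \<Longrightarrow> (X0 *\<^sub>v w) $ i \<in> I"
    and "k < N" "cf (w $ k) p q \<noteq> 0"
  shows "\<exists>i\<le>k. \<exists>s\<le>N. i + s \<le> p + k + 1 \<and> \<beta> i + \<beta> s \<le> q + \<beta> k"
  using assms(3,4)
proof (induction k arbitrary: p q)
  case 0
  have "cf ((X0 *\<^sub>v w) $ 0) (p + 1) q = cf (w $ 0) p q"
    unfolding X0_mult_index[OF w le0] using 0 by (simp add: cf_xymon_mult)
  then have "xymon (p + 1) q \<in> I" using cf_eq_0[OF rows[of 0], of "p + 1" q] 0 by auto
  then obtain s where "s \<le> N" "s \<le> p + 1" "\<beta> s \<le> q" unfolding mem_iff by auto
  then show ?case by (intro exI[of _ 0] conjI exI[of _ s]) auto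
next
  case (Suc k)
  show ?case
  proof (cases "xymon (p + 1) q \<in> I")
    case True
    then obtain s where "s \<le> N" "s \<le> p + 1" "\<beta> s \<le> q" unfolding mem_iff by auto
    then show ?thesis by (intro exI[of _ "Suc k"] conjI exI[of _ s]) auto
  next
    case False
    let ?\<gamma> = "\<beta> k - \<beta> (Suc k)"
    have "cf ((X0 *\<^sub>v w) $ Suc k) (p + 1) q
        = cf (w $ Suc k) p q - (if ?\<gamma> \<le> q then cf (w $ k) (p + 1) (q - ?\<gamma>) else 0)"
      unfolding X0_mult_index[OF w less_imp_le[OF Suc.prems(1)]]
      using Suc.prems by (simp add: cf_diff cf_xymon_mult)
    then have "?\<gamma> \<le> q" "cf (w $ k) (p + 1) (q - ?\<gamma>) \<noteq> 0"
      using cf_eq_0[OF rows False, of "Suc k"] Suc.prems by (auto split: if_splits)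
    moreover from this(2) obtain i s where "i \<le> k" "s \<le> N" "i + s \<le> p + 1 + k + 1"
        "\<beta> i + \<beta> s \<le> q - ?\<gamma> + \<beta> k"
      using Suc.IH[of "p + 1" "q - ?\<gamma>"] Suc.prems(1) by auto
    ultimately show ?thesis
      using \<beta>_le[of k "Suc k"] by (intro exI[of _ i] conjI exI[of _ s]) auto
  qed
qed

text \<open>The same search in the other direction: it looks at the coefficient of \<open>w\<^sub>k\<close> in row \<open>k + 1\<close> and ends in
  row \<open>N\<close> at the latest.\<close>

lemma right_staircase_step:
  assumes w: "w \<in> carrier_vec N" and rows: "\<And>i. i \<le> N \<Longrightarrow> (X0 *\<^sub>v w) $ i \<in> I"
    and "k < N" "cf (w $ k) p q \<noteq> 0"
  shows "\<exists>j>k. j \<le> N \<and> (\<exists>t\<le>N. j + t \<le> p + k + 1 \<and> \<beta> j + \<beta> t \<le> q + \<beta> k)"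
  using assms(3,4)
proof (induction "N - k" arbitrary: k p q rule: less_induct)
  case less
  let ?\<gamma> = "\<beta> k - \<beta> (Suc k)"
  have le: "\<beta> (Suc k) \<le> \<beta> k" by (rule \<beta>_le) simp
  show ?case
  proof (cases "xymon p (q + ?\<gamma>) \<in> I")
    case True
    then obtain t where "t \<le> N" "t \<le> p" "\<beta> t \<le> q + ?\<gamma>" unfolding mem_iff by auto
    then show ?thesis
      using less.prems(1) le by (intro exI[of _ "Suc k"] conjI exI[of _ t]) auto
  next
    case False
    have row: "cf ((X0 *\<^sub>v w) $ Suc k) p (q + ?\<gamma>)
        = (if Suc k < N \<and> 0 < p then cf (w $ Suc k) (p - 1) (q + ?\<gamma>) else 0) - cf (w $ k) p q"
      unfolding X0_mult_index[OF w Suc_leI[OF less.prems(1)]]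
      by (simp add: cf_diff cf_xymon_mult Suc_le_eq)
    have "cf ((X0 *\<^sub>v w) $ Suc k) p (q + ?\<gamma>) = 0"
      by (rule cf_eq_0[OF rows False]) (use less.prems in simp)
    with row have *: "Suc k < N" "0 < p" "cf (w $ Suc k) (p - 1) (q + ?\<gamma>) \<noteq> 0"
      using less.prems(2) by (auto split: if_splits)
    have "N - Suc k < N - k" using less.prems(1) by simp
    from less.hyps[OF this *(1,3)] obtain j t where "j > Suc k" "j \<le> N" "t \<le> N"
        "j + t \<le> p - 1 + Suc k + 1" "\<beta> j + \<beta> t \<le> q + ?\<gamma> + \<beta> (Suc k)" by auto
    then show ?thesis using *(2) le by (intro exI[of _ j] conjI exI[of _ t]) auto
  qed
qed

text \<open>Read as exponents, the two steps give \<open>u\<^sub>i u\<^sub>s | P\<close> and \<open>u\<^sub>j u\<^sub>t | P\<close> with \<open>i \<le> k < j\<close> for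
  the multidegree \<open>P = (p + k + 1, q + \<beta> k)\<close>. If \<open>s \<le> k < t\<close>, then \<open>u\<^sub>i u\<^sub>j | P\<close> as well, since
  passing from \<open>t\<close> to \<open>i\<close> lowers the exponent of \<open>x\<close> and passing from \<open>s\<close> to \<open>j\<close> does not raise
  that of \<open>y\<close>. Otherwise one of the given pairs has an index on either side of \<open>k\<close>.\<close>

lemma exponents_of_kernel_entry:
  assumes w: "w \<in> carrier_vec N" and rows: "\<And>i. i \<le> N \<Longrightarrow> (X0 *\<^sub>v w) $ i \<in> I"
    and k: "k < N" and nz: "cf (w $ k) p q \<noteq> 0"
  obtains i j where "i \<le> k" "k < j" "j \<le> N" "i + j \<le> p + k + 1" "\<beta> i + \<beta> j \<le> q + \<beta> k"
proof -
  obtain i s where left: "i \<le> k" "s \<le> N" "i + s \<le> p + k + 1" "\<beta> i + \<beta> s \<le> q + \<beta> k"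
    using left_staircase_step[OF w rows k nz] by auto
  obtain j t where jt: "k < j" "j \<le> N" "t \<le> N" "j + t \<le> p + k + 1" "\<beta> j + \<beta> t \<le> q + \<beta> k"
    using right_staircase_step[OF w rows k nz] by auto
  consider "k < s" | "t \<le> k" | "s \<le> k" "k < t" by linarith
  then show thesis
  proof cases
    case 1
    then show ?thesis using that[of i s] left by simp
  next
    case 2
    then show ?thesis using that[of t j] jt by (simp add: add.commute)
  next
    case 3
    have "\<beta> j \<le> \<beta> s" by (rule \<beta>_le) (use 3 jt in simp)
    then show ?thesis using that[of i j] left jt 3 by simp
  qed
qed

text \<open>The monomial is the determinant of a matrix whose columns are, up to sign, columns of \<open>X\<^sub>0\<close>
  except for the unit vectors in columns \<open>i\<close> and \<open>j\<close>; column \<open>k\<close> of \<open>X\<^sub>0\<close> is the one left out. In a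
  column \<open>c < i\<close> or \<open>k < c < j\<close> the entry off the diagonal is below it, in the other columns above
  it; so along the nonzero entries off the diagonal the row index is nearer to \<open>i\<close> or \<open>j\<close> than the
  column index, and the determinant is the product of the diagonal entries.\<close>

lemma staircase_monomial_mem_minors:
  assumes f: "f \<in> carrier_vec m" "I = (\<lambda>v. f \<bullet> v) ` carrier_vec m"
    and X: "X \<in> carrier_mat m q"
    and syz: "{v \<in> carrier_vec m. f \<bullet> v = 0} = mat_image X"
    and ijk: "i \<le> k" "k < j" "j \<le> N"
  shows "xymon (i + (j - Suc k)) (\<beta> i - \<beta> k + \<beta> j) \<in> minors_ideal X (int m - 2)"
proof -
  define up where "up c \<longleftrightarrow> c < i \<or> k < c \<and> c < j" for c
  define B where "B = mat (Suc N) (Suc N) (\<lambda>(r, c). if c = i \<or> c = j then (if r = c then 1 else 0)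
      else if up c then X0 $$ (r, c) else - X0 $$ (r, c - 1))"
  have B: "B \<in> carrier_mat (Suc N) (Suc N)" by (simp add: B_def)
  \<comment> \<open>the distance from \<open>i\<close> for indices up to \<open>k\<close>, and from \<open>j\<close> beyond\<close>
  define \<phi> where "\<phi> r = (if r \<le> k then (if r < i then i - r else r - i) else (if r < j then j - r else r - j))" for r
  have \<phi>: "c \<le> i \<Longrightarrow> \<phi> c = i - c" "i \<le> c \<Longrightarrow> c \<le> k \<Longrightarrow> \<phi> c = c - i"
    "k < c \<Longrightarrow> c \<le> j \<Longrightarrow> \<phi> c = j - c" "j \<le> c \<Longrightarrow> \<phi> c = c - j" for c
    using ijk by (simp_all add: \<phi>_def)
  have "det B = (\<Prod>c<Suc N. B $$ (c, c))"
  proof (rule det_acyclic[OF B, where \<phi> = \<phi>])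
    fix r c assume rc: "r < Suc N" "c < Suc N" "B $$ (r, c) \<noteq> 0"
    then consider "r = c" | "c \<noteq> i" "c \<noteq> j" "up c" "r = Suc c" | "c \<noteq> i" "c \<noteq> j" "\<not> up c" "r = c - 1" "0 < c"
      using ijk by (auto simp: B_def X0_def up_def split: if_splits)
    then show "r = c \<or> \<phi> r < \<phi> c"
    proof cases
      case up: 2
      then consider "c < i" | "k < c" "c < j" by (auto simp: up_def)
      then show ?thesis
      proof cases
        case 1
        then have "\<phi> c = i - c" "\<phi> r = i - r" using up(4) \<phi>(1) by simp_all
        then show ?thesis using 1 up(4) by arith
      next
        case 2
        then have "\<phi> c = j - c" "\<phi> r = j - r" using up(4) \<phi>(3) by simp_all
        then show ?thesis using 2 up(4) by arith
      qed
    next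
      case down: 3
      then consider "i < c" "c \<le> k" | "j < c" using ijk by (auto simp: up_def)
      then show ?thesis
      proof cases
        case 1
        then have "\<phi> c = c - i" "\<phi> r = r - i" using down(4,5) \<phi>(2) by simp_all
        then show ?thesis using 1 down(4) by arith
      next
        case 2
        then have "\<phi> c = c - j" "\<phi> r = r - j" using down(4,5) \<phi>(4) by simp_all
        then show ?thesis using 2 down(4) by arith
      qed
    qed simp
  qed
  also have "\<dots> = (\<Prod>c<Suc N. xymon (if up c then 1 else 0)
      (if c \<in> {i<..k} \<or> c \<in> {j<..N} then \<beta> (c - 1) - \<beta> c else 0))"
  proof (intro prod.cong refl)
    fix c assume "c \<in> {..<Suc N}"
    then show "B $$ (c, c) = xymon (if up c then 1 else 0)
        (if c \<in> {i<..k} \<or> c \<in> {j<..N} then \<beta> (c - 1) - \<beta> c else 0)"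
      using ijk by (auto simp: B_def X0_def up_def)
  qed
  also have "\<dots> = xymon (\<Sum>c<Suc N. if up c then 1 else 0)
      (\<Sum>c<Suc N. if c \<in> {i<..k} \<or> c \<in> {j<..N} then \<beta> (c - 1) - \<beta> c else 0)"
    by (rule prod_xymon)
  also have "(\<Sum>c<Suc N. if up c then 1 else 0 :: nat) = i + (j - Suc k)"
  proof -
    have "(\<Sum>c<Suc N. if up c then 1 else 0 :: nat) = card ({..<i} \<union> {k<..<j})"
      unfolding card_eq_sum by (rule sum.mono_neutral_cong_right) (use ijk in \<open>auto simp: up_def\<close>)
    also have "\<dots> = i + (j - Suc k)" using ijk by (subst card_Un_disjoint) auto
    finally show ?thesis .
  qed
  also have "(\<Sum>c<Suc N. if c \<in> {i<..k} \<or> c \<in> {j<..N} then \<beta> (c - 1) - \<beta> c else 0) = \<beta> i - \<beta> k + \<beta> j"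
  proof -
    have "(\<Sum>c<Suc N. if c \<in> {i<..k} \<or> c \<in> {j<..N} then \<beta> (c - 1) - \<beta> c else 0)
        = (\<Sum>c\<in>{i<..k} \<union> {j<..N}. \<beta> (c - 1) - \<beta> c)"
      by (rule sum.mono_neutral_cong_right) (use ijk in auto)
    also have "\<dots> = (\<Sum>c\<in>{i<..k}. \<beta> (c - 1) - \<beta> c) + (\<Sum>c\<in>{j<..N}. \<beta> (c - 1) - \<beta> c)"
      using ijk by (intro sum.union_disjoint) auto
    also have "\<dots> = \<beta> i - \<beta> k + (\<beta> j - \<beta> N)"
      by (simp only: sum_antimono_telescope[OF anti ijk(1)] sum_antimono_telescope[OF anti ijk(3)])
    finally show ?thesis by (simp add: \<beta>_N)
  qed
  finally have detB: "det B = xymon (i + (j - Suc k)) (\<beta> i - \<beta> k + \<beta> j)" .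
  have "\<exists>P\<in>carrier_mat m (Suc N). \<forall>v\<in>carrier_vec (Suc N). f \<bullet> (P *\<^sub>v v) = u \<bullet> v"
  proof (rule linear_form_factor[OF u_carrier f(1)])
    fix l assume "l < Suc N"
    then have "u $ l \<in> I" using mem_iff by (auto simp: u_def less_Suc_eq_le)
    then show "\<exists>p\<in>carrier_vec m. f \<bullet> p = u $ l" unfolding f(2) by auto
  qed
  then obtain P where P: "P \<in> carrier_mat m (Suc N)" "\<And>v. v \<in> carrier_vec (Suc N) \<Longrightarrow> f \<bullet> (P *\<^sub>v v) = u \<bullet> v"
    by auto
  have "\<exists>Q\<in>carrier_mat (Suc N) m. \<forall>v\<in>carrier_vec m. u \<bullet> (Q *\<^sub>v v) = f \<bullet> v"
  proof (rule linear_form_factor[OF f(1) u_carrier])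
    fix l assume l: "l < m"
    then have "f \<bullet> unit_vec m l \<in> I" unfolding f(2) by (intro imageI) simp
    then have "f $ l \<in> I" using l f(1) by simp
    then show "\<exists>p\<in>carrier_vec (Suc N). u \<bullet> p = f $ l" unfolding ideal_eq_image by auto
  qed
  then obtain Q where Q: "Q \<in> carrier_mat (Suc N) m" "\<And>v. v \<in> carrier_vec m \<Longrightarrow> u \<bullet> (Q *\<^sub>v v) = f \<bullet> v"
    by auto
  have "det B \<in> minors_ideal X (int m - 2)"
  proof (rule fitting_ideal_transfer[OF u_carrier f(1) X _ P Q B, of i j])
    show "v \<in> mat_image X" if "v \<in> carrier_vec m" "f \<bullet> v = 0" for v using syz that by blast
    show "u \<bullet> col B c = 0" if c: "c < Suc N" "c \<noteq> i" "c \<noteq> j" for c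
    proof (cases "up c")
      case True
      then have "c < N" using ijk by (auto simp: up_def)
      moreover have "col B c = col X0 c"
        using c True X0_carrier \<open>c < N\<close> by (intro eq_vecI) (auto simp: B_def)
      ultimately show ?thesis using u_col_X0 by simp
    next
      case False
      then have c0: "c - 1 < N" "0 < c" using c ijk by (auto simp: up_def)
      have "col B c = - col X0 (c - 1)"
        using c c0 False X0_carrier by (intro eq_vecI) (auto simp: B_def)
      moreover have "u \<bullet> (- col X0 (c - 1)) = - (u \<bullet> col X0 (c - 1))"
        by (rule scalar_prod_uminus_right[OF u_carrier col_carrier_vec[OF c0(1) X0_carrier]])
      ultimately show ?thesis using u_col_X0[OF c0(1)] by simp
    qed
  qed (use ijk in auto)
  then show ?thesis unfolding detB .
qed

lemma kernel_entry_mem_minors: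
  assumes f: "f \<in> carrier_vec m" "I = (\<lambda>v. f \<bullet> v) ` carrier_vec m"
    and X: "X \<in> carrier_mat m q"
    and syz: "{v \<in> carrier_vec m. f \<bullet> v = 0} = mat_image X"
    and w: "w \<in> carrier_vec N" and rows: "\<And>i. i \<le> N \<Longrightarrow> (X0 *\<^sub>v w) $ i \<in> I" and k: "k < N"
  shows "w $ k \<in> minors_ideal X (int m - 2)"
proof (rule mem_ideal_if_monomials_mem[OF minors_ideal_ideal])
  fix p q' assume "cf (w $ k) p q' \<noteq> 0"
  then obtain i j where ij: "i \<le> k" "k < j" "j \<le> N" "i + j \<le> p + k + 1" "\<beta> i + \<beta> j \<le> q' + \<beta> k"
    using exponents_of_kernel_entry[OF w rows k] by metis
  have "xymon (i + (j - Suc k)) (\<beta> i - \<beta> k + \<beta> j) dvd (xymon p q' :: 'k poly poly)"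
    by (rule xymon_dvd_xymon) (use ij \<beta>_le[OF ij(1)] in auto)
  with staircase_monomial_mem_minors[OF f X syz ij(1-3)]
  show "xymon p q' \<in> minors_ideal X (int m - 2)" by (rule class_ideal_dvd[OF minors_ideal_ideal])
qed

text \<open>For \<open>z \<in> I\<close> the vector \<open>w = z e\<^sub>0\<close> satisfies \<open>X\<^sub>0 w \<in> I S\<^sup>N\<^sup>+\<^sup>1\<close>.\<close>

lemma ideal_subset_minors:
  assumes f: "f \<in> carrier_vec m" "I = (\<lambda>v. f \<bullet> v) ` carrier_vec m"
    and X: "X \<in> carrier_mat m q"
    and syz: "{v \<in> carrier_vec m. f \<bullet> v = 0} = mat_image X"
  shows "I \<subseteq> minors_ideal X (int m - 2)"
proof
  fix z assume z: "z \<in> I"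
  let ?w = "z \<cdot>\<^sub>v unit_vec N 0"
  have "?w $ 0 \<in> minors_ideal X (int m - 2)"
  proof (rule kernel_entry_mem_minors[OF f X syz])
    show "(X0 *\<^sub>v ?w) $ i \<in> I" if "i \<le> N" for i
    proof -
      have "X0 *\<^sub>v ?w = z \<cdot>\<^sub>v (X0 *\<^sub>v unit_vec N 0)" by (rule mult_mat_vec_smult[OF X0_carrier]) simp
      then have "(X0 *\<^sub>v ?w) $ i = z * (X0 *\<^sub>v unit_vec N 0) $ i" using that X0_carrier by simp
      then show ?thesis using class_ideal_mult_right[OF ideal_I z] by simp
    qed
  qed (use N_pos in auto)
  then show "z \<in> minors_ideal X (int m - 2)" using N_pos by simp
qed

end

lemma staircase_of_pure_powers:
  fixes I :: "'k::field poly poly set"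
  assumes mono: "monomial_ideal I" and proper: "I \<noteq> UNIV"
    and pure: "xymon N0 0 \<in> I" "xymon 0 M \<in> I"
  obtains N \<beta> where "staircase I N \<beta>"
proof -
  note I = monomial_ideal_ideal[OF mono]
  have up: "xymon c d \<in> I" if "xymon a b \<in> I" "a \<le> c" "b \<le> d" for a b c d
    using class_ideal_dvd[OF I that(1) xymon_dvd_xymon[OF that(2,3)]] .
  define N where "N = (LEAST a. xymon a 0 \<in> I)"
  define \<beta> where "\<beta> l = (LEAST b. xymon l b \<in> I)" for l
  have N: "xymon N 0 \<in> I" unfolding N_def using pure(1) by (rule LeastI)
  have \<beta>: "xymon l (\<beta> l) \<in> I" for l
    unfolding \<beta>_def by (rule LeastI[of _ M]) (rule up[OF pure(2)], auto)
  have \<beta>_le: "\<beta> l \<le> b" if "xymon l b \<in> I" for l b unfolding \<beta>_def using that by (rule Least_le)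
  have "staircase I N \<beta>"
  proof
    show "monomial_ideal I" by (rule mono)
    have "xymon 0 0 \<notin> I" using proper class_ideal_one_imp_UNIV[OF I] by auto
    then show "0 < N" using N by (cases N) auto
    show "antimono \<beta>" by (rule antimonoI) (rule \<beta>_le, rule up[OF \<beta>], auto)
    show "\<beta> N = 0" using \<beta>_le[OF N] by simp
    show "xymon a b \<in> I \<longleftrightarrow> (\<exists>s\<le>N. s \<le> a \<and> \<beta> s \<le> b)" for a b
    proof
      assume ab: "xymon a b \<in> I"
      show "\<exists>s\<le>N. s \<le> a \<and> \<beta> s \<le> b"
      proof (cases "a \<le> N")
        case True
        then show ?thesis using \<beta>_le[OF ab] by auto
      next
        case False
        then show ?thesis using \<beta>_le[OF N] by (intro exI[of _ N]) auto
      qed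
    qed (use up[OF \<beta>] in blast)
  qed
  then show thesis by (rule that)
qed

section \<open>The trace of the canonical module\<close>

lemma quot_resolution_length_two:
  fixes f :: "'a::comm_ring_1 vec"
  defines "A0 \<equiv> mat 1 (dim_vec f) (\<lambda>(_, j). f $ j)"
  assumes f: "f \<in> carrier_vec m" and I: "I = (\<lambda>v. f \<bullet> v) ` carrier_vec m"
    and X: "X \<in> carrier_mat m q" and syz: "{v \<in> carrier_vec m. f \<bullet> v = 0} = mat_image X"
    and ker: "mat_kernel X = {0\<^sub>v q}"
  obtains g r A where "quot_resolution I g r A" "r 1 = m" "r 2 = q" "r 3 = 0" "A 0 = A0" "A 1 = X"
proof -
  define r where "r i = (if i = 0 then 1 else if i = 1 then m else if i = 2 then q else 0)" for i :: nat
  define A where "A i = (if i = 0 then A0 else if i = 1 then X else 0\<^sub>m (r i) 0)" for i :: nat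
  have A0: "A0 \<in> carrier_mat 1 m" using f by (simp add: A0_def)
  have A0v: "A0 *\<^sub>v v = vec 1 (\<lambda>_. f \<bullet> v)" if "v \<in> carrier_vec m" for v
    using that f by (intro eq_vecI) (auto simp: A0_def scalar_prod_def)
  have im0: "mat_image (0\<^sub>m n 0 :: 'a mat) = {0\<^sub>v n}" for n
    using mult_mat_zero_vec[of "0\<^sub>m n 0 :: 'a mat" n 0] by (simp add: mat_image_def carrier_vec_0_eq)
  have ker0: "mat_kernel (0\<^sub>m n 0 :: 'a mat) = {0\<^sub>v 0}" for n
    using mult_mat_zero_vec[of "0\<^sub>m n 0 :: 'a mat" n 0] by (auto simp: mat_kernel_def carrier_vec_0_eq)
  let ?g = "vec 1 (\<lambda>_. 1) :: 'a vec"
  have g: "?g \<bullet> v = v $ 0" if "v \<in> carrier_vec 1" for v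
    using that by (simp add: scalar_prod_def)
  have "quot_resolution I ?g r A"
    unfolding quot_resolution_def
  proof (intro conjI allI)
    show "A i \<in> carrier_mat (r i) (r (Suc i))" for i
      using A0 X by (auto simp: A_def r_def)
    show "?g \<in> carrier_vec (r 0)" by (simp add: r_def)
    have "0 \<in> I" unfolding I using f by (intro image_eqI[of _ _ "0\<^sub>v m"]) auto
    then show "\<exists>v\<in>carrier_vec (r 0). ?g \<bullet> v - 1 \<in> I"
      by (intro bexI[of _ ?g]) (auto simp: r_def scalar_prod_def)
    show "{v \<in> carrier_vec (r 0). ?g \<bullet> v \<in> I} = mat_image (A 0)"
    proof (intro subset_antisym subsetI)
      fix v assume "v \<in> {v \<in> carrier_vec (r 0). ?g \<bullet> v \<in> I}"
      then have v: "v \<in> carrier_vec 1" "v $ 0 \<in> I" using g[of v] by (auto simp: r_def)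
      then obtain w where w: "w \<in> carrier_vec m" "v $ 0 = f \<bullet> w" unfolding I by auto
      then have "v = A0 *\<^sub>v w" unfolding A0v[OF w(1)] using v(1) by (intro eq_vecI) auto
      then show "v \<in> mat_image (A 0)" using mat_image_mult[OF A0 w(1)] by (simp add: A_def)
    next
      fix v assume "v \<in> mat_image (A 0)"
      then obtain w where w: "w \<in> carrier_vec m" "v = A0 *\<^sub>v w"
        using mat_image_iff[OF A0] by (auto simp: A_def)
      then show "v \<in> {v \<in> carrier_vec (r 0). ?g \<bullet> v \<in> I}"
        using A0v[OF w(1)] by (auto simp: r_def I scalar_prod_def)
    qed
    fix i :: nat
    consider "i = 0" | "i = 1" | "2 \<le> i" by linarith
    then show "mat_kernel (A i) = mat_image (A (Suc i))"
    proof cases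
      case 1
      have "(vec 1 (\<lambda>_. c) = 0\<^sub>v 1) = (c = 0)" for c :: 'a
        by (auto simp: vec_eq_iff)
      then have "mat_kernel A0 = {v \<in> carrier_vec m. f \<bullet> v = 0}"
        using mat_kernel_iff[OF A0] A0v by auto
      then show ?thesis using syz 1 by (simp add: A_def)
    next
      case 2
      then show ?thesis using ker im0 by (simp add: A_def r_def)
    next
      case 3
      then show ?thesis using ker0 im0 by (simp add: A_def r_def)
    qed
  qed
  then show thesis by (rule that) (simp_all add: r_def A_def)
qed

lemma min_gens_principal:
  fixes g :: "'a::comm_ring_1"
  assumes "I = {z. g dvd z}"
  shows "min_gens I \<le> 1"
  unfolding min_gens_def
  by (rule Least_le) (use assms in \<open>auto intro!: exI[of _ "{g}"] simp: Idl_singleton\<close>)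

text \<open>The resolution \<open>0 \<rightarrow> S \<rightarrow> S\<close> with map \<open>g\<close> shows that \<open>\<omega>\<close> is the cokernel of multiplication by \<open>g\<close>,
  that is, \<open>S/I\<close> itself. The vector \<open>w = 1\<close> gives the identity, whose image is all of \<open>S/I\<close>.\<close>

lemma trace_of_principal_quotient:
  fixes I :: "'k::field poly poly set" and \<omega> :: "('k poly poly set, 'w) module"
  assumes g: "I = {z. g dvd z}" "g \<noteq> 0" and I: "ideal I class_ring"
    and d: "krull_dim (class_ring Quot I) = 1" and \<omega>: "canonical_module I \<omega>"
  shows "trace_ideal (class_ring Quot I) \<omega> = range (coset I)"
proof -
  let ?R = "class_ring Quot I"
  have W: "Module.module ?R \<omega>" using \<omega> by (simp add: canonical_module_def)
  let ?f = "vec 1 (\<lambda>_. g)" and ?X = "0\<^sub>m 1 0 :: 'k poly poly mat"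
  have fv: "?f \<bullet> v = g * v $ 0" if "v \<in> carrier_vec 1" for v using that by (simp add: scalar_prod_def)
  obtain e r A where R: "quot_resolution I e r A" and r: "r 1 = 1" "r 2 = 0"
    and A: "A 0 = mat 1 (dim_vec ?f) (\<lambda>(_, j). ?f $ j)"
  proof (rule quot_resolution_length_two[of ?f 1 I ?X 0])
    show "I = (\<lambda>v. ?f \<bullet> v) ` carrier_vec 1"
    proof (intro subset_antisym subsetI)
      fix z assume "z \<in> I"
      then obtain c where "z = g * c" using g(1) by auto
      then show "z \<in> (\<lambda>v. ?f \<bullet> v) ` carrier_vec 1"
        by (intro image_eqI[of _ _ "vec 1 (\<lambda>_. c)"]) (auto simp: scalar_prod_def)
    qed (use fv g(1) in auto)
    show "{v \<in> carrier_vec 1. ?f \<bullet> v = 0} = mat_image ?X"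
    proof (intro subset_antisym subsetI)
      fix v assume "v \<in> {v \<in> carrier_vec 1. ?f \<bullet> v = 0}"
      then have "v = 0\<^sub>v 1" using fv g(2) by (intro eq_vecI) auto
      then show "v \<in> mat_image ?X" using mat_image_zero[of ?X 1 0] by simp
    next
      fix v assume "v \<in> mat_image ?X"
      then have "v = 0\<^sub>v 1" using mult_mat_zero_vec[of ?X 1 0] by (auto simp: mat_image_def carrier_vec_0_eq)
      then show "v \<in> {v \<in> carrier_vec 1. ?f \<bullet> v = 0}" using fv[of "0\<^sub>v 1"] by simp
    qed
    show "mat_kernel ?X = {0\<^sub>v 0}"
      using mult_mat_zero_vec[of ?X 1 0] by (auto simp: mat_kernel_def carrier_vec_0_eq)
  qed auto
  have "krull_dim ?R = enat 1" "2 - 1 = Suc 0" using d by (simp_all add: one_enat_def)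
  from canonical_module_linear_cover[OF I \<omega> this R] r
  obtain \<eta> where \<eta>: "linear_cover I \<omega> (carrier_vec 1) (mat_image ((A 0)\<^sup>T)) \<eta>"
    by (auto simp: numeral_2_eq_2)
  have A0: "A 0 \<in> carrier_mat 1 1" by (simp add: A)
  have "coset I (vec 1 (\<lambda>_. 1) $ 0) \<in> trace_ideal ?R \<omega>"
  proof (rule coset_mem_trace_ideal[OF I \<eta> A0 _ _ _ W])
    show "(A 0 *\<^sub>v vec 1 (\<lambda>_. 1)) $ i \<in> I" if "i < 1" for i
      using that g(1) by (simp add: A scalar_prod_def)
  qed auto
  then have one: "coset I 1 \<in> trace_ideal ?R \<omega>" by simp
  have "{s. coset I s \<in> trace_ideal ?R \<omega>} = UNIV"
    by (rule class_ideal_one_imp_UNIV[OF trace_ideal_preimage(1)[OF I]]) (use one in simp)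
  then show ?thesis using trace_ideal_preimage(2)[OF I, of \<omega>] by simp
qed

theorem theorem3p1:
  fixes I :: "'k::field poly poly set"
    and X :: "'k poly poly mat"
    and \<omega> :: "('k poly poly set, 'w) module"
  assumes "monomial_ideal I"
    and "I \<noteq> {0}"
    and "I \<noteq> UNIV"
    and "cohen_macaulay_quot I"
    and "hilbert_burch_matrix I X"
    and "canonical_module I \<omega>"
  shows "I \<subseteq> minors_ideal X (int (min_gens I) - 2) \<and>
    trace_ideal (class_ring Quot I) \<omega>
      = (\<lambda>f. I +>\<^bsub>class_ring\<^esub> f) ` minors_ideal X (int (min_gens I) - 2)"
proof -
  note mono = assms(1) and \<omega> = assms(6)
  note I = monomial_ideal_ideal[OF mono]
  let ?R = "class_ring Quot I"
  define m where "m = min_gens I"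
  obtain f where X: "X \<in> carrier_mat m (m - 1)"
    and f: "f \<in> carrier_vec m" "I = (\<lambda>v. f \<bullet> v) ` carrier_vec m"
    and syz: "{v \<in> carrier_vec m. f \<bullet> v = 0} = mat_image X"
    and ker: "mat_kernel X = {0\<^sub>v (m - 1)}"
    using assms(5) unfolding hilbert_burch_matrix_def Let_def m_def by blast
  have W: "Module.module ?R \<omega>" using \<omega> by (simp add: canonical_module_def)
  from monomial_ideal_principal_or_socle[OF mono assms(2)]
  consider a b where "I = {z. xymon a b dvd z}"
    | p q where "xymon p q \<notin> I" "xymon (Suc p) q \<in> I" "xymon p (Suc q) \<in> I" by blast
  then have "I \<subseteq> minors_ideal X (int m - 2) \<and> trace_ideal ?R \<omega> = coset I ` minors_ideal X (int m - 2)"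
  proof cases
    case 1
    have "m \<le> 1" unfolding m_def by (rule min_gens_principal[OF 1])
    then have "minors_ideal X (int m - 2) = UNIV" by (simp add: minors_ideal_def)
    moreover have "(a, b) \<noteq> (0, 0)" using 1 assms(3) by auto
    then have "trace_ideal ?R \<omega> = range (coset I)"
      using trace_of_principal_quotient[OF 1 xymon_nz I _ \<omega>] krull_dim_principal 1 by blast
    ultimately show ?thesis by simp
  next
    case 2
    have dim: "krull_dim ?R = 0" by (rule krull_dim_0_if_socle[OF mono assms(4) 2])
    then have d: "krull_dim ?R = enat 0" "2 - 0 = Suc 1" by (simp_all add: zero_enat_def)
    obtain N0 M where pure: "xymon N0 0 \<in> I" "xymon 0 M \<in> I"
      using pure_powers_if_krull_dim_0[OF mono dim] by blast
    obtain N \<beta> where st: "staircase I N \<beta>" using staircase_of_pure_powers[OF mono assms(3) pure] .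
    interpret staircase I N \<beta> by (rule st)
    have m2: "2 \<le> m"
    proof (rule ccontr)
      assume "\<not> 2 \<le> m"
      then have m: "m = 0 \<or> m = 1" "m - 1 = 0" by auto
      obtain v where v: "v \<in> carrier_vec m" "f \<bullet> v = xymon N0 0" using pure(1) unfolding f(2) by auto
      obtain w where w: "w \<in> carrier_vec m" "f \<bullet> w = xymon 0 M" using pure(2) unfolding f(2) by auto
      have "m \<noteq> 0"
      proof
        assume "m = 0"
        then have "f \<bullet> v = 0" using v(1) by (simp add: scalar_prod_def)
        then show False using v(2) by simp
      qed
      then have m1: "m = 1" using m by simp
      let ?z = "xymon N0 0 \<cdot>\<^sub>v w - xymon 0 M \<cdot>\<^sub>v v"
      \<comment> \<open>\<open>X\<close> has no columns, but \<open>z\<close> comes from the Koszul relation between \<open>x\<^sup>N\<close> and \<open>y\<^sup>M\<close>.\<close>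
      have "f \<bullet> ?z = 0"
        using f(1) v w scalar_prod_minus_distrib[OF f(1), of "xymon N0 0 \<cdot>\<^sub>v w" "xymon 0 M \<cdot>\<^sub>v v"]
        by (simp add: mult.commute)
      moreover have "?z \<in> carrier_vec m" using v(1) w(1) by simp
      ultimately have "?z \<in> mat_image X" using syz by blast
      moreover have "mat_image X = {0\<^sub>v m}"
        using X mult_mat_zero_vec[OF X] unfolding m(2) by (simp add: mat_image_def carrier_vec_0_eq)
      ultimately have "?z $ 0 = 0" using m1 by simp
      then have "v $ 0 * xymon 0 M = w $ 0 * xymon N0 0" using v(1) w(1) m1 by (simp add: mult.commute)
      then obtain c where c: "v $ 0 = xymon N0 0 * c" using xpower_dvd_of_ypower_mult by (metis dvdE)
      have "xymon N0 0 * 1 = f $ 0 * v $ 0" using v m1 by (simp add: scalar_prod_def)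
      also have "\<dots> = xymon N0 0 * (f $ 0 * c)" by (simp add: c ac_simps)
      finally have "1 = f $ 0 * c" by (simp only: mult_cancel_left xymon_nz simp_thms)
      moreover have "f $ 0 = f \<bullet> unit_vec m 0" using f(1) m1 by simp
      then have "f $ 0 \<in> I" unfolding f(2) by (simp add: image_iff) (metis unit_vec_carrier)
      ultimately have "1 \<in> I" using class_ideal_mult_right[OF I] by metis
      then show False using class_ideal_one_imp_UNIV[OF I] assms(3) by simp
    qed
    have "I \<subseteq> minors_ideal X (int m - 2)" by (rule ideal_subset_minors[OF f X syz])
    moreover have "trace_ideal ?R \<omega> \<subseteq> coset I ` minors_ideal X (int m - 2)"
    proof -
      obtain g r A where R: "quot_resolution I g r A" "r 2 = N" "r 3 = 0" "A 1 = X0"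
        using quot_resolution_length_two[OF u_carrier ideal_eq_image X0_carrier syzygies_u kernel_X0] by metis
      then obtain \<eta> where \<eta>: "linear_cover I \<omega> (carrier_vec N) (mat_image (X0\<^sup>T)) \<eta>"
        using canonical_module_linear_cover[OF I \<omega> d R(1)] by (auto simp: numeral_eq_Suc)
      show ?thesis
        by (rule trace_ideal_subset[OF I \<eta> X0_carrier W minors_ideal_ideal],
            rule kernel_entry_mem_minors[OF f X syz]) auto
    qed
    moreover have "coset I ` minors_ideal X (int m - 2) \<subseteq> trace_ideal ?R \<omega>"
    proof -
      obtain g r A where R: "quot_resolution I g r A" "r 2 = m - 1" "r 3 = 0" "A 1 = X"
        using quot_resolution_length_two[OF f X syz ker] by metis
      then obtain \<eta> where \<eta>: "linear_cover I \<omega> (carrier_vec (m - 1)) (mat_image (X\<^sup>T)) \<eta>"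
        using canonical_module_linear_cover[OF I \<omega> d R(1)] by (auto simp: numeral_eq_Suc)
      let ?J = "{s. coset I s \<in> trace_ideal ?R \<omega>}"
      have J: "ideal ?J class_ring" by (rule trace_ideal_preimage(1)[OF I])
      have col: "f \<bullet> col X t = 0" if "t < m - 1" for t
        using mat_image_mult[OF X, of "unit_vec (m - 1) t"] mult_mat_vec_unit[OF X that] syz by auto
      have "minors_ideal X (int (m - 2)) \<subseteq> ?J"
      proof (rule minors_ideal_subset[OF X J])
        fix A B assume AB: "A \<subseteq> {..<m}" "B \<subseteq> {..<m - 1}" "card A = m - 2" "card B = m - 2"
        let ?D = "det (mat (m - 2) (m - 2) (\<lambda>(i, j). X $$ (pick A i, pick B j)))"
        obtain w k where w: "w \<in> carrier_vec (m - 1)" "\<And>l. l < m \<Longrightarrow> (X *\<^sub>v w) $ l \<in> I" "k < m - 1"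
          "w $ k = (- 1) ^ k * ?D"
          using minor_is_entry[OF f(1) m2 I f(2) pure X col AB(1,3,2,4)] by metis
        have "w $ k \<in> ?J" using coset_mem_trace_ideal[OF I \<eta> X w(1,2,3) W] by simp
        then have "(- 1) ^ k * w $ k \<in> ?J" by (rule class_ideal_mult[OF J])
        moreover have "(- 1) ^ k * w $ k = ?D"
          unfolding w(4) by (simp add: mult.assoc[symmetric] power_add[symmetric])
        ultimately show "?D \<in> ?J" by simp
      qed
      moreover have "int (m - 2) = int m - 2" using m2 by simp
      ultimately show ?thesis by auto
    qed
    ultimately show ?thesis by blast
  qed
  then show ?thesis unfolding m_def .
qed

end
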